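(* Let $\mathcal F\subseteq\mathsf{FO}$ be a $\mathsf{suc}$-stable and order-stable fragment. For all $\pi$-terms $s,t\in T_\Lambda$ the following are equivalent: (1) The identity $s=t$ holds in the syntactic semigroup of every language definable in $\mathcal F$ over non-empty words (i.e., of every language $L=\{w\in A^+\mid w\models\varphi\}$ with $A\subseteq\Lambda$ a finite alphabet and $\varphi\in\mathcal F$ a sentence). (2) Duplicator has winning strategies in the $\mathcal F$-games on $([\![s]\!]_\varrho,[\![t]\!]_\varrho)$ and on $([\![t]\!]_\varrho,[\![s]\!]_\varrho)$.
   Context: Fix a countably infinite set $\Lambda$ of letters and a countably infinite set $\mathbb V$ of first-order variables. $\pi$-terms. A $\pi$-algebra is a set with an associative binary operation (written as juxtaposition) and a unary operation $u\mapsto u^\pi$. $T_\Lambda$ is the free $\pi$-algebra generated by $\Lambda$; its elements are the $\pi$-terms. For a finite semigroup $S$, the idempotency algebra on $S$ is the $\pi$-algebra on $S$ in which $u^\pi$ is the unique idempotent in $\{u^k\mid k\ge1\}$. An identity $s=t$ of $\pi$-terms holds in $S$ if $h(s)=h(t)$ for every $\pi$-algebra morphism $h$ from $T_\Lambda$ into the idempotency algebra on $S$. Words. A (generalized) word $u$ is a (possibly empty) linear order $(\mathrm{dom}(u),\le_u)$ with a labeling $\mathrm{dom}(u)\to\Lambda$, $p\mapsto u(p)$; isomorphic words are identified. $\Lambda^{\mathsf{LO}}$ is the set of countable words; finite words $\Lambda^*$ are regarded as words with domain $\{1,\dots,n\}$. $uv$ is concatenation (all positions of $u$ before those of $v$).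 For a countable order type $\tau$ represented by $(T,\le_T)$, $u^\tau$ has domain $\mathrm{dom}(u)\times T$, $(p,t)\le(p',t')$ iff $t<_Tt'$, or $t=t'$ and $p\le_u p'$, and label $u(p)$ at $(p,t)$ (i.e. $\tau$ copies of $u$). $[\![\cdot]\!]_\tau:T_\Lambda\to\Lambda^{\mathsf{LO}}$ is the unique $\pi$-algebra morphism sending each $a\in\Lambda$ to the one-position word labeled $a$, where $\Lambda^{\mathsf{LO}}$ carries concatenation and $u^\pi=u^\tau$. Let $\varrho=\omega+\zeta\cdot\eta+\omega^*$, where $\omega,\zeta,\eta,\omega^*$ are the order types of $\mathbb N,\mathbb Z,\mathbb Q,\mathbb Z_{<0}$ and $\zeta\cdot\eta$ denotes $\eta$ copies of $\zeta$. Logic. $\mathsf{FO}$ is the set of formulae built from the atoms $\top,\bot,\mathsf{empty},x=y,\lambda(x)=a,x<y,x\le y,\mathsf{suc}(x,y),\mathsf{min}(x),\mathsf{max}(x)$ ($x,y\in\mathbb V$, $a\in\Lambda$) by $\neg,\vee,\wedge,\exists x,\forall x$. $\mathrm{FV}(\varphi)$ is the set of free variables; a sentence has none; a literal is an atom or a negated atom. For finite $\mathbb X\subseteq\mathbb V$, an $\mathbb X$-valuation $\langle u,\alpha\rangle$ is a word $u\in\Lambda^{\mathsf{LO}}$ with a map $\alpha:\mathbb X\to\mathrm{dom}(u)$; $\langle u,\alpha\rangle\models\varphi$ (for $\mathrm{FV}(\varphi)\subseteq\mathbb X$) is the usual semantics: variables range over positions, $\lambda$ is the labeling, $\mathsf{empty}$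 says the domain is empty, $\mathsf{suc}(x,y)$ says $y$ is the immediate successor of $x$, $\mathsf{min}(x)$/$\mathsf{max}(x)$ say $x$ is the least/greatest position. A word $u$ is identified with the $\emptyset$-valuation on $u$. For finite $A\subseteq\Lambda$, $A^+$ is the set of non-empty finite words over $A$. For $L\subseteq A^+$ the syntactic semigroup of $L$ is $A^+/{\equiv_L}$, where for $u,v\in A^+$: $u\equiv_Lv$ iff for all $x,y\in A^*$, $xuy\in L\Leftrightarrow xvy\in L$. Languages defined by sentences are regular, so these semigroups are finite. Fragments. A context $\mu$ is a formula with a unique occurrence of an extra constant predicate $\circ$; $\mu(\varphi)$ is the result of replacing $\circ$ by $\varphi$. A fragment is a non-empty set $\mathcal F\subseteq\mathsf{FO}$ such that for all contexts $\mu$, $\varphi,\psi\in\mathsf{FO}$, $a\in\Lambda$, $x,y\in\mathbb V$: (i) if $\mu(\varphi)\in\mathcal F$ then $\mu(\top),\mu(\bot),\mu(\lambda(x)=a)\in\mathcal F$; (ii) $\mu(\varphi\vee\psi)\in\mathcal F$ iff $\mu(\varphi),\mu(\psi)\in\mathcal F$; (iii) $\mu(\varphi\wedge\psi)\in\mathcal F$ iff $\mu(\varphi),\mu(\psi)\in\mathcal F$; (iv) $\mu(\neg\neg\varphi)\in\mathcal F$ implies $\mu(\varphi)\in\mathcal F$; (v) if $\mu(\exists x\,\varphi)\in\mathcal F$ and $x\notin\mathrm{FV}(\varphi)$ then $\mu(\varphi)\in\mathcal F$; (vi) if $\mu(\forall x\,\varphi)\in\mathcal F$ and $x\notin\mathrm{FV}(\varphi)$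 then $\mu(\varphi)\in\mathcal F$. It is order-stable if for all $\mu,x,y$: $\mu(x<y)\in\mathcal F$ iff $\mu(x\le y)\in\mathcal F$. It is $\mathsf{suc}$-stable if for all $\mu,x,y$: $\mu(\mathsf{suc}(x,y))\in\mathcal F$ implies $\mu(x=y),\mu(\mathsf{max}(x)),\mu(\mathsf{min}(y))\in\mathcal F$; and $\mu(\mathsf{min}(x))\in\mathcal F$ or $\mu(\mathsf{max}(x))\in\mathcal F$ implies $\mu(\mathsf{empty})\in\mathcal F$. Game. Let $\mathcal Q=\{\exists,\forall,\neg\exists,\neg\forall\}$. For $\mathsf Q\in\mathcal Q$ and $x\in\mathbb V$ the reduct is $\mathcal F/\mathsf Qx=\{\varphi\in\mathsf{FO}\mid\mathsf Qx\,\varphi\in\mathcal F\}$ (a fragment whenever non-empty). A configuration is a triple $(\mathcal G,\langle u,\alpha\rangle,\langle v,\beta\rangle)$ with $\mathcal G$ a fragment and $\langle u,\alpha\rangle,\langle v,\beta\rangle$ $\mathbb X$-valuations for the same finite $\mathbb X\subseteq\mathbb V$. If there is a literal $\varphi\in\mathcal G$ with $\mathrm{FV}(\varphi)\subseteq\mathbb X$, $\langle u,\alpha\rangle\models\varphi$ and $\langle v,\beta\rangle\not\models\varphi$, the game stops and Spoiler wins. Otherwise a round is played: Spoiler chooses $\mathsf Q\in\mathcal Q$ and $x\in\mathbb V$ with $\mathcal G/\mathsf Qx\ne\emptyset$, and then a position $q$, in $\mathrm{dom}(u)$ if $\mathsf Q\in\{\exists,\neg\forall\}$ and in $\mathrm{dom}(v)$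 if $\mathsf Q\in\{\forall,\neg\exists\}$; Duplicator chooses a position $r$ in the domain of the other word. With $\alpha[x/p]$ denoting $\alpha$ with the value at $x$ set (or reset) to $p$, the next configuration is, for $\exists$: $(\mathcal G/\exists x,\langle u,\alpha[x/q]\rangle,\langle v,\beta[x/r]\rangle)$; for $\forall$: $(\mathcal G/\forall x,\langle u,\alpha[x/r]\rangle,\langle v,\beta[x/q]\rangle)$; for $\neg\exists$: $(\mathcal G/\neg\exists x,\langle v,\beta[x/q]\rangle,\langle u,\alpha[x/r]\rangle)$; for $\neg\forall$: $(\mathcal G/\neg\forall x,\langle v,\beta[x/r]\rangle,\langle u,\alpha[x/q]\rangle)$. A player unable to make a required choice loses immediately. Duplicator wins all infinite plays. The $\mathcal F$-game on $(u,v)$ starts in the configuration $(\mathcal F,u,v)$ with $\mathbb X=\emptyset$. *)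

theory Defs
  imports Complex_Main "HOL-Library.Countable" "HOL-Library.Infinite_Typeclass"
begin

text \<open>
  Throughout, \<open>'a\<close> is the set of letters and \<open>'v\<close> the set of first-order variables. Both are
  constrained to be countably infinite (sort \<open>{countable, infinite}\<close>) in the theorem.
\<close>

section \<open>\<open>\<pi>\<close>-algebras and \<open>\<pi>\<close>-terms\<close>

definition pi_algebra :: "'s set \<Rightarrow> ('s \<Rightarrow> 's \<Rightarrow> 's) \<Rightarrow> ('s \<Rightarrow> 's) \<Rightarrow> bool" where
  "pi_algebra C m p \<longleftrightarrow>
     (\<forall>x\<in>C. \<forall>y\<in>C. m x y \<in> C) \<and>
     (\<forall>x\<in>C. \<forall>y\<in>C. \<forall>z\<in>C. m (m x y) z = m x (m y z)) \<and>
     (\<forall>x\<in>C. p x \<in> C)"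

text \<open>
  The free \<open>\<pi>\<close>-algebra, built from associativity normal forms: every \<open>\<pi>\<close>-term is uniquely a
  non-empty product, bracketed to the right, of letters and \<open>\<pi>\<close>-powers. \<open>LetterCat a t\<close> stands
  for \<open>a t\<close> and \<open>PowCat s t\<close> for \<open>s\<^sup>\<pi> t\<close>. That this is the free \<open>\<pi>\<close>-algebra over \<open>'a\<close> is shown in
  \<open>pterm_pi_algebra\<close> and \<open>pterm_free\<close>.
\<close>
datatype 'a pterm =
    Letter 'a
  | Pow "'a pterm"
  | LetterCat 'a "'a pterm"
  | PowCat "'a pterm" "'a pterm"

primrec pcat :: "'a pterm \<Rightarrow> 'a pterm \<Rightarrow> 'a pterm" where
  "pcat (Letter a) t = LetterCat a t"
| "pcat (Pow s) t = PowCat s t"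
| "pcat (LetterCat a s) t = LetterCat a (pcat s t)"
| "pcat (PowCat r s) t = PowCat r (pcat s t)"

definition pi_hom :: "'s set \<Rightarrow> ('s \<Rightarrow> 's \<Rightarrow> 's) \<Rightarrow> ('s \<Rightarrow> 's) \<Rightarrow> ('a pterm \<Rightarrow> 's) \<Rightarrow> bool" where
  "pi_hom C m p h \<longleftrightarrow>
     (\<forall>t. h t \<in> C) \<and> (\<forall>s t. h (pcat s t) = m (h s) (h t)) \<and> (\<forall>t. h (Pow t) = p (h t))"

lemma pcat_assoc: "pcat (pcat r s) t = pcat r (pcat s t)"
  by (induction r) auto

lemma pterm_pi_algebra: "pi_algebra UNIV pcat Pow"
  by (simp add: pi_algebra_def pcat_assoc)

lemma pterm_free:
  assumes alg: "pi_algebra C m p" and g: "\<And>a. g a \<in> C"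
  shows "\<exists>!h. pi_hom C m p h \<and> (\<forall>a. h (Letter a) = g a)"
proof -
  have mC: "\<And>x y. x \<in> C \<Longrightarrow> y \<in> C \<Longrightarrow> m x y \<in> C"
    and mA: "\<And>x y z. x \<in> C \<Longrightarrow> y \<in> C \<Longrightarrow> z \<in> C \<Longrightarrow> m (m x y) z = m x (m y z)"
    and pC: "\<And>x. x \<in> C \<Longrightarrow> p x \<in> C"
    using alg by (auto simp: pi_algebra_def)
  define h where "h = rec_pterm g (\<lambda>_ x. p x) (\<lambda>a _ x. m (g a) x) (\<lambda>_ _ x y. m (p x) y)"
  have h_simps: "h (Letter a) = g a" "h (Pow s) = p (h s)"
    "h (LetterCat a s) = m (g a) (h s)" "h (PowCat s t) = m (p (h s)) (h t)" for a s t
    by (simp_all add: h_def)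
  have hC: "h t \<in> C" for t
    by (induction t) (auto simp: h_simps g mC pC)
  have "h (pcat s t) = m (h s) (h t)" for s t
    by (induction s) (auto simp: h_simps g mA pC hC)
  then have ex: "pi_hom C m p h \<and> (\<forall>a. h (Letter a) = g a)"
    by (simp add: pi_hom_def hC h_simps)
  moreover have "k = h" if k: "pi_hom C m p k \<and> (\<forall>a. k (Letter a) = g a)" for k
  proof
    fix t
    have cat: "k (LetterCat a s) = m (g a) (k s)" "k (PowCat r s) = m (p (k r)) (k s)" for a r s
      using k unfolding pi_hom_def by (metis pcat.simps(1), metis pcat.simps(2))
    show "k t = h t"
      by (induction t) (use k in \<open>auto simp: cat h_simps pi_hom_def\<close>)
  qed
  ultimately show ?thesis by blast
qed


section \<open>Identities in finite semigroups and syntactic semigroups\<close>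

text \<open>The powers \<open>u\<^sup>k\<close> with \<open>k \<ge> 1\<close> are written \<open>(m u ^^ n) u\<close> with \<open>n = k - 1\<close>.\<close>
definition idem_power :: "('s \<Rightarrow> 's \<Rightarrow> 's) \<Rightarrow> 's \<Rightarrow> 's" where
  "idem_power m u = (THE e. m e e = e \<and> (\<exists>n. e = (m u ^^ n) u))"

definition identity_holds ::
    "'s set \<Rightarrow> ('s \<Rightarrow> 's \<Rightarrow> 's) \<Rightarrow> 'a pterm \<Rightarrow> 'a pterm \<Rightarrow> bool" where
  "identity_holds S m s t \<longleftrightarrow> (\<forall>h. pi_hom S m (idem_power m) h \<longrightarrow> h s = h t)"

definition nonempty_words :: "'a set \<Rightarrow> 'a list set" where
  "nonempty_words A = lists A - {[]}"

definition synt_cong :: "'a set \<Rightarrow> 'a list set \<Rightarrow> ('a list \<times> 'a list) set" where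
  "synt_cong A L = {(u, v). u \<in> nonempty_words A \<and> v \<in> nonempty_words A \<and>
     (\<forall>x\<in>lists A. \<forall>y\<in>lists A. x @ u @ y \<in> L \<longleftrightarrow> x @ v @ y \<in> L)}"

definition synt_semigroup :: "'a set \<Rightarrow> 'a list set \<Rightarrow> 'a list set set" where
  "synt_semigroup A L = nonempty_words A // synt_cong A L"

definition synt_mult ::
    "'a set \<Rightarrow> 'a list set \<Rightarrow> 'a list set \<Rightarrow> 'a list set \<Rightarrow> 'a list set" where
  "synt_mult A L X Y = (\<Union>u\<in>X. \<Union>v\<in>Y. synt_cong A L `` {u @ v})"

lemma equiv_synt_cong: "equiv (nonempty_words A) (synt_cong A L)"
  by (auto simp: equiv_def refl_on_def sym_def trans_def synt_cong_def)

lemma synt_mult_class: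
  assumes "u \<in> nonempty_words A" "v \<in> nonempty_words A"
  shows "synt_mult A L (synt_cong A L `` {u}) (synt_cong A L `` {v}) = synt_cong A L `` {u @ v}"
proof -
  have "congruent2 (synt_cong A L) (synt_cong A L) (\<lambda>u v. synt_cong A L `` {u @ v})"
  proof (rule congruent2I')
    fix u u' v v'
    assume uu: "(u, u') \<in> synt_cong A L" and vv: "(v, v') \<in> synt_cong A L"
    have "x @ (u @ v) @ y \<in> L \<longleftrightarrow> x @ (u' @ v') @ y \<in> L"
      if x: "x \<in> lists A" and y: "y \<in> lists A" for x y
    proof -
      have "v @ y \<in> lists A" "x @ u' \<in> lists A"
        using uu vv x y by (auto simp: synt_cong_def nonempty_words_def)
      then have "x @ u @ (v @ y) \<in> L \<longleftrightarrow> x @ u' @ (v @ y) \<in> L"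
        and "(x @ u') @ v @ y \<in> L \<longleftrightarrow> (x @ u') @ v' @ y \<in> L"
        using uu vv x y unfolding synt_cong_def by blast+
      then show ?thesis by simp
    qed
    then have "(u @ v, u' @ v') \<in> synt_cong A L"
      using uu vv by (auto simp: synt_cong_def nonempty_words_def)
    then show "synt_cong A L `` {u @ v} = synt_cong A L `` {u' @ v'}"
      by (rule equiv_class_eq[OF equiv_synt_cong])
  qed
  then show ?thesis
    unfolding synt_mult_def
    by (rule UN_equiv_class2[OF equiv_synt_cong equiv_synt_cong _ assms])
qed


section \<open>Linear orders and generalized words\<close>

text \<open>
  Linear orders are reflexive relations with domain \<open>Field r\<close>. \<open>order_copies r t\<close> is the order
  made of \<open>t\<close> copies of \<open>r\<close>, i.e. \<open>r \<cdot> t\<close> with the second component most significant.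
\<close>
definition order_sum :: "'p rel \<Rightarrow> 'q rel \<Rightarrow> ('p + 'q) rel" where
  "order_sum r s =
     {(Inl x, Inl y) |x y. (x, y) \<in> r} \<union>
     {(Inr x, Inr y) |x y. (x, y) \<in> s} \<union>
     {(Inl x, Inr y) |x y. x \<in> Field r \<and> y \<in> Field s}"

definition order_copies :: "'p rel \<Rightarrow> 'i rel \<Rightarrow> ('p \<times> 'i) rel" where
  "order_copies r t =
     {((p, i), (q, j)) |p i q j.
        p \<in> Field r \<and> q \<in> Field r \<and> i \<in> Field t \<and> j \<in> Field t \<and>
        ((i, j) \<in> t \<and> i \<noteq> j \<or> i = j \<and> (p, q) \<in> r)}"

definition order_omega :: "nat rel" where
  "order_omega = {(m, n). m \<le> n}"

definition order_zeta :: "int rel" where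
  "order_zeta = {(i, j). i \<le> j}"

definition order_eta :: "rat rel" where
  "order_eta = {(p, q). p \<le> q}"

definition order_omega_star :: "int rel" where
  "order_omega_star = {(i, j). i \<le> j \<and> j < 0}"

definition order_rho :: "(nat + (int \<times> rat) + int) rel" where
  "order_rho =
     order_sum order_omega (order_sum (order_copies order_zeta order_eta) order_omega_star)"

text \<open>
  A countable word is represented with a set of natural numbers as its domain
  \<open>Field (word_ord u)\<close>; every countable linear order has such a copy. Values of \<open>letter_at u\<close>
  outside the domain are irrelevant. Isomorphic words are not identified by equality: every notion
  below depends on words only up to \<open>word_iso\<close>.
\<close>
record 'a gword =
  word_ord :: "nat rel"
  letter_at :: "nat \<Rightarrow> 'a"

definition wf_word :: "'a gword \<Rightarrow> bool" where
  "wf_word u \<longleftrightarrow> Linear_order (word_ord u)"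

abbreviation positions :: "'a gword \<Rightarrow> nat set" where
  "positions u \<equiv> Field (word_ord u)"

definition word_iso :: "'a gword \<Rightarrow> 'a gword \<Rightarrow> bool" where
  "word_iso u v \<longleftrightarrow> (\<exists>f. bij_betw f (positions u) (positions v) \<and>
     (\<forall>p\<in>positions u. letter_at u p = letter_at v (f p)) \<and>
     (\<forall>p\<in>positions u. \<forall>q\<in>positions u. (p, q) \<in> word_ord u \<longleftrightarrow> (f p, f q) \<in> word_ord v))"

definition finite_word :: "'a list \<Rightarrow> 'a gword" where
  "finite_word w =
     \<lparr>word_ord = {(i, j). 1 \<le> i \<and> i \<le> j \<and> j \<le> length w}, letter_at = (\<lambda>i. w ! (i - 1))\<rparr>"

text \<open>
  Concatenation and powers live on \<open>nat + nat\<close> and \<open>nat \<times> 'i\<close>, and are moved back to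
  natural numbers along the injection \<open>to_nat\<close>, whose left inverse is \<open>from_nat\<close>.
\<close>
definition word_concat :: "'a gword \<Rightarrow> 'a gword \<Rightarrow> 'a gword" where
  "word_concat u v =
     \<lparr>word_ord = dir_image (order_sum (word_ord u) (word_ord v)) to_nat,
      letter_at = (\<lambda>n. case from_nat n of Inl p \<Rightarrow> letter_at u p | Inr q \<Rightarrow> letter_at v q)\<rparr>"

definition word_power :: "'a gword \<Rightarrow> 'i::countable rel \<Rightarrow> 'a gword" where
  "word_power u \<tau> =
     \<lparr>word_ord = dir_image (order_copies (word_ord u) \<tau>) to_nat,
      letter_at = (\<lambda>n. letter_at u (fst (from_nat n :: nat \<times> 'i)))\<rparr>"

text \<open>
  The morphism \<open>t \<mapsto> [[t]]\<^sub>\<tau>\<close>, computed along normal forms. Its compatibility with products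
  (up to isomorphism) is \<open>eval_pcat\<close>.
\<close>
primrec eval_pterm :: "'i::countable rel \<Rightarrow> 'a pterm \<Rightarrow> 'a gword" where
  "eval_pterm \<tau> (Letter a) = finite_word [a]"
| "eval_pterm \<tau> (Pow s) = word_power (eval_pterm \<tau> s) \<tau>"
| "eval_pterm \<tau> (LetterCat a t) = word_concat (finite_word [a]) (eval_pterm \<tau> t)"
| "eval_pterm \<tau> (PowCat s t) = word_concat (word_power (eval_pterm \<tau> s) \<tau>) (eval_pterm \<tau> t)"

lemma Field_order_sum: "Field (order_sum r s) = Inl ` Field r \<union> Inr ` Field s"
  unfolding order_sum_def Field_def by (auto simp: image_iff Domain_iff Range_iff)

lemma Linear_order_order_sum:
  assumes "Linear_order r" "Linear_order s"
  shows "Linear_order (order_sum r s)"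
  unfolding order_on_defs
proof (intro conjI)
  note d = assms[unfolded order_on_defs]
  show "order_sum r s \<subseteq> Field (order_sum r s) \<times> Field (order_sum r s)"
    by (auto intro: FieldI1 FieldI2)
  show "Refl (order_sum r s)" using d
    unfolding refl_on_def Field_order_sum by (auto simp: order_sum_def)
  show "trans (order_sum r s)"
  proof (rule transI)
    fix a b c assume "(a, b) \<in> order_sum r s" "(b, c) \<in> order_sum r s"
    then show "(a, c) \<in> order_sum r s"
      using d unfolding order_sum_def by (auto intro: FieldI1 FieldI2 dest: transD)
  qed
  show "antisym (order_sum r s)" using d
    unfolding antisym_def order_sum_def by auto
  show "Total (order_sum r s)"
  proof (rule total_onI)
    fix a b assume "a \<in> Field (order_sum r s)" "b \<in> Field (order_sum r s)" "a \<noteq> b"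
    moreover have "(x, y) \<in> r \<or> (y, x) \<in> r" if "x \<in> Field r" "y \<in> Field r" "x \<noteq> y" for x y
      using that d by (simp add: total_on_def)
    moreover have "(x, y) \<in> s \<or> (y, x) \<in> s" if "x \<in> Field s" "y \<in> Field s" "x \<noteq> y" for x y
      using that d by (simp add: total_on_def)
    ultimately show "(a, b) \<in> order_sum r s \<or> (b, a) \<in> order_sum r s"
      unfolding Field_order_sum by (cases a; cases b) (auto simp: order_sum_def)
  qed
qed

lemma Field_order_copies:
  assumes "Linear_order r" "Linear_order t"
  shows "Field (order_copies r t) = Field r \<times> Field t"
proof -
  have "((p, i), (p, i)) \<in> order_copies r t" if "p \<in> Field r" "i \<in> Field t" for p i
    using that assms by (auto simp: order_copies_def order_on_defs refl_on_def)
  then have "Field r \<times> Field t \<subseteq> Field (order_copies r t)"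
    by (auto intro: FieldI1)
  moreover have "Field (order_copies r t) \<subseteq> Field r \<times> Field t"
    by (auto simp: order_copies_def Field_def)
  ultimately show ?thesis by blast
qed

lemma Linear_order_order_copies:
  assumes "Linear_order r" "Linear_order t"
  shows "Linear_order (order_copies r t)"
  unfolding order_on_defs
proof (intro conjI)
  note d = assms[unfolded order_on_defs]
  show "order_copies r t \<subseteq> Field (order_copies r t) \<times> Field (order_copies r t)"
    by (auto intro: FieldI1 FieldI2)
  show "Refl (order_copies r t)"
    using d unfolding refl_on_def Field_order_copies[OF assms] by (auto simp: order_copies_def)
  have tr: "\<And>x y z. (x, y) \<in> r \<Longrightarrow> (y, z) \<in> r \<Longrightarrow> (x, z) \<in> r"
      "\<And>x y z. (x, y) \<in> t \<Longrightarrow> (y, z) \<in> t \<Longrightarrow> (x, z) \<in> t"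
    and an: "\<And>x y. (x, y) \<in> r \<Longrightarrow> (y, x) \<in> r \<Longrightarrow> x = y"
      "\<And>x y. (x, y) \<in> t \<Longrightarrow> (y, x) \<in> t \<Longrightarrow> x = y"
    and tot: "\<And>x y. x \<in> Field r \<Longrightarrow> y \<in> Field r \<Longrightarrow> x \<noteq> y \<Longrightarrow> (x, y) \<in> r \<or> (y, x) \<in> r"
      "\<And>x y. x \<in> Field t \<Longrightarrow> y \<in> Field t \<Longrightarrow> x \<noteq> y \<Longrightarrow> (x, y) \<in> t \<or> (y, x) \<in> t"
    using d by (auto dest: transD antisymD simp: total_on_def)
  show "trans (order_copies r t)"
    by (rule transI) (auto simp: order_copies_def dest: tr an(2))
  show "antisym (order_copies r t)"
    by (rule antisymI) (auto simp: order_copies_def dest: an)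
  show "Total (order_copies r t)"
    unfolding total_on_def Field_order_copies[OF assms]
    by (auto simp: order_copies_def dest: tot)
qed

lemma Linear_order_rho: "Linear_order order_rho"
proof -
  have om: "Linear_order order_omega"
    by (auto simp: order_omega_def order_on_defs refl_on_def trans_def antisym_def total_on_def Field_def)
  have ze: "Linear_order order_zeta"
    by (auto simp: order_zeta_def order_on_defs refl_on_def trans_def antisym_def total_on_def Field_def)
  have et: "Linear_order order_eta"
    by (auto simp: order_eta_def order_on_defs refl_on_def trans_def antisym_def total_on_def Field_def)
  have os: "Linear_order order_omega_star"
    by (auto simp: order_omega_star_def order_on_defs refl_on_def trans_def antisym_def total_on_def Field_def)
  show ?thesis
    unfolding order_rho_def
    by (intro Linear_order_order_sum Linear_order_order_copies om ze et os)
qed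

lemma positions_finite_word: "positions (finite_word w) = {1..length w}"
  by (auto simp: finite_word_def Field_def)

lemma wf_finite_word: "wf_word (finite_word w)"
  unfolding wf_word_def order_on_defs
  by (auto simp: finite_word_def refl_on_def trans_def antisym_def total_on_def Field_def)

lemma wf_word_concat: "wf_word u \<Longrightarrow> wf_word v \<Longrightarrow> wf_word (word_concat u v)"
  unfolding wf_word_def word_concat_def
  by (auto intro!: Linear_order_dir_image Linear_order_order_sum intro: inj_on_subset)

lemma wf_word_power: "wf_word u \<Longrightarrow> Linear_order \<tau> \<Longrightarrow> wf_word (word_power u \<tau>)"
  unfolding wf_word_def word_power_def
  by (auto intro!: Linear_order_dir_image Linear_order_order_copies intro: inj_on_subset)

lemma wf_eval_pterm: "Linear_order \<tau> \<Longrightarrow> wf_word (eval_pterm \<tau> t)"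
  by (induction t) (auto intro: wf_finite_word wf_word_concat wf_word_power)

lemma word_iso_refl: "word_iso u u"
  unfolding word_iso_def by (rule exI[of _ id]) auto

lemma word_iso_trans:
  assumes "word_iso u v" "word_iso v w"
  shows "word_iso u w"
proof -
  obtain f g where f: "bij_betw f (positions u) (positions v)"
      "\<forall>p\<in>positions u. letter_at u p = letter_at v (f p)"
      "\<forall>p\<in>positions u. \<forall>q\<in>positions u. (p, q) \<in> word_ord u \<longleftrightarrow> (f p, f q) \<in> word_ord v"
    and g: "bij_betw g (positions v) (positions w)"
      "\<forall>p\<in>positions v. letter_at v p = letter_at w (g p)"
      "\<forall>p\<in>positions v. \<forall>q\<in>positions v. (p, q) \<in> word_ord v \<longleftrightarrow> (g p, g q) \<in> word_ord w"
    using assms unfolding word_iso_def by blast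
  show ?thesis
    unfolding word_iso_def
    by (rule exI[of _ "g \<circ> f"])
      (use f g bij_betwE[OF f(1)] bij_betw_trans[OF f(1) g(1)] in auto)
qed

abbreviation pos_left :: "nat \<Rightarrow> nat" where
  "pos_left p \<equiv> to_nat (Inl p :: nat + nat)"

abbreviation pos_right :: "nat \<Rightarrow> nat" where
  "pos_right p \<equiv> to_nat (Inr p :: nat + nat)"

lemma positions_word_concat:
  "positions (word_concat u v) = pos_left ` positions u \<union> pos_right ` positions v"
  by (simp add: word_concat_def dir_image_Field Field_order_sum image_Un image_image)

lemma word_ord_word_concat:
  "(pos_left p, pos_left q) \<in> word_ord (word_concat u v) \<longleftrightarrow> (p, q) \<in> word_ord u"
  "(pos_right p, pos_right q) \<in> word_ord (word_concat u v) \<longleftrightarrow> (p, q) \<in> word_ord v"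
  "(pos_left p, pos_right q) \<in> word_ord (word_concat u v) \<longleftrightarrow> p \<in> positions u \<and> q \<in> positions v"
  "(pos_right p, pos_left q) \<notin> word_ord (word_concat u v)"
  by (auto simp: word_concat_def dir_image_def order_sum_def)

lemma letter_at_word_concat:
  "letter_at (word_concat u v) (pos_left p) = letter_at u p"
  "letter_at (word_concat u v) (pos_right p) = letter_at v p"
  by (simp_all add: word_concat_def)

lemma word_iso_concat_right:
  assumes "word_iso v v'"
  shows "word_iso (word_concat u v) (word_concat u v')"
proof -
  obtain f where f: "bij_betw f (positions v) (positions v')"
      "\<forall>p\<in>positions v. letter_at v p = letter_at v' (f p)"
      "\<forall>p\<in>positions v. \<forall>q\<in>positions v. (p, q) \<in> word_ord v \<longleftrightarrow> (f p, f q) \<in> word_ord v'"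
    using assms unfolding word_iso_def by blast
  define g where "g n = (case from_nat n of Inl p \<Rightarrow> pos_left p | Inr q \<Rightarrow> pos_right (f q))" for n
  have g: "g (pos_left p) = pos_left p" "g (pos_right p) = pos_right (f p)" for p
    by (simp_all add: g_def)
  have inj: "inj_on f (positions v)" and im: "f ` positions v = positions v'"
    using f(1) by (auto simp: bij_betw_def)
  show ?thesis
    unfolding word_iso_def
  proof (rule exI[of _ g], intro conjI)
    show "bij_betw g (positions (word_concat u v)) (positions (word_concat u v'))"
    proof -
      have "inj_on g (positions (word_concat u v))"
        unfolding positions_word_concat
        by (rule inj_onI) (auto simp: g dest: inj_onD[OF inj])
      moreover have "g ` positions (word_concat u v) = positions (word_concat u v')"
        by (simp add: positions_word_concat image_Un image_image g im[symmetric])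
      ultimately show ?thesis by (simp add: bij_betw_def)
    qed
  qed (use f(2,3) im in \<open>auto simp: positions_word_concat word_ord_word_concat letter_at_word_concat g\<close>)
qed

lemma word_iso_concat_assoc:
  "word_iso (word_concat u (word_concat v w)) (word_concat (word_concat u v) w)"
proof -
  define g where "g n = (case from_nat n of Inl p \<Rightarrow> pos_left (pos_left p)
    | Inr m \<Rightarrow> (case from_nat m of Inl p \<Rightarrow> pos_left (pos_right p) | Inr q \<Rightarrow> pos_right q))" for n
  have g: "g (pos_left p) = pos_left (pos_left p)"
    "g (pos_right (pos_left p)) = pos_left (pos_right p)"
    "g (pos_right (pos_right p)) = pos_right p" for p
    by (simp_all add: g_def)
  show ?thesis
    unfolding word_iso_def
  proof (rule exI[of _ g], intro conjI)
    show "bij_betw g (positions (word_concat u (word_concat v w)))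
        (positions (word_concat (word_concat u v) w))"
      unfolding bij_betw_def positions_word_concat
      by (auto simp: inj_on_def g image_Un image_image)
  qed (auto simp: positions_word_concat word_ord_word_concat letter_at_word_concat g)
qed

lemma eval_pcat:
  "word_iso (eval_pterm \<tau> (pcat s t)) (word_concat (eval_pterm \<tau> s) (eval_pterm \<tau> t))"
  by (induction s)
    (auto intro: word_iso_refl word_iso_trans[OF word_iso_concat_right word_iso_concat_assoc])


section \<open>First-order logic on words\<close>

datatype ('v, 'a) atom =
    ATrue
  | AFalse
  | AEmpty
  | AEq 'v 'v
  | ALetter 'v 'a
  | ALess 'v 'v
  | ALeq 'v 'v
  | ASuc 'v 'v
  | AMin 'v
  | AMax 'v

datatype ('v, 'a) fm =
    Atom "('v, 'a) atom"
  | Neg "('v, 'a) fm"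
  | Or "('v, 'a) fm" "('v, 'a) fm"
  | And "('v, 'a) fm" "('v, 'a) fm"
  | Exi 'v "('v, 'a) fm"
  | All 'v "('v, 'a) fm"

primrec atom_vars :: "('v, 'a) atom \<Rightarrow> 'v set" where
  "atom_vars ATrue = {}"
| "atom_vars AFalse = {}"
| "atom_vars AEmpty = {}"
| "atom_vars (AEq x y) = {x, y}"
| "atom_vars (ALetter x a) = {x}"
| "atom_vars (ALess x y) = {x, y}"
| "atom_vars (ALeq x y) = {x, y}"
| "atom_vars (ASuc x y) = {x, y}"
| "atom_vars (AMin x) = {x}"
| "atom_vars (AMax x) = {x}"

primrec FV :: "('v, 'a) fm \<Rightarrow> 'v set" where
  "FV (Atom A) = atom_vars A"
| "FV (Neg \<phi>) = FV \<phi>"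
| "FV (Or \<phi> \<psi>) = FV \<phi> \<union> FV \<psi>"
| "FV (And \<phi> \<psi>) = FV \<phi> \<union> FV \<psi>"
| "FV (Exi x \<phi>) = FV \<phi> - {x}"
| "FV (All x \<phi>) = FV \<phi> - {x}"

definition sentence :: "('v, 'a) fm \<Rightarrow> bool" where
  "sentence \<phi> \<longleftrightarrow> FV \<phi> = {}"

definition literal :: "('v, 'a) fm \<Rightarrow> bool" where
  "literal \<phi> \<longleftrightarrow> (\<exists>A. \<phi> = Atom A \<or> \<phi> = Neg (Atom A))"

text \<open>
  An \<open>X\<close>-valuation is a word with a finite partial map \<open>\<alpha>\<close> to its positions, where
  \<open>X = dom \<alpha>\<close>. Satisfaction is only meaningful when \<open>FV \<phi> \<subseteq> dom \<alpha>\<close>.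
\<close>
type_synonym ('v, 'a) valuation = "'a gword \<times> ('v \<rightharpoonup> nat)"

definition pos_less :: "'a gword \<Rightarrow> nat \<Rightarrow> nat \<Rightarrow> bool" where
  "pos_less u p q \<longleftrightarrow> (p, q) \<in> word_ord u \<and> p \<noteq> q"

primrec sat_atom :: "'a gword \<Rightarrow> ('v \<rightharpoonup> nat) \<Rightarrow> ('v, 'a) atom \<Rightarrow> bool" where
  "sat_atom u \<alpha> ATrue \<longleftrightarrow> True"
| "sat_atom u \<alpha> AFalse \<longleftrightarrow> False"
| "sat_atom u \<alpha> AEmpty \<longleftrightarrow> positions u = {}"
| "sat_atom u \<alpha> (AEq x y) \<longleftrightarrow> the (\<alpha> x) = the (\<alpha> y)"
| "sat_atom u \<alpha> (ALetter x a) \<longleftrightarrow> letter_at u (the (\<alpha> x)) = a"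
| "sat_atom u \<alpha> (ALess x y) \<longleftrightarrow> pos_less u (the (\<alpha> x)) (the (\<alpha> y))"
| "sat_atom u \<alpha> (ALeq x y) \<longleftrightarrow> (the (\<alpha> x), the (\<alpha> y)) \<in> word_ord u"
| "sat_atom u \<alpha> (ASuc x y) \<longleftrightarrow> pos_less u (the (\<alpha> x)) (the (\<alpha> y)) \<and>
     \<not> (\<exists>p\<in>positions u. pos_less u (the (\<alpha> x)) p \<and> pos_less u p (the (\<alpha> y)))"
| "sat_atom u \<alpha> (AMin x) \<longleftrightarrow> (\<forall>p\<in>positions u. (the (\<alpha> x), p) \<in> word_ord u)"
| "sat_atom u \<alpha> (AMax x) \<longleftrightarrow> (\<forall>p\<in>positions u. (p, the (\<alpha> x)) \<in> word_ord u)"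

primrec sat :: "'a gword \<Rightarrow> ('v \<rightharpoonup> nat) \<Rightarrow> ('v, 'a) fm \<Rightarrow> bool" where
  "sat u \<alpha> (Atom A) \<longleftrightarrow> sat_atom u \<alpha> A"
| "sat u \<alpha> (Neg \<phi>) \<longleftrightarrow> \<not> sat u \<alpha> \<phi>"
| "sat u \<alpha> (Or \<phi> \<psi>) \<longleftrightarrow> sat u \<alpha> \<phi> \<or> sat u \<alpha> \<psi>"
| "sat u \<alpha> (And \<phi> \<psi>) \<longleftrightarrow> sat u \<alpha> \<phi> \<and> sat u \<alpha> \<psi>"
| "sat u \<alpha> (Exi x \<phi>) \<longleftrightarrow> (\<exists>p\<in>positions u. sat u (\<alpha>(x \<mapsto> p)) \<phi>)"
| "sat u \<alpha> (All x \<phi>) \<longleftrightarrow> (\<forall>p\<in>positions u. sat u (\<alpha>(x \<mapsto> p)) \<phi>)"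

definition language :: "'a set \<Rightarrow> ('v, 'a) fm \<Rightarrow> 'a list set" where
  "language A \<phi> = {w \<in> nonempty_words A. sat (finite_word w) Map.empty \<phi>}"


section \<open>Fragments\<close>

datatype ('v, 'a) fctx =
    Hole
  | CNeg "('v, 'a) fctx"
  | COrL "('v, 'a) fctx" "('v, 'a) fm"
  | COrR "('v, 'a) fm" "('v, 'a) fctx"
  | CAndL "('v, 'a) fctx" "('v, 'a) fm"
  | CAndR "('v, 'a) fm" "('v, 'a) fctx"
  | CExi 'v "('v, 'a) fctx"
  | CAll 'v "('v, 'a) fctx"

primrec plug :: "('v, 'a) fctx \<Rightarrow> ('v, 'a) fm \<Rightarrow> ('v, 'a) fm" where
  "plug Hole \<phi> = \<phi>"
| "plug (CNeg \<mu>) \<phi> = Neg (plug \<mu> \<phi>)"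
| "plug (COrL \<mu> \<psi>) \<phi> = Or (plug \<mu> \<phi>) \<psi>"
| "plug (COrR \<psi> \<mu>) \<phi> = Or \<psi> (plug \<mu> \<phi>)"
| "plug (CAndL \<mu> \<psi>) \<phi> = And (plug \<mu> \<phi>) \<psi>"
| "plug (CAndR \<psi> \<mu>) \<phi> = And \<psi> (plug \<mu> \<phi>)"
| "plug (CExi x \<mu>) \<phi> = Exi x (plug \<mu> \<phi>)"
| "plug (CAll x \<mu>) \<phi> = All x (plug \<mu> \<phi>)"

definition fragment :: "('v, 'a) fm set \<Rightarrow> bool" where
  "fragment F \<longleftrightarrow> F \<noteq> {} \<and>
     (\<forall>\<mu> \<phi> \<psi> a x.
        (plug \<mu> \<phi> \<in> F \<longrightarrow>
           plug \<mu> (Atom ATrue) \<in> F \<and> plug \<mu> (Atom AFalse) \<in> F \<and>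
           plug \<mu> (Atom (ALetter x a)) \<in> F) \<and>
        (plug \<mu> (Or \<phi> \<psi>) \<in> F \<longleftrightarrow> plug \<mu> \<phi> \<in> F \<and> plug \<mu> \<psi> \<in> F) \<and>
        (plug \<mu> (And \<phi> \<psi>) \<in> F \<longleftrightarrow> plug \<mu> \<phi> \<in> F \<and> plug \<mu> \<psi> \<in> F) \<and>
        (plug \<mu> (Neg (Neg \<phi>)) \<in> F \<longrightarrow> plug \<mu> \<phi> \<in> F) \<and>
        (plug \<mu> (Exi x \<phi>) \<in> F \<and> x \<notin> FV \<phi> \<longrightarrow> plug \<mu> \<phi> \<in> F) \<and>
        (plug \<mu> (All x \<phi>) \<in> F \<and> x \<notin> FV \<phi> \<longrightarrow> plug \<mu> \<phi> \<in> F))"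

definition order_stable :: "('v, 'a) fm set \<Rightarrow> bool" where
  "order_stable F \<longleftrightarrow>
     (\<forall>\<mu> x y. plug \<mu> (Atom (ALess x y)) \<in> F \<longleftrightarrow> plug \<mu> (Atom (ALeq x y)) \<in> F)"

definition suc_stable :: "('v, 'a) fm set \<Rightarrow> bool" where
  "suc_stable F \<longleftrightarrow>
     (\<forall>\<mu> x y. plug \<mu> (Atom (ASuc x y)) \<in> F \<longrightarrow>
        plug \<mu> (Atom (AEq x y)) \<in> F \<and>
        plug \<mu> (Atom (AMax x)) \<in> F \<and> plug \<mu> (Atom (AMin y)) \<in> F) \<and>
     (\<forall>\<mu> x. plug \<mu> (Atom (AMin x)) \<in> F \<or> plug \<mu> (Atom (AMax x)) \<in> F \<longrightarrow>
        plug \<mu> (Atom AEmpty) \<in> F)"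


section \<open>The game\<close>

datatype quantifier = QEx | QAll | QNegEx | QNegAll

primrec quantify :: "quantifier \<Rightarrow> 'v \<Rightarrow> ('v, 'a) fm \<Rightarrow> ('v, 'a) fm" where
  "quantify QEx x \<phi> = Exi x \<phi>"
| "quantify QAll x \<phi> = All x \<phi>"
| "quantify QNegEx x \<phi> = Neg (Exi x \<phi>)"
| "quantify QNegAll x \<phi> = Neg (All x \<phi>)"

definition reduct :: "('v, 'a) fm set \<Rightarrow> quantifier \<Rightarrow> 'v \<Rightarrow> ('v, 'a) fm set" where
  "reduct F Q x = {\<phi>. quantify Q x \<phi> \<in> F}"

type_synonym ('v, 'a) config =
  "('v, 'a) fm set \<times> ('v, 'a) valuation \<times> ('v, 'a) valuation"

fun spoiler_stop :: "('v, 'a) config \<Rightarrow> bool" where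
  "spoiler_stop (G, (u, \<alpha>), (v, \<beta>)) \<longleftrightarrow>
     (\<exists>\<phi>\<in>G. literal \<phi> \<and> FV \<phi> \<subseteq> dom \<alpha> \<and> sat u \<alpha> \<phi> \<and> \<not> sat v \<beta> \<phi>)"

type_synonym 'v spoiler_move = "quantifier \<times> 'v \<times> nat"

fun spoiler_legal :: "('v, 'a) config \<Rightarrow> 'v spoiler_move \<Rightarrow> bool" where
  "spoiler_legal (G, (u, \<alpha>), (v, \<beta>)) (Q, x, q) \<longleftrightarrow>
     reduct G Q x \<noteq> {} \<and> q \<in> (if Q \<in> {QEx, QNegAll} then positions u else positions v)"

fun duplicator_legal :: "('v, 'a) config \<Rightarrow> 'v spoiler_move \<Rightarrow> nat \<Rightarrow> bool" where
  "duplicator_legal (G, (u, \<alpha>), (v, \<beta>)) (Q, x, q) r \<longleftrightarrow>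
     r \<in> (if Q \<in> {QEx, QNegAll} then positions v else positions u)"

fun next_config :: "('v, 'a) config \<Rightarrow> 'v spoiler_move \<Rightarrow> nat \<Rightarrow> ('v, 'a) config" where
  "next_config (G, (u, \<alpha>), (v, \<beta>)) (Q, x, q) r =
     (reduct G Q x,
      (case Q of
         QEx \<Rightarrow> ((u, \<alpha>(x \<mapsto> q)), (v, \<beta>(x \<mapsto> r)))
       | QAll \<Rightarrow> ((u, \<alpha>(x \<mapsto> r)), (v, \<beta>(x \<mapsto> q)))
       | QNegEx \<Rightarrow> ((v, \<beta>(x \<mapsto> q)), (u, \<alpha>(x \<mapsto> r)))
       | QNegAll \<Rightarrow> ((v, \<beta>(x \<mapsto> r)), (u, \<alpha>(x \<mapsto> q)))))"

text \<open>
  A Duplicator strategy maps the completed rounds and Spoiler's current choice to a position.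
  \<open>play c\<^sub>0 \<sigma> h c\<close>: the rounds \<open>h\<close> form a partial play from \<open>c\<^sub>0\<close> that is consistent with \<open>\<sigma>\<close> and
  leads to configuration \<open>c\<close>.
\<close>
type_synonym 'v strategy = "('v spoiler_move \<times> nat) list \<Rightarrow> 'v spoiler_move \<Rightarrow> nat"

inductive play ::
    "('v, 'a) config \<Rightarrow> 'v strategy \<Rightarrow> ('v spoiler_move \<times> nat) list \<Rightarrow> ('v, 'a) config \<Rightarrow> bool"
  for c\<^sub>0 :: "('v, 'a) config" and \<sigma> :: "'v strategy" where
  start: "play c\<^sub>0 \<sigma> [] c\<^sub>0"
| round: "play c\<^sub>0 \<sigma> (h @ [(m, \<sigma> h m)]) (next_config c m (\<sigma> h m))"
    if "play c\<^sub>0 \<sigma> h c" "\<not> spoiler_stop c" "spoiler_legal c m" "duplicator_legal c m (\<sigma> h m)"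

text \<open>
  Spoiler wins a play only by reaching a stopping configuration or a round in which Duplicator
  cannot choose a position. So \<open>\<sigma>\<close> is winning iff no consistent play gets to a stopping
  configuration and \<open>\<sigma>\<close> always answers legally. Infinite plays, and plays in which Spoiler
  cannot make a required choice, are won by Duplicator and impose no condition.
\<close>
definition winning_strategy :: "('v, 'a) config \<Rightarrow> 'v strategy \<Rightarrow> bool" where
  "winning_strategy c\<^sub>0 \<sigma> \<longleftrightarrow>
     (\<forall>h c. play c\<^sub>0 \<sigma> h c \<longrightarrow>
        \<not> spoiler_stop c \<and> (\<forall>m. spoiler_legal c m \<longrightarrow> duplicator_legal c m (\<sigma> h m)))"

definition duplicator_wins :: "('v, 'a) fm set \<Rightarrow> 'a gword \<Rightarrow> 'a gword \<Rightarrow> bool" where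
  "duplicator_wins F u v \<longleftrightarrow> (\<exists>\<sigma>. winning_strategy (F, (u, Map.empty), (v, Map.empty)) \<sigma>)"

end

theory Submission
  imports Defs "HOL-Library.Product_Lexorder" "HOL-Library.Infinite_Set"
begin

text \<open>
  Everything is compared through finite Ehrenfeucht-Fraisse games. Their equivalences \<open>\<equiv>\<^sub>k\<close> are
  congruences for sums, for copies along a linear order, and for substitution of words for
  letters; moreover \<open>\<rho> \<equiv>\<^sub>k {0..<n}\<close> as soon as \<open>n > 2\<^sup>k\<close>. Hence \<open>[[t]]\<^sub>\<rho>\<close> is \<open>\<equiv>\<^sub>k\<close> to the finite word
  obtained by reading \<open>\<pi>\<close> as an \<open>n\<close>-fold power, and in the syntactic semigroup of a language
  defined by a sentence of rank \<open>k\<close> the idempotent power of \<open>u\<close> is \<open>u\<^sup>n\<close>. So the identity holds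
  iff \<open>[[s]]\<^sub>\<rho>\<close> and \<open>[[t]]\<^sub>\<rho>\<close>, with letters replaced by non-empty words and put into any finite
  context, agree on the sentence.

  From identities to strategies: \<open>[[t]]\<^sub>\<rho>\<close> is saturated. This is expressed as sequential
  compactness of its set of positions (every sequence has a subsequence converging in all \<open>\<equiv>\<^sub>k\<close>,
  with parameters), which passes from \<open>\<rho>\<close> to sums and copies. By saturation, Duplicator can keep
  the invariant that all formulae of the current fragment are preserved.

  From strategies to identities: Duplicator's strategy on \<open>([[s]]\<^sub>\<rho>, [[t]]\<^sub>\<rho>)\<close> is simulated on the
  words with letters expanded and put into a context; the stability conditions on the fragment
  are what reduces literals about expanded positions to literals about the original ones.
\<close>


section \<open>Finite Ehrenfeucht-Fraisse games\<close>

text \<open>Fragments need not be closed under negation, so formulae are preserved in one direction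
  only; this is why two games are needed and why a negated quantifier exchanges the words. Closure
  under finite conjunctions and disjunctions turns finitely many formulae into one, which is all
  that saturation asks for. Compactness is stated through games rather than formulae because a limit
  in a sum or in copies along an order is then assembled from limits in the components, without
  splitting formulae. The type rho is the saturated form of a long finite order: it is discrete with
  two endpoints, and the density of its copies of Z provides a limit for positions whose distances
  to both neighbouring parameters grow beyond every bound. In the converse direction the obstacle is
  that one letter turns into a whole word: a strict comparison of expanded positions may be a weak
  one of the original positions, a successor may stay inside one original position, and at the
  border with the context a successor is decided by the original position being last or
  first.\<close>

type_synonym ('p, 'a) lword = "'p rel \<times> ('p \<Rightarrow> 'a)"

abbreviation pts :: "('p, 'a) lword \<Rightarrow> 'p set" where
  "pts M \<equiv> Field (fst M)"

definition partial_iso :: "('p, 'a) lword \<Rightarrow> ('q, 'a) lword \<Rightarrow> ('p \<times> 'q) set \<Rightarrow> bool" where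
  "partial_iso M N R \<longleftrightarrow> R \<subseteq> pts M \<times> pts N \<and>
     (\<forall>p q. (p, q) \<in> R \<longrightarrow> snd M p = snd N q) \<and>
     (\<forall>p q p' q'. (p, q) \<in> R \<longrightarrow> (p', q') \<in> R \<longrightarrow>
        (p = p' \<longleftrightarrow> q = q') \<and> ((p, p') \<in> fst M \<longleftrightarrow> (q, q') \<in> fst N))"

text \<open>Duplicator survives \<open>k\<close> more rounds after the pairs in \<open>R\<close>
  have been picked. \<open>R\<close> is a relation and may be infinite, so that the graph of an
  isomorphism or an identity on parameters can serve as a position of the game.\<close>

primrec EF :: "nat \<Rightarrow> ('p, 'a) lword \<Rightarrow> ('q, 'a) lword \<Rightarrow> ('p \<times> 'q) set \<Rightarrow> bool" where
  "EF 0 M N R \<longleftrightarrow> partial_iso M N R"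
| "EF (Suc k) M N R \<longleftrightarrow> partial_iso M N R \<and>
     (\<forall>p\<in>pts M. \<exists>q\<in>pts N. EF k M N (insert (p, q) R)) \<and>
     (\<forall>q\<in>pts N. \<exists>p\<in>pts M. EF k M N (insert (p, q) R))"

lemma EF_SucI:
  assumes "partial_iso M N R"
    and "\<And>p. p \<in> pts M \<Longrightarrow> \<exists>q\<in>pts N. EF k M N (insert (p, q) R)"
    and "\<And>q. q \<in> pts N \<Longrightarrow> \<exists>p\<in>pts M. EF k M N (insert (p, q) R)"
  shows "EF (Suc k) M N R"
  using assms by simp

lemma EF_forth:
  assumes "EF (Suc k) M N R" "p \<in> pts M"
  obtains q where "q \<in> pts N" "EF k M N (insert (p, q) R)"
  using assms by auto

lemma EF_back:
  assumes "EF (Suc k) M N R" "q \<in> pts N"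
  obtains p where "p \<in> pts M" "EF k M N (insert (p, q) R)"
  using assms by auto

lemma EF_partial_iso: "EF k M N R \<Longrightarrow> partial_iso M N R"
  by (cases k) auto

lemma partial_iso_mono: "partial_iso M N R \<Longrightarrow> R' \<subseteq> R \<Longrightarrow> partial_iso M N R'"
  unfolding partial_iso_def by blast

lemma EF_subset: "EF k M N R \<Longrightarrow> R' \<subseteq> R \<Longrightarrow> EF k M N R'"
proof (induction k arbitrary: R R')
  case 0
  then show ?case by (auto intro: partial_iso_mono)
next
  case (Suc k)
  have "EF k M N (insert (p, q) R')" if "EF k M N (insert (p, q) R)" for p q
    by (rule Suc.IH[OF that]) (use Suc.prems(2) in blast)
  with Suc.prems show ?case unfolding EF.simps by (meson partial_iso_mono)
qed

lemma EF_pred: "EF (Suc k) M N R \<Longrightarrow> EF k M N R"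
proof (induction k arbitrary: R)
  case 0
  then show ?case by simp
next
  case (Suc k)
  have pi: "partial_iso M N R"
    and f: "\<forall>p\<in>pts M. \<exists>q\<in>pts N. EF (Suc k) M N (insert (p, q) R)"
    and b: "\<forall>q\<in>pts N. \<exists>p\<in>pts M. EF (Suc k) M N (insert (p, q) R)"
    using Suc.prems EF.simps(2)[of "Suc k" M N R] by blast+
  show ?case
    using pi f b Suc.IH unfolding EF.simps(2)[of k M N R] by blast
qed

lemma EF_le: "EF k M N R \<Longrightarrow> j \<le> k \<Longrightarrow> EF j M N R"
  by (rotate_tac 1, induction rule: inc_induct) (blast intro: EF_pred)+

lemma partial_iso_converse: "partial_iso M N R \<Longrightarrow> partial_iso N M (R\<inverse>)"
  unfolding partial_iso_def by auto

lemma EF_converse: "EF k M N R \<Longrightarrow> EF k N M (R\<inverse>)"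
proof (induction k arbitrary: R)
  case 0
  then show ?case by (simp add: partial_iso_converse)
next
  case (Suc k)
  have step: "EF k N M (insert (q, p) (R\<inverse>))" if "EF k M N (insert (p, q) R)" for p q
  proof -
    have "insert (q, p) (R\<inverse>) = (insert (p, q) R)\<inverse>" by auto
    then show ?thesis using Suc.IH[OF that] by simp
  qed
  show ?case
  proof (rule EF_SucI)
    show "partial_iso N M (R\<inverse>)"
      using EF_partial_iso[OF Suc.prems] by (rule partial_iso_converse)
  next
    fix q assume "q \<in> pts N"
    then show "\<exists>p\<in>pts M. EF k N M (insert (q, p) (R\<inverse>))"
      using EF_back[OF Suc.prems] step by metis
  next
    fix p assume "p \<in> pts M"
    then show "\<exists>q\<in>pts N. EF k N M (insert (q, p) (R\<inverse>))"
      using EF_forth[OF Suc.prems] step by metis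
  qed
qed

lemma partial_isoD:
  assumes "partial_iso M N R" "(p, q) \<in> R"
  shows "p \<in> pts M" "q \<in> pts N" "snd M p = snd N q"
    "(p', q') \<in> R \<Longrightarrow> p = p' \<longleftrightarrow> q = q'"
    "(p', q') \<in> R \<Longrightarrow> (p, p') \<in> fst M \<longleftrightarrow> (q, q') \<in> fst N"
  using assms unfolding partial_iso_def by blast+

lemma partial_isoI:
  assumes "\<And>p q. (p, q) \<in> R \<Longrightarrow> p \<in> pts M \<and> q \<in> pts N \<and> snd M p = snd N q"
    and "\<And>p q p' q'. (p, q) \<in> R \<Longrightarrow> (p', q') \<in> R \<Longrightarrow>
      (p = p' \<longleftrightarrow> q = q') \<and> ((p, p') \<in> fst M \<longleftrightarrow> (q, q') \<in> fst N)"
  shows "partial_iso M N R"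
  unfolding partial_iso_def using assms by (simp add: subset_iff split_paired_all)

lemma partial_iso_relcomp:
  assumes R: "partial_iso M N R" and S: "partial_iso N K S"
  shows "partial_iso M K (R O S)"
proof (rule partial_isoI)
  fix p r assume "(p, r) \<in> R O S"
  then obtain q where "(p, q) \<in> R" "(q, r) \<in> S" by blast
  then show "p \<in> pts M \<and> r \<in> pts K \<and> snd M p = snd K r"
    using partial_isoD(1,3)[OF R] partial_isoD(2,3)[OF S] by auto
next
  fix p r p' r' assume "(p, r) \<in> R O S" "(p', r') \<in> R O S"
  then obtain q q' where "(p, q) \<in> R" "(q, r) \<in> S" "(p', q') \<in> R" "(q', r') \<in> S" by blast
  then show "(p = p' \<longleftrightarrow> r = r') \<and> ((p, p') \<in> fst M \<longleftrightarrow> (r, r') \<in> fst K)"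
    using partial_isoD(4,5)[OF R, of p q p' q'] partial_isoD(4,5)[OF S, of q r q' r'] by simp
qed

text \<open>Duplicator's answer in \<open>N\<close> is handed on as Spoiler's move in the second
  game. With \<open>EF_converse\<close> this makes every \<open>ef_equiv k\<close> an equivalence
  and allows a game to be conjugated by an isomorphism.\<close>

lemma EF_relcomp: "EF k M N R \<Longrightarrow> EF k N K S \<Longrightarrow> EF k M K (R O S)"
proof (induction k arbitrary: R S)
  case 0
  then show ?case by (simp add: partial_iso_relcomp)
next
  case (Suc k)
  have step: "EF k M K (insert (p, r) (R O S))"
    if "EF k M N (insert (p, q) R)" "EF k N K (insert (q, r) S)" for p q r
    by (rule EF_subset[OF Suc.IH[OF that]]) auto
  show ?case
  proof (rule EF_SucI)
    show "partial_iso M K (R O S)"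
      using Suc.prems by (blast intro: partial_iso_relcomp EF_partial_iso)
  next
    fix p assume "p \<in> pts M"
    from EF_forth[OF Suc.prems(1) this] obtain q where q: "q \<in> pts N" "EF k M N (insert (p, q) R)" .
    from EF_forth[OF Suc.prems(2) q(1)] obtain r where "r \<in> pts K" "EF k N K (insert (q, r) S)" .
    with step q show "\<exists>r\<in>pts K. EF k M K (insert (p, r) (R O S))" by blast
  next
    fix r assume "r \<in> pts K"
    from EF_back[OF Suc.prems(2) this] obtain q where q: "q \<in> pts N" "EF k N K (insert (q, r) S)" .
    from EF_back[OF Suc.prems(1) q(1)] obtain p where "p \<in> pts M" "EF k M N (insert (p, q) R)" .
    with step q show "\<exists>p\<in>pts M. EF k M K (insert (p, r) (R O S))" by blast
  qed
qed

definition lword_iso :: "('p \<Rightarrow> 'q) \<Rightarrow> ('p, 'a) lword \<Rightarrow> ('q, 'a) lword \<Rightarrow> bool" where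
  "lword_iso f M N \<longleftrightarrow> inj_on f (pts M) \<and> f ` pts M = pts N \<and>
     (\<forall>p\<in>pts M. snd M p = snd N (f p)) \<and>
     (\<forall>p\<in>pts M. \<forall>p'\<in>pts M. (p, p') \<in> fst M \<longleftrightarrow> (f p, f p') \<in> fst N)"

text \<open>With the whole graph picked in advance, a further pair of the graph is already present,
  so the position of the game never changes.\<close>

lemma EF_iso: "lword_iso f M N \<Longrightarrow> EF k M N ((\<lambda>p. (p, f p)) ` pts M)"
proof (induction k)
  case 0
  then show ?case by (auto simp: partial_iso_def lword_iso_def inj_on_def)
next
  case (Suc k)
  have step: "EF k M N (insert (p, f p) ((\<lambda>p. (p, f p)) ` pts M))" if "p \<in> pts M" for p
    using Suc.IH[OF Suc.prems] that by (simp add: insert_absorb)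
  have im: "f ` pts M = pts N" using Suc.prems by (simp add: lword_iso_def)
  show ?case
  proof (rule EF_SucI)
    show "partial_iso M N ((\<lambda>p. (p, f p)) ` pts M)"
      using Suc.IH[OF Suc.prems] by (rule EF_partial_iso)
  next
    fix p assume "p \<in> pts M"
    then show "\<exists>q\<in>pts N. EF k M N (insert (p, q) ((\<lambda>p. (p, f p)) ` pts M))"
      using step im by blast
  next
    fix q assume "q \<in> pts N"
    then obtain p where "p \<in> pts M" "q = f p" using im by blast
    then show "\<exists>p\<in>pts M. EF k M N (insert (p, q) ((\<lambda>p. (p, f p)) ` pts M))"
      using step by blast
  qed
qed

lemma EF_Id_on: "P \<subseteq> pts M \<Longrightarrow> EF k M M (Id_on P)"
  by (rule EF_subset[OF EF_iso[of id]]) (auto simp: lword_iso_def)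

definition ef_equiv :: "nat \<Rightarrow> ('p, 'a) lword \<Rightarrow> ('q, 'a) lword \<Rightarrow> bool" where
  "ef_equiv k M N \<longleftrightarrow> EF k M N {}"

lemma ef_equiv_iso: "lword_iso f M N \<Longrightarrow> ef_equiv k M N"
  unfolding ef_equiv_def by (rule EF_subset[OF EF_iso]) auto

lemma ef_equiv_refl: "ef_equiv k M M"
  unfolding ef_equiv_def by (rule EF_subset[OF EF_Id_on[of "{}"]]) auto

lemma ef_equiv_sym: "ef_equiv k M N \<Longrightarrow> ef_equiv k N M"
  unfolding ef_equiv_def using EF_converse by fastforce

lemma ef_equiv_trans [trans]: "ef_equiv k M N \<Longrightarrow> ef_equiv k N K \<Longrightarrow> ef_equiv k M K"
  unfolding ef_equiv_def using EF_relcomp by fastforce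

section \<open>First-order satisfaction over positions of any type\<close>

definition lless :: "('p, 'a) lword \<Rightarrow> 'p \<Rightarrow> 'p \<Rightarrow> bool" where
  "lless M p q \<longleftrightarrow> (p, q) \<in> fst M \<and> p \<noteq> q"

definition lsuc :: "('p, 'a) lword \<Rightarrow> 'p \<Rightarrow> 'p \<Rightarrow> bool" where
  "lsuc M p q \<longleftrightarrow> lless M p q \<and> \<not> (\<exists>z\<in>pts M. lless M p z \<and> lless M z q)"

definition lmin :: "('p, 'a) lword \<Rightarrow> 'p \<Rightarrow> bool" where
  "lmin M p \<longleftrightarrow> (\<forall>z\<in>pts M. (p, z) \<in> fst M)"

definition lmax :: "('p, 'a) lword \<Rightarrow> 'p \<Rightarrow> bool" where
  "lmax M p \<longleftrightarrow> (\<forall>z\<in>pts M. (z, p) \<in> fst M)"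

text \<open>Sums, copies and expansions do not live on \<open>nat\<close>, so satisfaction is
  restated for labelled orders. Valuations become total; by \<open>gsat_cong\<close> only their
  values at free variables count.\<close>

primrec gsat_atom :: "('p, 'a) lword \<Rightarrow> ('v \<Rightarrow> 'p) \<Rightarrow> ('v, 'a) atom \<Rightarrow> bool" where
  "gsat_atom M \<alpha> ATrue \<longleftrightarrow> True"
| "gsat_atom M \<alpha> AFalse \<longleftrightarrow> False"
| "gsat_atom M \<alpha> AEmpty \<longleftrightarrow> pts M = {}"
| "gsat_atom M \<alpha> (AEq x y) \<longleftrightarrow> \<alpha> x = \<alpha> y"
| "gsat_atom M \<alpha> (ALetter x a) \<longleftrightarrow> snd M (\<alpha> x) = a"
| "gsat_atom M \<alpha> (ALess x y) \<longleftrightarrow> lless M (\<alpha> x) (\<alpha> y)"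
| "gsat_atom M \<alpha> (ALeq x y) \<longleftrightarrow> (\<alpha> x, \<alpha> y) \<in> fst M"
| "gsat_atom M \<alpha> (ASuc x y) \<longleftrightarrow> lsuc M (\<alpha> x) (\<alpha> y)"
| "gsat_atom M \<alpha> (AMin x) \<longleftrightarrow> lmin M (\<alpha> x)"
| "gsat_atom M \<alpha> (AMax x) \<longleftrightarrow> lmax M (\<alpha> x)"

primrec gsat :: "('p, 'a) lword \<Rightarrow> ('v \<Rightarrow> 'p) \<Rightarrow> ('v, 'a) fm \<Rightarrow> bool" where
  "gsat M \<alpha> (Atom A) \<longleftrightarrow> gsat_atom M \<alpha> A"
| "gsat M \<alpha> (Neg \<phi>) \<longleftrightarrow> \<not> gsat M \<alpha> \<phi>"
| "gsat M \<alpha> (Or \<phi> \<psi>) \<longleftrightarrow> gsat M \<alpha> \<phi> \<or> gsat M \<alpha> \<psi>"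
| "gsat M \<alpha> (And \<phi> \<psi>) \<longleftrightarrow> gsat M \<alpha> \<phi> \<and> gsat M \<alpha> \<psi>"
| "gsat M \<alpha> (Exi x \<phi>) \<longleftrightarrow> (\<exists>p\<in>pts M. gsat M (\<alpha>(x := p)) \<phi>)"
| "gsat M \<alpha> (All x \<phi>) \<longleftrightarrow> (\<forall>p\<in>pts M. gsat M (\<alpha>(x := p)) \<phi>)"

definition gw :: "'a gword \<Rightarrow> (nat, 'a) lword" where
  "gw u = (word_ord u, letter_at u)"

lemma gw_simps [simp]: "fst (gw u) = word_ord u" "snd (gw u) = letter_at u"
  by (simp_all add: gw_def)

lemma sat_atom_gsat: "sat_atom u \<alpha> A \<longleftrightarrow> gsat_atom (gw u) (the \<circ> \<alpha>) A"
  by (cases A) (auto simp: lless_def lsuc_def lmin_def lmax_def pos_less_def)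

lemma sat_gsat: "sat u \<alpha> \<phi> \<longleftrightarrow> gsat (gw u) (the \<circ> \<alpha>) \<phi>"
  by (induction \<phi> arbitrary: \<alpha>) (simp_all add: sat_atom_gsat fun_upd_comp)

lemma gsat_cong: "(\<And>x. x \<in> FV \<phi> \<Longrightarrow> \<alpha> x = \<beta> x) \<Longrightarrow> gsat M \<alpha> \<phi> \<longleftrightarrow> gsat M \<beta> \<phi>"
proof (induction \<phi> arbitrary: \<alpha> \<beta>)
  case (Atom A)
  then show ?case by (cases A) auto
next
  case (Exi x \<phi>)
  have "gsat M (\<alpha>(x := p)) \<phi> \<longleftrightarrow> gsat M (\<beta>(x := p)) \<phi>" for p
    by (rule Exi.IH) (use Exi.prems in auto)
  then show ?case by simp
next
  case (All x \<phi>)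
  have "gsat M (\<alpha>(x := p)) \<phi> \<longleftrightarrow> gsat M (\<beta>(x := p)) \<phi>" for p
    by (rule All.IH) (use All.prems in auto)
  then show ?case by simp
next
  case (Or \<phi> \<psi>)
  then show ?case by (metis FV.simps(3) UnCI gsat.simps(3))
next
  case (And \<phi> \<psi>)
  then show ?case by (metis FV.simps(4) UnCI gsat.simps(4))
next
  case (Neg \<phi>)
  then show ?case by (metis FV.simps(2) gsat.simps(2))
qed

text \<open>Atoms have rank 1 because \<open>suc\<close>, \<open>min\<close>, \<open>max\<close> and \<open>empty\<close> hide a quantifier.\<close>
primrec qrank :: "('v, 'a) fm \<Rightarrow> nat" where
  "qrank (Atom A) = 1"
| "qrank (Neg \<phi>) = qrank \<phi>"
| "qrank (Or \<phi> \<psi>) = max (qrank \<phi>) (qrank \<psi>)"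
| "qrank (And \<phi> \<psi>) = max (qrank \<phi>) (qrank \<psi>)"
| "qrank (Exi x \<phi>) = Suc (qrank \<phi>)"
| "qrank (All x \<phi>) = Suc (qrank \<phi>)"

text \<open>\<open>lsuc\<close>, \<open>lmin\<close>, \<open>lmax\<close> and emptiness are decided
  by one further position; the spare round supplies its partner. All other atoms are read off the
  partial isomorphism.\<close>

lemma EF_gsat_atom:
  assumes ef: "EF (Suc k) M N R" and R: "\<And>x. x \<in> atom_vars A \<Longrightarrow> (\<alpha> x, \<beta> x) \<in> R"
  shows "gsat_atom M \<alpha> A \<longleftrightarrow> gsat_atom N \<beta> A"
proof -
  have pi: "partial_iso M N R" using ef by simp
  have fo: "\<exists>q\<in>pts N. partial_iso M N (insert (p, q) R)" if "p \<in> pts M" for p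
    using ef that by (meson EF_forth EF_partial_iso)
  have ba: "\<exists>p\<in>pts M. partial_iso M N (insert (p, q) R)" if "q \<in> pts N" for q
    using ef that by (meson EF_back EF_partial_iso)
  have le: "(p, p') \<in> fst M \<longleftrightarrow> (q, q') \<in> fst N" "p = p' \<longleftrightarrow> q = q'"
      "lless M p p' \<longleftrightarrow> lless N q q'"
    if "partial_iso M N R'" "(p, q) \<in> R'" "(p', q') \<in> R'" for R' p p' q q'
    using partial_isoD(4,5)[OF that] unfolding lless_def by auto
  have suc: "lsuc M p p' \<longleftrightarrow> lsuc N q q'" if "(p, q) \<in> R" "(p', q') \<in> R" for p p' q q'
  proof -
    have "(\<exists>z\<in>pts M. lless M p z \<and> lless M z p') \<longleftrightarrow> (\<exists>z\<in>pts N. lless N q z \<and> lless N z q')"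
    proof
      assume "\<exists>z\<in>pts M. lless M p z \<and> lless M z p'"
      then obtain z where z: "z \<in> pts M" "lless M p z" "lless M z p'" by blast
      obtain z' where z': "z' \<in> pts N" "partial_iso M N (insert (z, z') R)" using fo[OF z(1)] by blast
      show "\<exists>z\<in>pts N. lless N q z \<and> lless N z q'"
        using z' z le(3)[OF z'(2), of p q z z'] le(3)[OF z'(2), of z z' p' q'] that by blast
    next
      assume "\<exists>z\<in>pts N. lless N q z \<and> lless N z q'"
      then obtain z where z: "z \<in> pts N" "lless N q z" "lless N z q'" by blast
      obtain z' where z': "z' \<in> pts M" "partial_iso M N (insert (z', z) R)" using ba[OF z(1)] by blast
      show "\<exists>z\<in>pts M. lless M p z \<and> lless M z p'"
        using z' z le(3)[OF z'(2), of p q z' z] le(3)[OF z'(2), of z' z p' q'] that by blast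
    qed
    then show ?thesis unfolding lsuc_def using le(3)[OF pi that] by blast
  qed
  have "((p, z) \<in> fst M \<longleftrightarrow> (q, z') \<in> fst N) \<and> ((z, p) \<in> fst M \<longleftrightarrow> (z', q) \<in> fst N)"
    if "(p, q) \<in> R" "partial_iso M N (insert (z, z') R)" for p q z z'
    using le(1)[OF that(2), of p q z z'] le(1)[OF that(2), of z z' p q] that(1) by simp
  then have mi: "lmin M p \<longleftrightarrow> lmin N q" "lmax M p \<longleftrightarrow> lmax N q" if "(p, q) \<in> R" for p q
    unfolding lmin_def lmax_def using fo ba that by meson+
  show ?thesis
  proof (cases A)
    case AEmpty
    then show ?thesis using fo ba by auto
  next
    case (ALetter x a)
    then show ?thesis using pi R[of x] by (auto simp: partial_iso_def)
  qed (use R in \<open>simp_all add: le[OF pi] suc mi\<close>)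
qed

text \<open>The easy half of the Ehrenfeucht-Fraisse theorem, with parameters: each quantifier
  spends a round and the last one is kept for the atom.\<close>

lemma EF_gsat:
  assumes "EF k M N R" "qrank \<phi> \<le> k" "\<And>x. x \<in> FV \<phi> \<Longrightarrow> (\<alpha> x, \<beta> x) \<in> R"
  shows "gsat M \<alpha> \<phi> \<longleftrightarrow> gsat N \<beta> \<phi>"
  using assms
proof (induction \<phi> arbitrary: k R \<alpha> \<beta>)
  case (Atom A)
  then obtain j where "k = Suc j" by (cases k) auto
  with Atom show ?case using EF_gsat_atom[of j M N R A \<alpha> \<beta>] by simp
next
  case (Neg \<phi>)
  then show ?case using Neg.IH[OF Neg.prems(1)] by simp
next
  case (Or \<phi> \<psi>)
  have "gsat M \<alpha> \<phi> \<longleftrightarrow> gsat N \<beta> \<phi>" "gsat M \<alpha> \<psi> \<longleftrightarrow> gsat N \<beta> \<psi>"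
    using Or.prems(2,3) by (auto intro!: Or.IH[OF Or.prems(1)])
  then show ?case by simp
next
  case (And \<phi> \<psi>)
  have "gsat M \<alpha> \<phi> \<longleftrightarrow> gsat N \<beta> \<phi>" "gsat M \<alpha> \<psi> \<longleftrightarrow> gsat N \<beta> \<psi>"
    using And.prems(2,3) by (auto intro!: And.IH[OF And.prems(1)])
  then show ?case by simp
next
  case (Exi x \<phi>)
  then obtain j where k: "k = Suc j" by (cases k) auto
  have "gsat M (\<alpha>(x := p)) \<phi> \<longleftrightarrow> gsat N (\<beta>(x := q)) \<phi>" if "EF j M N (insert (p, q) R)" for p q
    by (rule Exi.IH[OF that]) (use Exi.prems k in auto)
  then show ?case using Exi.prems(1) unfolding k EF.simps gsat.simps by meson
next
  case (All x \<phi>)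
  then obtain j where k: "k = Suc j" by (cases k) auto
  have "gsat M (\<alpha>(x := p)) \<phi> \<longleftrightarrow> gsat N (\<beta>(x := q)) \<phi>" if "EF j M N (insert (p, q) R)" for p q
    by (rule All.IH[OF that]) (use All.prems k in auto)
  then show ?case using All.prems(1) unfolding k EF.simps gsat.simps by meson
qed

lemma ef_equiv_gsat:
  assumes "ef_equiv (qrank \<phi>) M N" "FV \<phi> = {}"
  shows "gsat M \<alpha> \<phi> \<longleftrightarrow> gsat N \<beta> \<phi>"
  by (rule EF_gsat[OF assms(1)[unfolded ef_equiv_def]]) (use assms(2) in auto)


section \<open>Sums, copies and substitutions\<close>

definition lsum :: "('p, 'a) lword \<Rightarrow> ('q, 'a) lword \<Rightarrow> ('p + 'q, 'a) lword" where
  "lsum M N = (order_sum (fst M) (fst N), case_sum (snd M) (snd N))"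

definition lcopies :: "('p, 'a) lword \<Rightarrow> 'i rel \<Rightarrow> ('p \<times> 'i, 'a) lword" where
  "lcopies M T = (order_copies (fst M) T, snd M \<circ> fst)"

text \<open>Indices into \<open>w a\<close> count from 0, unlike positions of
  \<open>finite_word\<close>. Here the first component is the significant one, because the length of
  a block depends on it.\<close>

definition lsub :: "('a \<Rightarrow> 'b list) \<Rightarrow> ('p, 'a) lword \<Rightarrow> ('p \<times> nat, 'b) lword" where
  "lsub w M =
     ({((p, i), (q, j)). p \<in> pts M \<and> q \<in> pts M \<and> i < length (w (snd M p)) \<and>
         j < length (w (snd M q)) \<and> ((p, q) \<in> fst M \<and> p \<noteq> q \<or> p = q \<and> i \<le> j)},
      \<lambda>(p, i). w (snd M p) ! i)"

text \<open>A bare order seen as a word over a one-letter alphabet, so that the same games compare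
  index orders.\<close>

definition unlab :: "'i rel \<Rightarrow> ('i, unit) lword" where
  "unlab T = (T, \<lambda>_. ())"

lemma unlab_simps [simp]: "fst (unlab T) = T" "snd (unlab T) x = ()"
  by (simp_all add: unlab_def)

lemma order_sum_simps [simp]:
  "(Inl x, Inl y) \<in> order_sum r s \<longleftrightarrow> (x, y) \<in> r"
  "(Inr x', Inr y') \<in> order_sum r s \<longleftrightarrow> (x', y') \<in> s"
  "(Inl x, Inr y') \<in> order_sum r s \<longleftrightarrow> x \<in> Field r \<and> y' \<in> Field s"
  "(Inr x', Inl y) \<notin> order_sum r s"
  by (auto simp: order_sum_def)

lemma lsum_simps [simp]:
  "fst (lsum M N) = order_sum (fst M) (fst N)"
  "snd (lsum M N) (Inl p) = snd M p" "snd (lsum M N) (Inr q) = snd N q"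
  by (simp_all add: lsum_def)

lemma lcopies_simps [simp]:
  "fst (lcopies M T) = order_copies (fst M) T" "snd (lcopies M T) x = snd M (fst x)"
  by (simp_all add: lcopies_def)

lemma pts_lsum: "pts (lsum M N) = Inl ` pts M \<union> Inr ` pts N"
  by (simp add: Field_order_sum)

lemma pts_lsub: "pts (lsub w M) = {(p, i). p \<in> pts M \<and> i < length (w (snd M p))}"
  by (auto simp: lsub_def Field_def)

lemma lsub_simps:
  "((p, i), (q, j)) \<in> fst (lsub w M) \<longleftrightarrow> p \<in> pts M \<and> q \<in> pts M \<and> i < length (w (snd M p)) \<and>
         j < length (w (snd M q)) \<and> ((p, q) \<in> fst M \<and> p \<noteq> q \<or> p = q \<and> i \<le> j)"
  "snd (lsub w M) (p, i) = w (snd M p) ! i"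
  by (simp_all add: lsub_def)

definition sum_pairs :: "('p \<times> 'q) set \<Rightarrow> ('p' \<times> 'q') set \<Rightarrow> (('p + 'p') \<times> ('q + 'q')) set" where
  "sum_pairs R S = (\<lambda>(p, q). (Inl p, Inl q)) ` R \<union> (\<lambda>(p, q). (Inr p, Inr q)) ` S"

lemma sum_pairs_simps [simp]:
  "(Inl a, Inl b) \<in> sum_pairs R S \<longleftrightarrow> (a, b) \<in> R"
  "(Inr a', Inr b') \<in> sum_pairs R S \<longleftrightarrow> (a', b') \<in> S"
  "(Inl a, Inr b') \<notin> sum_pairs R S"
  "(Inr a', Inl b) \<notin> sum_pairs R S"
  by (auto simp: sum_pairs_def)

lemma partial_iso_lsum:
  assumes R: "partial_iso M N R" and S: "partial_iso M' N' S"
  shows "partial_iso (lsum M M') (lsum N N') (sum_pairs R S)"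
proof (rule partial_isoI)
  fix p q assume "(p, q) \<in> sum_pairs R S"
  then show "p \<in> pts (lsum M M') \<and> q \<in> pts (lsum N N') \<and> snd (lsum M M') p = snd (lsum N N') q"
    using partial_isoD(1-3)[OF R] partial_isoD(1-3)[OF S]
    by (auto simp: sum_pairs_def Field_order_sum)
next
  fix p q p' q' assume "(p, q) \<in> sum_pairs R S" "(p', q') \<in> sum_pairs R S"
  then show "(p = p' \<longleftrightarrow> q = q') \<and> ((p, p') \<in> fst (lsum M M') \<longleftrightarrow> (q, q') \<in> fst (lsum N N'))"
    using partial_isoD[OF R] partial_isoD[OF S]
    by (cases p; cases q; cases p'; cases q') simp_all
qed

text \<open>A move is answered inside its own summand; the game on the other summand merely forfeits
  a round.\<close>

lemma EF_lsum:
  "EF k M N R \<Longrightarrow> EF k M' N' S \<Longrightarrow> EF k (lsum M M') (lsum N N') (sum_pairs R S)"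
proof (induction k arbitrary: R S)
  case 0
  then show ?case by (simp add: partial_iso_lsum)
next
  case (Suc k)
  have L: "EF k (lsum M M') (lsum N N') (insert (Inl p, Inl q) (sum_pairs R S))"
    if "EF k M N (insert (p, q) R)" for p q
    by (rule EF_subset[OF Suc.IH[OF that EF_pred[OF Suc.prems(2)]]]) (auto simp: sum_pairs_def)
  have R: "EF k (lsum M M') (lsum N N') (insert (Inr p, Inr q) (sum_pairs R S))"
    if "EF k M' N' (insert (p, q) S)" for p q
    by (rule EF_subset[OF Suc.IH[OF EF_pred[OF Suc.prems(1)] that]]) (auto simp: sum_pairs_def)
  show ?case
  proof (rule EF_SucI)
    show "partial_iso (lsum M M') (lsum N N') (sum_pairs R S)"
      using Suc.prems by (blast intro: partial_iso_lsum EF_partial_iso)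
  next
    fix p assume p: "p \<in> pts (lsum M M')"
    show "\<exists>q\<in>pts (lsum N N'). EF k (lsum M M') (lsum N N') (insert (p, q) (sum_pairs R S))"
    proof (cases p)
      case (Inl a)
      then have "a \<in> pts M" using p by (auto simp: Field_order_sum)
      from EF_forth[OF Suc.prems(1) this] obtain q where "q \<in> pts N" "EF k M N (insert (a, q) R)" .
      with L Inl show ?thesis by (auto simp: Field_order_sum)
    next
      case (Inr a)
      then have "a \<in> pts M'" using p by (auto simp: Field_order_sum)
      from EF_forth[OF Suc.prems(2) this] obtain q where "q \<in> pts N'" "EF k M' N' (insert (a, q) S)" .
      with R Inr show ?thesis by (auto simp: Field_order_sum)
    qed
  next
    fix q assume q: "q \<in> pts (lsum N N')"
    show "\<exists>p\<in>pts (lsum M M'). EF k (lsum M M') (lsum N N') (insert (p, q) (sum_pairs R S))"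
    proof (cases q)
      case (Inl a)
      then have "a \<in> pts N" using q by (auto simp: Field_order_sum)
      from EF_back[OF Suc.prems(1) this] obtain p where "p \<in> pts M" "EF k M N (insert (p, a) R)" .
      with L Inl show ?thesis by (auto simp: Field_order_sum)
    next
      case (Inr a)
      then have "a \<in> pts N'" using q by (auto simp: Field_order_sum)
      from EF_back[OF Suc.prems(2) this] obtain p where "p \<in> pts M'" "EF k M' N' (insert (p, a) S)" .
      with R Inr show ?thesis by (auto simp: Field_order_sum)
    qed
  qed
qed

lemma ef_equiv_lsum:
  "ef_equiv k M N \<Longrightarrow> ef_equiv k M' N' \<Longrightarrow> ef_equiv k (lsum M M') (lsum N N')"
  unfolding ef_equiv_def using EF_lsum[of k M N "{}" M' N' "{}"] by (simp add: sum_pairs_def)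

text \<open>\<open>Q c d\<close> holds the pairs picked in a separate game between copy
  \<open>c\<close> on the left and copy \<open>d\<close> on the right; one such game exists for
  every pair of indices.\<close>

definition copies_pairs :: "('i \<Rightarrow> 'j \<Rightarrow> ('p \<times> 'q) set) \<Rightarrow> (('p \<times> 'i) \<times> ('q \<times> 'j)) set" where
  "copies_pairs Q = {((a, c), (b, d)) |a b c d. (a, b) \<in> Q c d}"

lemma order_copies_iff:
  "((p, i), (q, j)) \<in> order_copies r t \<longleftrightarrow>
     p \<in> Field r \<and> q \<in> Field r \<and> i \<in> Field t \<and> j \<in> Field t \<and> ((i, j) \<in> t \<and> i \<noteq> j \<or> i = j \<and> (p, q) \<in> r)"
  by (simp add: order_copies_def)

lemma partial_iso_lcopies:
  assumes S: "partial_iso (unlab T) (unlab T') S"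
    and Q: "\<And>c d. partial_iso M N (Q c d)" and QS: "\<And>c d. Q c d \<noteq> {} \<Longrightarrow> (c, d) \<in> S"
    and lin: "Linear_order (fst M)" "Linear_order (fst N)" "Linear_order T" "Linear_order T'"
  shows "partial_iso (lcopies M T) (lcopies N T') (copies_pairs Q)"
proof (rule partial_isoI)
  fix x y assume "(x, y) \<in> copies_pairs Q"
  then obtain a b c d where "x = (a, c)" "y = (b, d)" "(a, b) \<in> Q c d" "(c, d) \<in> S"
    using QS by (fastforce simp: copies_pairs_def)
  then show "x \<in> pts (lcopies M T) \<and> y \<in> pts (lcopies N T') \<and>
      snd (lcopies M T) x = snd (lcopies N T') y"
    using partial_isoD(1-3)[OF Q] partial_isoD(1,2)[OF S]
    by (simp add: Field_order_copies lin)
next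
  fix x y x' y' assume "(x, y) \<in> copies_pairs Q" "(x', y') \<in> copies_pairs Q"
  then obtain a b c d a' b' c' d' where
    x: "x = (a, c)" "y = (b, d)" "x' = (a', c')" "y' = (b', d')"
    and m: "(a, b) \<in> Q c d" "(a', b') \<in> Q c' d'"
    by (auto simp: copies_pairs_def)
  then have s: "(c, d) \<in> S" "(c', d') \<in> S" using QS by blast+
  have cd: "c = c' \<longleftrightarrow> d = d'" "(c, c') \<in> T \<longleftrightarrow> (d, d') \<in> T'"
    using partial_isoD(4,5)[OF S s] by simp_all
  have ab: "(a = a' \<longleftrightarrow> b = b') \<and> ((a, a') \<in> fst M \<longleftrightarrow> (b, b') \<in> fst N)" if "c = c'"
    using partial_isoD(4,5)[OF Q m(1)] m(2) that cd by simp
  have f: "a \<in> pts M" "b \<in> pts N" "a' \<in> pts M" "b' \<in> pts N" "c \<in> Field T" "d \<in> Field T'"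
    "c' \<in> Field T" "d' \<in> Field T'"
    using partial_isoD(1,2)[OF Q] m partial_isoD(1,2)[OF S] s by auto
  show "(x = x' \<longleftrightarrow> y = y') \<and> ((x, x') \<in> fst (lcopies M T) \<longleftrightarrow> (y, y') \<in> fst (lcopies N T'))"
    using cd ab by (cases "c = c'") (simp_all add: x f order_copies_iff)
qed

text \<open>A position \<open>(a, c)\<close> is answered in two stages: \<open>d\<close> answers
  \<open>c\<close> in the game on the index orders, then \<open>b\<close> answers \<open>a\<close>
  in the game attached to \<open>(c, d)\<close>. Both stages are charged to the same round, so
  \<open>k\<close> rounds suffice everywhere.\<close>

lemma EF_lcopies:
  assumes lin: "Linear_order (fst M)" "Linear_order (fst N)" "Linear_order T" "Linear_order T'"
  shows "EF k (unlab T) (unlab T') S \<Longrightarrow> (\<And>c d. EF k M N (Q c d)) \<Longrightarrow>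
    (\<And>c d. Q c d \<noteq> {} \<Longrightarrow> (c, d) \<in> S) \<Longrightarrow> EF k (lcopies M T) (lcopies N T') (copies_pairs Q)"
proof (induction k arbitrary: S Q)
  case 0
  show ?case unfolding EF.simps
    by (rule partial_iso_lcopies[where S = S]) (use 0 lin in auto)
next
  case (Suc k)
  have step: "EF k (lcopies M T) (lcopies N T') (insert ((a, c), (b, d)) (copies_pairs Q))"
    if c: "EF k (unlab T) (unlab T') (insert (c, d) S)" and a: "EF k M N (insert (a, b) (Q c d))"
    for a b c d
  proof -
    \<comment> \<open>Only the game at \<open>(c, d)\<close> advances; every other one is weakened
      by \<open>EF_pred\<close>.\<close>
    define Q' where "Q' c' d' = (if (c', d') = (c, d) then insert (a, b) (Q c d) else Q c' d')" for c' d'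
    have "EF k M N (Q' c' d')" for c' d'
      using a EF_pred[OF Suc.prems(2)] by (simp add: Q'_def)
    moreover have "(c', d') \<in> insert (c, d) S" if "Q' c' d' \<noteq> {}" for c' d'
      using that Suc.prems(3) by (auto simp: Q'_def split: if_splits)
    ultimately have "EF k (lcopies M T) (lcopies N T') (copies_pairs Q')"
      by (rule Suc.IH[OF c])
    then show ?thesis
      by (rule EF_subset) (auto simp: copies_pairs_def Q'_def)
  qed
  show ?case
  proof (rule EF_SucI)
    show "partial_iso (lcopies M T) (lcopies N T') (copies_pairs Q)"
      by (rule partial_iso_lcopies[where S = S]) (use Suc.prems lin in \<open>blast intro: EF_partial_iso\<close>)+
  next
    fix x assume "x \<in> pts (lcopies M T)"
    then obtain a c where x: "x = (a, c)" "a \<in> pts M" "c \<in> pts (unlab T)"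
      by (auto simp: Field_order_copies lin)
    from EF_forth[OF Suc.prems(1) x(3)] obtain d
      where d: "d \<in> pts (unlab T')" "EF k (unlab T) (unlab T') (insert (c, d) S)" .
    from EF_forth[OF Suc.prems(2) x(2)] obtain b
      where b: "b \<in> pts N" "EF k M N (insert (a, b) (Q c d))" .
    have "(b, d) \<in> pts (lcopies N T')" using b d by (simp add: Field_order_copies lin)
    with step[OF d(2) b(2)] x
    show "\<exists>y\<in>pts (lcopies N T'). EF k (lcopies M T) (lcopies N T') (insert (x, y) (copies_pairs Q))"
      by blast
  next
    fix y assume "y \<in> pts (lcopies N T')"
    then obtain b d where y: "y = (b, d)" "b \<in> pts N" "d \<in> pts (unlab T')"
      by (auto simp: Field_order_copies lin)
    from EF_back[OF Suc.prems(1) y(3)] obtain c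
      where c: "c \<in> pts (unlab T)" "EF k (unlab T) (unlab T') (insert (c, d) S)" .
    from EF_back[OF Suc.prems(2) y(2)] obtain a
      where a: "a \<in> pts M" "EF k M N (insert (a, b) (Q c d))" .
    have "(a, c) \<in> pts (lcopies M T)" using a c by (simp add: Field_order_copies lin)
    with step[OF c(2) a(2)] y
    show "\<exists>x\<in>pts (lcopies M T). EF k (lcopies M T) (lcopies N T') (insert (x, y) (copies_pairs Q))"
      by blast
  qed
qed

lemma ef_equiv_lcopies:
  assumes "Linear_order (fst M)" "Linear_order (fst N)" "Linear_order T" "Linear_order T'"
    and "ef_equiv k M N" "ef_equiv k (unlab T) (unlab T')"
  shows "ef_equiv k (lcopies M T) (lcopies N T')"
  unfolding ef_equiv_def
  by (rule EF_subset[OF EF_lcopies[OF assms(1-4), of k "{}" "\<lambda>_ _. {}"]])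
    (use assms(5,6) in \<open>auto simp: ef_equiv_def\<close>)

definition sub_pairs :: "('a \<Rightarrow> 'b list) \<Rightarrow> ('p, 'a) lword \<Rightarrow> ('p \<times> 'q) set \<Rightarrow> (('p \<times> nat) \<times> ('q \<times> nat)) set" where
  "sub_pairs w M R = {((p, i), (q, i)) |p q i. (p, q) \<in> R \<and> i < length (w (snd M p))}"

lemma partial_iso_lsub:
  assumes R: "partial_iso M N R"
  shows "partial_iso (lsub w M) (lsub w N) (sub_pairs w M R)"
proof (rule partial_isoI)
  fix x y assume "(x, y) \<in> sub_pairs w M R"
  then show "x \<in> pts (lsub w M) \<and> y \<in> pts (lsub w N) \<and> snd (lsub w M) x = snd (lsub w N) y"
    using partial_isoD(1-3)[OF R] by (auto simp: sub_pairs_def pts_lsub lsub_simps)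
next
  fix x y x' y' assume "(x, y) \<in> sub_pairs w M R" "(x', y') \<in> sub_pairs w M R"
  then obtain p q i p' q' j where x: "x = (p, i)" "y = (q, i)" "x' = (p', j)" "y' = (q', j)"
    and m: "(p, q) \<in> R" "(p', q') \<in> R" "i < length (w (snd M p))" "j < length (w (snd M p'))"
    by (auto simp: sub_pairs_def)
  show "(x = x' \<longleftrightarrow> y = y') \<and> ((x, x') \<in> fst (lsub w M) \<longleftrightarrow> (y, y') \<in> fst (lsub w N))"
    using partial_isoD[OF R m(1)] partial_isoD(1-3)[OF R m(2)] m by (simp add: x lsub_simps)
qed

text \<open>Duplicator answers the block and keeps the index inside it; equal labels guarantee that
  this index exists on the other side.\<close>

lemma EF_lsub: "EF k M N R \<Longrightarrow> EF k (lsub w M) (lsub w N) (sub_pairs w M R)"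
proof (induction k arbitrary: R)
  case 0
  then show ?case by (simp add: partial_iso_lsub)
next
  case (Suc k)
  have step: "EF k (lsub w M) (lsub w N) (insert ((p, i), (q, i)) (sub_pairs w M R))"
    if "EF k M N (insert (p, q) R)" "i < length (w (snd M p))" for p q i
    by (rule EF_subset[OF Suc.IH[OF that(1)]]) (use that(2) in \<open>auto simp: sub_pairs_def\<close>)
  have lab: "snd M p = snd N q" if "EF k M N (insert (p, q) R)" for p q
    using partial_isoD(3)[OF EF_partial_iso[OF that]] by blast
  show ?case
  proof (rule EF_SucI)
    show "partial_iso (lsub w M) (lsub w N) (sub_pairs w M R)"
      using Suc.prems by (blast intro: partial_iso_lsub EF_partial_iso)
  next
    fix x assume "x \<in> pts (lsub w M)"
    then obtain p i where x: "x = (p, i)" "p \<in> pts M" "i < length (w (snd M p))"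
      by (auto simp: pts_lsub)
    from EF_forth[OF Suc.prems x(2)] obtain q where q: "q \<in> pts N" "EF k M N (insert (p, q) R)" .
    have "(q, i) \<in> pts (lsub w N)" using q lab[OF q(2)] x by (simp add: pts_lsub)
    with step[OF q(2) x(3)] x
    show "\<exists>y\<in>pts (lsub w N). EF k (lsub w M) (lsub w N) (insert (x, y) (sub_pairs w M R))" by blast
  next
    fix y assume "y \<in> pts (lsub w N)"
    then obtain q i where y: "y = (q, i)" "q \<in> pts N" "i < length (w (snd N q))"
      by (auto simp: pts_lsub)
    from EF_back[OF Suc.prems y(2)] obtain p where p: "p \<in> pts M" "EF k M N (insert (p, q) R)" .
    have i: "i < length (w (snd M p))" using y lab[OF p(2)] by simp
    then have "(p, i) \<in> pts (lsub w M)" using p by (simp add: pts_lsub)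
    with step[OF p(2) i] y
    show "\<exists>x\<in>pts (lsub w M). EF k (lsub w M) (lsub w N) (insert (x, y) (sub_pairs w M R))" by blast
  qed
qed

lemma ef_equiv_lsub: "ef_equiv k M N \<Longrightarrow> ef_equiv k (lsub w M) (lsub w N)"
  unfolding ef_equiv_def using EF_lsub[of k M N "{}" w] by (simp add: sub_pairs_def)

section \<open>Concatenations and powers of words as sums and copies\<close>

lemma dir_image_to_nat: "(to_nat x, to_nat y) \<in> dir_image r to_nat \<longleftrightarrow> (x, y) \<in> r"
  by (auto simp: dir_image_def)

lemma lword_iso_concat: "lword_iso to_nat (lsum (gw u) (gw v)) (gw (word_concat u v))"
  unfolding lword_iso_def
  by (auto simp: word_concat_def dir_image_to_nat dir_image_Field Field_order_sum inj_on_def)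

lemma lword_iso_power: "lword_iso to_nat (lcopies (gw u) T) (gw (word_power u T))"
  unfolding lword_iso_def
  by (auto simp: word_power_def dir_image_to_nat dir_image_Field inj_on_def)

section \<open>Sequential compactness\<close>

text \<open>The number of rounds is tied to the index: the \<open>k\<close>-th selected member
  agrees with the limit \<open>c\<close> for \<open>k\<close> rounds. Passing to a further
  subsequence only improves this, so limits can be taken one coordinate after another.\<close>

definition ef_compact :: "('p, 'a) lword \<Rightarrow> bool" where
  "ef_compact M \<longleftrightarrow> (\<forall>P q. finite P \<longrightarrow> P \<subseteq> pts M \<longrightarrow> range q \<subseteq> pts M \<longrightarrow>
     (\<exists>c\<in>pts M. \<exists>f :: nat \<Rightarrow> nat. strict_mono f \<and> (\<forall>k. EF k M M (insert (q (f k), c) (Id_on P)))))"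

lemma ef_compactE:
  assumes "ef_compact M" "finite P" "P \<subseteq> pts M" "\<And>n. q n \<in> pts M"
  obtains c f where "c \<in> pts M" "strict_mono (f :: nat \<Rightarrow> nat)"
    "\<And>k. EF k M M (insert (q (f k), c) (Id_on P))"
proof -
  have "range q \<subseteq> pts M" using assms(4) by blast
  with assms(1-3) have "\<exists>c\<in>pts M. \<exists>f :: nat \<Rightarrow> nat. strict_mono f \<and> (\<forall>k. EF k M M (insert (q (f k), c) (Id_on P)))"
    unfolding ef_compact_def by blast
  with that show thesis by blast
qed

lemma ef_compactI:
  assumes "\<And>P q. finite P \<Longrightarrow> P \<subseteq> pts M \<Longrightarrow> (\<And>n. q n \<in> pts M) \<Longrightarrow>
    \<exists>c\<in>pts M. \<exists>f :: nat \<Rightarrow> nat. strict_mono f \<and> (\<forall>k. EF k M M (insert (q (f k), c) (Id_on P)))"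
  shows "ef_compact M"
  unfolding ef_compact_def using assms by (simp add: subset_iff)

text \<open>A game on \<open>M\<close> is carried to \<open>N\<close> by composing it with the graph
  of \<open>f\<close> on one side and with its converse on the other.\<close>

lemma ef_compact_iso:
  assumes iso: "lword_iso f M N" and M: "ef_compact M"
  shows "ef_compact N"
proof (rule ef_compactI)
  fix P' and q' :: "nat \<Rightarrow> _" assume P': "finite P'" "P' \<subseteq> pts N" and q': "\<And>n. q' n \<in> pts N"
  have inj: "inj_on f (pts M)" and im: "f ` pts M = pts N" using iso by (auto simp: lword_iso_def)
  define g where "g = inv_into (pts M) f"
  have g: "g y \<in> pts M" "f (g y) = y" if "y \<in> pts N" for y
    using that im unfolding g_def by (auto intro: inv_into_into f_inv_into_f)
  obtain c h where c: "c \<in> pts M" "strict_mono (h :: nat \<Rightarrow> nat)"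
    and ef: "\<And>k. EF k M M (insert (g (q' (h k)), c) (Id_on (g ` P')))"
    using ef_compactE[OF M, of "g ` P'" "\<lambda>n. g (q' n)"] P' q' g by blast
  define G where "G = (\<lambda>p. (p, f p)) ` pts M"
  have "EF k N N (insert (q' (h k), f c) (Id_on P'))" for k
  proof (rule EF_subset)
    show "EF k N N (G\<inverse> O insert (g (q' (h k)), c) (Id_on (g ` P')) O G)"
      unfolding G_def by (intro EF_relcomp[OF EF_converse[OF EF_iso[OF iso]]] EF_relcomp[OF ef EF_iso[OF iso]])
    have G: "(g y, y) \<in> G" if "y \<in> pts N" for y using g[OF that] unfolding G_def by force
    have "(y, y) \<in> G\<inverse> O insert (g (q' (h k)), c) (Id_on (g ` P')) O G" if "y \<in> P'" for y
      using G[of y] that P' by blast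
    moreover have "(q' (h k), f c) \<in> G\<inverse> O insert (g (q' (h k)), c) (Id_on (g ` P')) O G"
      using G[OF q'] c(1) unfolding G_def by blast
    ultimately show "insert (q' (h k), f c) (Id_on P') \<subseteq> G\<inverse> O insert (g (q' (h k)), c) (Id_on (g ` P')) O G"
      by blast
  qed
  moreover have "f c \<in> pts N" using c im by blast
  ultimately show "\<exists>c\<in>pts N. \<exists>f :: nat \<Rightarrow> nat. strict_mono f \<and> (\<forall>k. EF k N N (insert (q' (f k), c) (Id_on P')))"
    using c(2) by blast
qed

text \<open>Infinitely many members lie in one summand; their limit is taken there over the
  parameters of that summand, while the other summand is matched identically.\<close>

lemma ef_compact_lsum:
  assumes M: "ef_compact M" and N: "ef_compact N"
  shows "ef_compact (lsum M N)"
proof (rule ef_compactI)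
  fix P and q :: "nat \<Rightarrow> _" assume P: "finite P" "P \<subseteq> pts (lsum M N)" and q: "\<And>n. q n \<in> pts (lsum M N)"
  define P1 P2 where "P1 = Inl -` P" and "P2 = Inr -` P"
  have P12: "finite P1" "P1 \<subseteq> pts M" "finite P2" "P2 \<subseteq> pts N"
    using P unfolding P1_def P2_def by (auto simp: Field_order_sum intro: finite_vimageI)
  have Psum: "Id_on P \<subseteq> sum_pairs (Id_on P1) (Id_on P2)"
  proof
    fix z assume "z \<in> Id_on P"
    then obtain x where "x \<in> P" "z = (x, x)" by blast
    then show "z \<in> sum_pairs (Id_on P1) (Id_on P2)"
      by (cases x) (force simp: sum_pairs_def P1_def P2_def)+
  qed
  let ?goal = "\<exists>c\<in>pts (lsum M N). \<exists>f :: nat \<Rightarrow> nat. strict_mono f \<and>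
      (\<forall>k. EF k (lsum M N) (lsum M N) (insert (q (f k), c) (Id_on P)))"
  have "infinite {n. q n \<in> Inl ` pts M} \<or> infinite {n. q n \<in> Inr ` pts N}"
  proof (rule ccontr)
    assume "\<not> ?thesis"
    then have "finite ({n. q n \<in> Inl ` pts M} \<union> {n. q n \<in> Inr ` pts N})" by blast
    moreover have "{n. q n \<in> Inl ` pts M} \<union> {n. q n \<in> Inr ` pts N} = UNIV"
      using q by (auto simp: Field_order_sum)
    ultimately show False by simp
  qed
  then show ?goal
  proof
    assume inf: "infinite {n. q n \<in> Inl ` pts M}"
    define e where "e = Infinite_Set.enumerate {n. q n \<in> Inl ` pts M}"
    have e: "strict_mono e" "q (e n) \<in> Inl ` pts M" for n
      using strict_mono_enumerate[OF inf] enumerate_in_set[OF inf] by (auto simp: e_def)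
    then have "\<forall>n. \<exists>a\<in>pts M. q (e n) = Inl a" by blast
    then obtain a where a: "\<And>n. a n \<in> pts M" "\<And>n. q (e n) = Inl (a n)" by metis
    obtain c f where c: "c \<in> pts M" "strict_mono (f :: nat \<Rightarrow> nat)"
      and ef: "\<And>k. EF k M M (insert (a (f k), c) (Id_on P1))"
      using ef_compactE[OF M P12(1,2), of a] a(1) by blast
    have "EF k (lsum M N) (lsum M N) (insert (q ((e \<circ> f) k), Inl c) (Id_on P))" for k
      by (rule EF_subset[OF EF_lsum[OF ef[of k] EF_Id_on[OF P12(4)]]])
        (use Psum in \<open>auto simp: sum_pairs_def a\<close>)
    moreover have "strict_mono (e \<circ> f)" using e(1) c(2) by (rule strict_mono_o)
    moreover have "Inl c \<in> pts (lsum M N)" using c(1) by (simp add: Field_order_sum)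
    ultimately show ?goal by blast
  next
    assume inf: "infinite {n. q n \<in> Inr ` pts N}"
    define e where "e = Infinite_Set.enumerate {n. q n \<in> Inr ` pts N}"
    have e: "strict_mono e" "q (e n) \<in> Inr ` pts N" for n
      using strict_mono_enumerate[OF inf] enumerate_in_set[OF inf] by (auto simp: e_def)
    then have "\<forall>n. \<exists>a\<in>pts N. q (e n) = Inr a" by blast
    then obtain a where a: "\<And>n. a n \<in> pts N" "\<And>n. q (e n) = Inr (a n)" by metis
    obtain c f where c: "c \<in> pts N" "strict_mono (f :: nat \<Rightarrow> nat)"
      and ef: "\<And>k. EF k N N (insert (a (f k), c) (Id_on P2))"
      using ef_compactE[OF N P12(3,4), of a] a(1) by blast
    have "EF k (lsum M N) (lsum M N) (insert (q ((e \<circ> f) k), Inr c) (Id_on P))" for k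
      by (rule EF_subset[OF EF_lsum[OF EF_Id_on[OF P12(2)] ef[of k]]])
        (use Psum in \<open>auto simp: sum_pairs_def a\<close>)
    moreover have "strict_mono (e \<circ> f)" using e(1) c(2) by (rule strict_mono_o)
    moreover have "Inr c \<in> pts (lsum M N)" using c(1) by (simp add: Field_order_sum)
    ultimately show ?goal by blast
  qed
qed

text \<open>First the indices converge along \<open>f\<close>; then, along a further subsequence
  \<open>g\<close>, the inner positions converge over the parameters of the limit copy
  \<open>c\<close>.\<close>

lemma ef_compact_lcopies:
  assumes M: "ef_compact M" "Linear_order (fst M)" and T: "ef_compact (unlab T)" "Linear_order T"
  shows "ef_compact (lcopies M T)"
proof (rule ef_compactI)
  fix P and q :: "nat \<Rightarrow> _"
  assume P: "finite P" "P \<subseteq> pts (lcopies M T)" and q: "\<And>n. q n \<in> pts (lcopies M T)"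
  have pts: "pts (lcopies M T) = pts M \<times> Field T" by (simp add: Field_order_copies M T)
  define C where "C = snd ` P"
  have C: "finite C" "C \<subseteq> pts (unlab T)" using P unfolding C_def pts by auto
  have q': "snd (q n) \<in> pts (unlab T)" "fst (q n) \<in> pts M" for n using q[of n] unfolding pts by auto
  obtain c f where c: "c \<in> pts (unlab T)" "strict_mono (f :: nat \<Rightarrow> nat)"
    and efT: "\<And>k. EF k (unlab T) (unlab T) (insert (snd (q (f k)), c) (Id_on C))"
    using ef_compactE[OF T(1) C, of "\<lambda>n. snd (q n)"] q' by blast
  define Px where "Px x = {a. (a, x) \<in> P}" for x
  have Px: "finite (Px x)" "Px x \<subseteq> pts M" for x
  proof -
    have "Px x \<subseteq> fst ` P" unfolding Px_def by force
    then show "finite (Px x)" using P(1) by (rule finite_surj[rotated])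
    show "Px x \<subseteq> pts M" using P(2) unfolding pts Px_def by auto
  qed
  obtain a g where a: "a \<in> pts M" "strict_mono (g :: nat \<Rightarrow> nat)"
    and efM: "\<And>k. EF k M M (insert (fst (q (f (g k))), a) (Id_on (Px c)))"
    using ef_compactE[OF M(1) Px, of "\<lambda>n. fst (q (f n))"] q' by blast
  have "EF k (lcopies M T) (lcopies M T) (insert (q ((f \<circ> g) k), (a, c)) (Id_on P))" for k
  proof -
    obtain a' c' where ac': "q (f (g k)) = (a', c')" by fastforce
    \<comment> \<open>If copy \<open>c\<close> contains a parameter, the game on the indices
      contains both \<open>(c', c)\<close> and \<open>(c, c)\<close> and forces
      \<open>c' = c\<close>; otherwise \<open>Px c\<close> is empty. So the parameters attached to
      \<open>(c', c)\<close> never clash with those of copy \<open>c\<close>.\<close>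
    define Q where "Q x y = (if (x, y) = (c', c) then insert (a', a) (Id_on (Px c))
      else if x = y then Id_on (Px x) else {})" for x y
    have "k \<le> g k" using a(2) by (rule strict_mono_imp_increasing)
    then have "EF k (unlab T) (unlab T) (insert (c', c) (Id_on C))"
      using EF_le[OF efT[of "g k"]] by (simp add: ac')
    moreover have "EF k M M (Q x y)" for x y
      using efM[of k] EF_Id_on[OF Px(2)] EF_Id_on[of "{}" M k] by (simp add: Q_def ac')
    moreover have "(x, y) \<in> insert (c', c) (Id_on C)" if "Q x y \<noteq> {}" for x y
      using that unfolding Q_def C_def Px_def by (auto split: if_splits simp: image_iff) force+
    ultimately have "EF k (lcopies M T) (lcopies M T) (copies_pairs Q)"
      using EF_lcopies[OF M(2) M(2) T(2) T(2)] by blast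
    then show ?thesis
      by (rule EF_subset) (auto simp: ac' copies_pairs_def Q_def Px_def)
  qed
  moreover have "strict_mono (f \<circ> g)" using c(2) a(2) by (rule strict_mono_o)
  moreover have "(a, c) \<in> pts (lcopies M T)" using a c pts by simp
  ultimately show "\<exists>c\<in>pts (lcopies M T). \<exists>f :: nat \<Rightarrow> nat. strict_mono f \<and>
      (\<forall>k. EF k (lcopies M T) (lcopies M T) (insert (q (f k), c) (Id_on P)))" by blast
qed

lemma ef_compact_finite_word: "ef_compact (gw (finite_word [a]))"
proof (rule ef_compactI)
  fix P and q :: "nat \<Rightarrow> _"
  assume P: "P \<subseteq> pts (gw (finite_word [a]))" and q: "\<And>n. q n \<in> pts (gw (finite_word [a]))"
  have "q n = 1" for n using q[of n] by (simp add: positions_finite_word)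
  moreover have "1 \<in> pts (gw (finite_word [a]))" by (simp add: positions_finite_word)
  moreover have "EF k (gw (finite_word [a])) (gw (finite_word [a])) (insert (1, 1) (Id_on P))" for k
    by (rule EF_subset[OF EF_Id_on[of "insert 1 P"]]) (use P \<open>1 \<in> _\<close> in auto)
  ultimately show "\<exists>c\<in>pts (gw (finite_word [a])). \<exists>f :: nat \<Rightarrow> nat. strict_mono f \<and>
      (\<forall>k. EF k (gw (finite_word [a])) (gw (finite_word [a])) (insert (q (f k), c) (Id_on P)))"
    using strict_mono_id by auto
qed


section \<open>The order type rho and finite orders\<close>

text \<open>A common home for rho and the finite orders: the first component names a column and the
  second a place in it, compared lexicographically.\<close>

definition lex_order :: "(rat \<times> int) set \<Rightarrow> (rat \<times> int) rel" where
  "lex_order D = {(x, y). x \<in> D \<and> y \<in> D \<and> x \<le> y}"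

lemma lex_order_iff: "(x, y) \<in> lex_order D \<longleftrightarrow> x \<in> D \<and> y \<in> D \<and> x \<le> y"
  by (simp add: lex_order_def)

lemma Field_lex_order [simp]: "Field (lex_order D) = D"
  by (auto simp: lex_order_def Field_def)

text \<open>Columns are intervals of Z. Only a column with nothing to its left may have a least
  element, and only one with nothing to its right a greatest element, so distinct columns are
  infinitely far apart, as \<open>gap\<close> assumes.\<close>

definition columnar :: "(rat \<times> int) set \<Rightarrow> bool" where
  "columnar D \<longleftrightarrow>
     (\<forall>b i j m. (b, i) \<in> D \<longrightarrow> (b, j) \<in> D \<longrightarrow> i \<le> m \<longrightarrow> m \<le> j \<longrightarrow> (b, m) \<in> D) \<and>
     (\<forall>b b' i j. (b, i) \<in> D \<longrightarrow> (b', j) \<in> D \<longrightarrow> b < b' \<longrightarrow>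
        (\<forall>m\<ge>i. (b, m) \<in> D) \<and> (\<forall>m\<le>j. (b', m) \<in> D))"

text \<open>Meaningful for \<open>x \<le> y\<close> only; different columns are infinitely far apart.\<close>
definition gap :: "nat \<Rightarrow> rat \<times> int \<Rightarrow> rat \<times> int \<Rightarrow> int" where
  "gap k x y = (if fst x = fst y then min (2 ^ k) (snd y - snd x) else 2 ^ k)"

lemma gap_pos: "x < y \<Longrightarrow> 0 < gap k x y"
  by (auto simp: gap_def less_prod_def)

lemma gap_self [simp]: "gap k x x = 0"
  by (simp add: gap_def)

lemma gap_add: "x \<le> y \<Longrightarrow> y \<le> z \<Longrightarrow> gap k x z = min (2 ^ k) (gap k x y + gap k y z)"
  by (auto simp: gap_def less_eq_prod_def min_def)

lemma gap_Suc: "gap k x y = min (2 ^ k) (gap (Suc k) x y)"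
proof -
  define K :: int where "K = 2 ^ k"
  have "0 < K" by (simp add: K_def)
  then show ?thesis by (auto simp: gap_def K_def[symmetric] min_def)
qed

text \<open>The halving step of the game on linear orders. If \<open>p\<close> is closer than
  \<open>2 ^ k\<close> to one end, that distance is copied from the same end; otherwise
  \<open>e\<close> is put \<open>2 ^ k\<close> to the right of \<open>d\<close>. Equality of the
  gaps up to \<open>2 ^ Suc k\<close> then leaves the required distance on the other side. This is
  why the cap doubles with each round.\<close>

lemma gap_interpolate:
  assumes E: "columnar E" "d \<in> E" "d' \<in> E" and le: "c \<le> p" "p \<le> c'" "d \<le> d'"
    and eq: "gap (Suc k) c c' = gap (Suc k) d d'"
  shows "\<exists>e\<in>E. d \<le> e \<and> e \<le> d' \<and> gap k c p = gap k d e \<and> gap k p c' = gap k e d'"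
proof -
  obtain cb ci pb pi cb' ci' db di db' di' where
    s: "c = (cb, ci)" "p = (pb, pi)" "c' = (cb', ci')" "d = (db, di)" "d' = (db', di')"
    by (metis surj_pair)
  define K :: int where "K = 2 ^ k"
  have K: "K > 0" "2 ^ Suc k = 2 * K" by (simp_all add: K_def)
  have g: "gap k x y = (if fst x = fst y then min K (snd y - snd x) else K)"
    "gap (Suc k) x y = (if fst x = fst y then min (2 * K) (snd y - snd x) else 2 * K)" for x y
    by (simp_all add: gap_def K_def)
  have col: "i \<le> m \<Longrightarrow> m \<le> j \<Longrightarrow> (b, m) \<in> E" if "(b, i) \<in> E" "(b, j) \<in> E" for b i j m
    using E(1) that unfolding columnar_def by blast
  have cols: "i \<le> m \<Longrightarrow> (b, m) \<in> E" "m \<le> j \<Longrightarrow> (b', m) \<in> E"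
    if "(b, i) \<in> E" "(b', j) \<in> E" "b < b'" for b b' i j m
    using E(1) that unfolding columnar_def by blast+
  have lt: "db < db'" if "db \<noteq> db'"
    using le(3) that by (auto simp: s less_eq_prod_def)
  \<comment> \<open>\<open>right\<close> and \<open>left\<close> go \<open>m\<close> steps from
    \<open>d\<close> and from \<open>d'\<close>; by \<open>columnar\<close> these points exist in
    \<open>E\<close> even when \<open>d\<close> and \<open>d'\<close> lie in different
    columns.\<close>
  have right: "(db, di + m) \<in> E" if "0 \<le> m" "db = db' \<longrightarrow> m \<le> di' - di" for m
    using col[of db di di' "di + m"] cols(1)[of db di db' di' "di + m"] lt E(2,3) that
    by (cases "db = db'") (simp_all add: s)
  have left: "(db', di' - m) \<in> E" if "0 \<le> m" "db = db' \<longrightarrow> m \<le> di' - di" for m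
    using col[of db di di' "di' - m"] cols(2)[of db di db' di' "di' - m"] lt E(2,3) that
    by (cases "db = db'") (simp_all add: s)
  consider (A) "cb = pb" "pi - ci < K" | (B) "pb = cb'" "ci' - pi < K"
    | (C) "cb = pb \<longrightarrow> K \<le> pi - ci" "pb = cb' \<longrightarrow> K \<le> ci' - pi" by linarith
  then show ?thesis
  proof cases
    case A
    then have "(db, di + (pi - ci)) \<in> E"
      using le eq K by (intro right) (auto simp: s g less_eq_prod_def min_def split: if_splits)
    then show ?thesis
      by (rule bexI[rotated]) (use A le eq K in \<open>auto simp: s g less_eq_prod_def min_def split: if_splits\<close>)
  next
    case B
    then have "(db', di' - (ci' - pi)) \<in> E"
      using le eq K by (intro left) (auto simp: s g less_eq_prod_def min_def split: if_splits)
    then show ?thesis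
      by (rule bexI[rotated]) (use B le eq K in \<open>auto simp: s g less_eq_prod_def min_def split: if_splits\<close>)
  next
    case C
    then have "(db, di + K) \<in> E"
      using le eq K by (intro right) (auto simp: s g less_eq_prod_def min_def split: if_splits)
    then show ?thesis
      by (rule bexI[rotated]) (use C le eq K in \<open>auto simp: s g less_eq_prod_def min_def split: if_splits\<close>)
  qed
qed

text \<open>Matching least and matching greatest elements belong to \<open>R\<close>, so that any
  other position lies between two picked ones.\<close>

definition gap_similar ::
    "nat \<Rightarrow> (rat \<times> int) set \<Rightarrow> (rat \<times> int) set \<Rightarrow> ((rat \<times> int) \<times> (rat \<times> int)) set \<Rightarrow> bool" where
  "gap_similar k D E R \<longleftrightarrow> finite R \<and> R \<subseteq> D \<times> E \<and>
     (\<exists>l l'. (l, l') \<in> R \<and> (\<forall>x\<in>D. l \<le> x) \<and> (\<forall>y\<in>E. l' \<le> y)) \<and>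
     (\<exists>g g'. (g, g') \<in> R \<and> (\<forall>x\<in>D. x \<le> g) \<and> (\<forall>y\<in>E. y \<le> g')) \<and>
     (\<forall>x y x' y'. (x, y) \<in> R \<longrightarrow> (x', y') \<in> R \<longrightarrow>
        (x < x' \<longleftrightarrow> y < y') \<and> (x \<le> x' \<longrightarrow> gap k x x' = gap k y y'))"

lemma gap_similar_pair:
  assumes D: "a \<in> D" "b \<in> D" "\<And>x. x \<in> D \<Longrightarrow> a \<le> x" "\<And>x. x \<in> D \<Longrightarrow> x \<le> b"
    and E: "a' \<in> E" "b' \<in> E" "\<And>x. x \<in> E \<Longrightarrow> a' \<le> x" "\<And>x. x \<in> E \<Longrightarrow> x \<le> b'"
    and lt: "a < b" "a' < b'" and gap: "gap k a b = gap k a' b'"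
  shows "gap_similar k D E {(a, a'), (b, b')}"
  unfolding gap_similar_def
proof (intro conjI)
  show "\<exists>l l'. (l, l') \<in> {(a, a'), (b, b')} \<and> (\<forall>x\<in>D. l \<le> x) \<and> (\<forall>y\<in>E. l' \<le> y)"
    using D E by blast
  show "\<exists>g g'. (g, g') \<in> {(a, a'), (b, b')} \<and> (\<forall>x\<in>D. x \<le> g) \<and> (\<forall>y\<in>E. y \<le> g')"
    using D E by blast
  have "\<not> b < a" "\<not> b \<le> a" "\<not> b' < a'" using lt by auto
  then show "\<forall>x y x' y'. (x, y) \<in> {(a, a'), (b, b')} \<longrightarrow> (x', y') \<in> {(a, a'), (b, b')} \<longrightarrow>
      (x < x' \<longleftrightarrow> y < y') \<and> (x \<le> x' \<longrightarrow> gap k x x' = gap k y y')"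
    using lt gap by (simp add: imp_conjL) 
qed (use D E in auto)

lemma gap_similarD:
  assumes "gap_similar k D E R" "(x, y) \<in> R" "(x', y') \<in> R"
  shows "x < x' \<longleftrightarrow> y < y'" "x \<le> x' \<longleftrightarrow> y \<le> y'" "x = x' \<longleftrightarrow> y = y'"
    "x \<le> x' \<Longrightarrow> gap k x x' = gap k y y'"
proof -
  have "(x < x' \<longleftrightarrow> y < y') \<and> (x' < x \<longleftrightarrow> y' < y)" using assms unfolding gap_similar_def by blast
  then show "x < x' \<longleftrightarrow> y < y'" "x \<le> x' \<longleftrightarrow> y \<le> y'" "x = x' \<longleftrightarrow> y = y'" by (auto simp: not_less[symmetric] order.order_iff_strict)
  show "x \<le> x' \<Longrightarrow> gap k x x' = gap k y y'" using assms unfolding gap_similar_def by blast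
qed

lemma gap_similar_converse: "gap_similar k D E R \<Longrightarrow> gap_similar k E D (R\<inverse>)"
proof -
  assume a: "gap_similar k D E R"
  have "\<forall>x y x' y'. (x, y) \<in> R\<inverse> \<longrightarrow> (x', y') \<in> R\<inverse> \<longrightarrow>
        (x < x' \<longleftrightarrow> y < y') \<and> (x \<le> x' \<longrightarrow> gap k x x' = gap k y y')"
    using gap_similarD[OF a] by (metis converseD)
  moreover have "finite (R\<inverse>)" "R\<inverse> \<subseteq> E \<times> D" using a unfolding gap_similar_def by auto
  moreover have "\<exists>l l'. (l, l') \<in> R\<inverse> \<and> (\<forall>x\<in>E. l \<le> x) \<and> (\<forall>y\<in>D. l' \<le> y)"
    "\<exists>g g'. (g, g') \<in> R\<inverse> \<and> (\<forall>x\<in>E. x \<le> g) \<and> (\<forall>y\<in>D. y \<le> g')"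
    using a unfolding gap_similar_def by blast+
  ultimately show ?thesis unfolding gap_similar_def by blast
qed

lemma gap_similar_Suc: "gap_similar (Suc k) D E R \<Longrightarrow> gap_similar k D E R"
proof -
  assume a: "gap_similar (Suc k) D E R"
  have "(x < x' \<longleftrightarrow> y < y') \<and> (x \<le> x' \<longrightarrow> gap k x x' = gap k y y')"
    if "(x, y) \<in> R" "(x', y') \<in> R" for x y x' y'
    using gap_similarD[OF a that] gap_Suc[of k x x'] gap_Suc[of k y y'] by simp
  then show ?thesis using a unfolding gap_similar_def by blast
qed

text \<open>Only the gaps to the picked neighbours \<open>c\<close> and \<open>c'\<close> are
  assumed. Gaps to all other picked positions follow, since \<open>gap_add\<close> recovers a
  truncated gap from its truncated parts.\<close>

lemma gap_similar_insert:
  assumes R: "gap_similar k D E R" and cd: "(c, d) \<in> R" "(c', d') \<in> R"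
    and p: "p \<in> D" "c < p" "p < c'" and e: "e \<in> E" "d < e" "e < d'"
    and out: "\<And>x y. (x, y) \<in> R \<Longrightarrow> x \<le> c \<or> c' \<le> x"
    and gap: "gap k c p = gap k d e" "gap k p c' = gap k e d'"
  shows "gap_similar k D E (insert (p, e) R)"
proof -
  have new: "(x < p \<longleftrightarrow> y < e) \<and> (p < x \<longleftrightarrow> e < y) \<and> x \<noteq> p \<and> y \<noteq> e \<and>
      (x \<le> p \<longrightarrow> gap k x p = gap k y e) \<and> (p \<le> x \<longrightarrow> gap k p x = gap k e y)"
    if xy: "(x, y) \<in> R" for x y
    using out[OF xy]
  proof
    assume le: "x \<le> c"
    then have "y \<le> d" using gap_similarD(2)[OF R xy cd(1)] by simp
    moreover have "gap k x c = gap k y d" using gap_similarD(4)[OF R xy cd(1) le] .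
    moreover have "gap k x p = min (2 ^ k) (gap k x c + gap k c p)"
      using le p by (intro gap_add) auto
    moreover have "gap k y e = min (2 ^ k) (gap k y d + gap k d e)"
      using \<open>y \<le> d\<close> e by (intro gap_add) auto
    ultimately show ?thesis using le p e gap by auto
  next
    assume le: "c' \<le> x"
    then have "d' \<le> y" using gap_similarD(2)[OF R cd(2) xy] by simp
    moreover have "gap k c' x = gap k d' y" using gap_similarD(4)[OF R cd(2) xy le] .
    moreover have "gap k p x = min (2 ^ k) (gap k p c' + gap k c' x)"
      using le p by (intro gap_add) auto
    moreover have "gap k e y = min (2 ^ k) (gap k e d' + gap k d' y)"
      using \<open>d' \<le> y\<close> e by (intro gap_add) auto
    ultimately show ?thesis using le p e gap by auto
  qed
  have "(x < x' \<longleftrightarrow> y < y') \<and> (x \<le> x' \<longrightarrow> gap k x x' = gap k y y')"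
    if "(x, y) \<in> insert (p, e) R" "(x', y') \<in> insert (p, e) R" for x y x' y'
    using that new[of x y] new[of x' y'] gap_similarD[OF R, of x y x' y'] by auto
  then show ?thesis using R p(1) e(1) unfolding gap_similar_def by (simp, blast)
qed

lemma gap_similar_extend:
  assumes R: "gap_similar (Suc k) D E R" and E: "columnar E" and p: "p \<in> D"
  shows "\<exists>e\<in>E. gap_similar k D E (insert (p, e) R)"
proof (cases "p \<in> Domain R")
  case True
  then obtain e where e: "(p, e) \<in> R" by blast
  then have "e \<in> E" using R unfolding gap_similar_def by blast
  with e gap_similar_Suc[OF R] show ?thesis by (metis insert_absorb)
next
  case False
  have fin: "finite (Domain R)" using R unfolding gap_similar_def by (simp add: finite_Domain)
  obtain l where l: "l \<in> Domain R" "l < p"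
    using R p False unfolding gap_similar_def by (metis DomainI order.order_iff_strict)
  obtain g where g: "g \<in> Domain R" "p < g"
    using R p False unfolding gap_similar_def by (metis DomainI order.order_iff_strict)
  \<comment> \<open>The picked positions closest to \<open>p\<close> from below and from
    above.\<close>
  define c where "c = Max {x \<in> Domain R. x < p}"
  define c' where "c' = Min {x \<in> Domain R. p < x}"
  have "finite {x \<in> Domain R. x < p}" "{x \<in> Domain R. x < p} \<noteq> {}"
    "finite {x \<in> Domain R. p < x}" "{x \<in> Domain R. p < x} \<noteq> {}"
    using fin l g by (simp, blast, simp, blast)
  then have "c \<in> {x \<in> Domain R. x < p}" unfolding c_def by (intro Max_in)
  moreover have "c' \<in> {x \<in> Domain R. p < x}" unfolding c'_def
    using \<open>finite {x \<in> Domain R. p < x}\<close> \<open>{x \<in> Domain R. p < x} \<noteq> {}\<close> by (rule Min_in)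
  ultimately obtain d d' where cd: "(c, d) \<in> R" "(c', d') \<in> R" and cp: "c < p" "p < c'" by blast
  have out: "x \<le> c \<or> c' \<le> x" if "(x, y) \<in> R" for x y
  proof -
    have "x \<in> Domain R" "x \<noteq> p" using that False by auto
    then show ?thesis
      using fin unfolding c_def c'_def by (cases "x < p") (auto intro!: Max_ge Min_le)
  qed
  have dd: "d \<in> E" "d' \<in> E" using cd R unfolding gap_similar_def by blast+
  have le: "c \<le> c'" "d \<le> d'" using cp gap_similarD(2)[OF R cd] by auto
  obtain e where e: "e \<in> E" "d \<le> e" "e \<le> d'" "gap k c p = gap k d e" "gap k p c' = gap k e d'"
    using gap_interpolate[OF E dd less_imp_le[OF cp(1)] less_imp_le[OF cp(2)] le(2)
        gap_similarD(4)[OF R cd le(1)]] by blast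
  have "d \<noteq> e" "e \<noteq> d'" using gap_pos[OF cp(1), of k] gap_pos[OF cp(2), of k] e by auto
  then have "d < e" "e < d'" using e by auto
  then have "gap_similar k D E (insert (p, e) R)"
    using gap_similar_insert[OF gap_similar_Suc[OF R] cd p cp] e out by blast
  with e show ?thesis by blast
qed

lemma partial_iso_lex_order:
  assumes R: "gap_similar k D E R"
  shows "partial_iso (unlab (lex_order D)) (unlab (lex_order E)) R"
proof -
  have sub: "x \<in> D" "y \<in> E" if "(x, y) \<in> R" for x y
    using R that unfolding gap_similar_def by blast+
  show ?thesis
  proof (rule partial_isoI)
    fix p q p' q' assume "(p, q) \<in> R" "(p', q') \<in> R"
    then show "(p = p' \<longleftrightarrow> q = q') \<and> ((p, p') \<in> fst (unlab (lex_order D)) \<longleftrightarrow> (q, q') \<in> fst (unlab (lex_order E)))"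
      using gap_similarD(2,3)[OF R, of p q p' q'] sub[of p q] sub[of p' q'] by (simp add: lex_order_iff)
  qed (simp add: sub)
qed

lemma EF_lex_order:
  assumes DE: "columnar D" "columnar E"
  shows "gap_similar k D E R \<Longrightarrow> EF k (unlab (lex_order D)) (unlab (lex_order E)) R"
proof (induction k arbitrary: R)
  case 0
  then show ?case by (simp add: partial_iso_lex_order)
next
  case (Suc k)
  show ?case
  proof (rule EF_SucI)
    show "partial_iso (unlab (lex_order D)) (unlab (lex_order E)) R"
      using Suc.prems by (rule partial_iso_lex_order)
  next
    fix p assume "p \<in> pts (unlab (lex_order D))"
    then have "p \<in> D" by simp
    from gap_similar_extend[OF Suc.prems DE(2) this] Suc.IH
    show "\<exists>q\<in>pts (unlab (lex_order E)). EF k (unlab (lex_order D)) (unlab (lex_order E)) (insert (p, q) R)"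
      by (metis Field_lex_order unlab_simps(1))
  next
    fix q assume "q \<in> pts (unlab (lex_order E))"
    then have "q \<in> E" by simp
    then obtain p where p: "p \<in> D" "gap_similar k E D (insert (q, p) (R\<inverse>))"
      using gap_similar_extend[OF gap_similar_converse[OF Suc.prems] DE(1)] by blast
    have "(insert (q, p) (R\<inverse>))\<inverse> = insert (p, q) R" by auto
    then have "gap_similar k D E (insert (p, q) R)" using gap_similar_converse[OF p(2)] by simp
    with p Suc.IH show "\<exists>p\<in>pts (unlab (lex_order D)). EF k (unlab (lex_order D)) (unlab (lex_order E)) (insert (p, q) R)"
      by auto
  qed
qed

lemma strict_mono_choice:
  fixes I :: "nat \<Rightarrow> nat set"
  assumes "\<And>k. infinite (I k)"
  obtains f where "strict_mono f" "\<And>k. f k \<in> I k"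
proof -
  have "\<exists>f. \<forall>n. f n \<in> I n \<and> f n < f (Suc n)"
  proof (rule dependent_nat_choice)
    show "\<exists>x. x \<in> I 0" using infinite_imp_nonempty[OF assms[of 0]] by blast
    show "\<exists>y. y \<in> I (Suc n) \<and> x < y" for x n :: nat
      using assms[of "Suc n"] unfolding infinite_nat_iff_unbounded by blast
  qed
  with that show thesis by (auto simp: strict_mono_Suc_iff)
qed

text \<open>A value hit infinitely often is itself a limit. Otherwise infinitely many members lie
  between the same two neighbouring parameters \<open>c\<close> and \<open>c'\<close>, and their
  distances to both exceed every bound. Hence \<open>c\<close> and \<open>c'\<close> lie in
  different columns, and any point of a column strictly between them is a limit, since the games see
  truncated gaps only.\<close>

lemma ef_compact_lex_order:
  assumes D: "columnar D" "l \<in> D" "g \<in> D" "\<And>x. x \<in> D \<Longrightarrow> l \<le> x" "\<And>x. x \<in> D \<Longrightarrow> x \<le> g"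
    and dense: "\<And>x y. x \<in> D \<Longrightarrow> y \<in> D \<Longrightarrow> fst x < fst y \<Longrightarrow> \<exists>z\<in>D. fst x < fst z \<and> fst z < fst y"
  shows "ef_compact (unlab (lex_order D))"
proof (rule ef_compactI)
  fix P0 and q :: "nat \<Rightarrow> rat \<times> int"
  assume "finite P0" "P0 \<subseteq> pts (unlab (lex_order D))" "\<And>n. q n \<in> pts (unlab (lex_order D))"
  then have P0: "finite P0" "P0 \<subseteq> D" and q: "q n \<in> D" for n by auto
  \<comment> \<open>The endpoints join the parameters because \<open>gap_similar\<close> demands
    them.\<close>
  define P where "P = insert l (insert g P0)"
  have P: "finite P" "P \<subseteq> D" "l \<in> P" "g \<in> P" "P0 \<subseteq> P" using P0 D by (auto simp: P_def)
  let ?M = "unlab (lex_order D)"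
  show "\<exists>c\<in>pts ?M. \<exists>f :: nat \<Rightarrow> nat. strict_mono f \<and> (\<forall>k. EF k ?M ?M (insert (q (f k), c) (Id_on P0)))"
  proof (cases "\<exists>v. infinite {n. q n = v}")
    case True
    then obtain v where v: "infinite {n. q n = v}" by blast
    define f where "f = Infinite_Set.enumerate {n. q n = v}"
    have f: "strict_mono f" "q (f k) = v" for k
      using strict_mono_enumerate[OF v] enumerate_in_set[OF v] by (auto simp: f_def)
    then have vD: "v \<in> D" using q by metis
    have "EF k ?M ?M (insert (q (f k), v) (Id_on P0))" for k
      by (rule EF_subset[OF EF_Id_on[of "insert v P0"]]) (use f(2) vD P0 in auto)
    with vD f(1) show ?thesis by auto
  next
    case False
    then have fib: "finite {n. q n = v}" for v by blast
    have fibs: "finite {n. q n \<in> V}" if "finite V" for V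
    proof -
      have "{n. q n \<in> V} = (\<Union>v\<in>V. {n. q n = v})" by auto
      then show ?thesis using that fib by simp
    qed
    have "infinite (- {n. q n \<in> P})" using fibs[OF P(1)] Compl_eq_Diff_UNIV by (metis Diff_infinite_finite infinite_UNIV_nat)
    \<comment> \<open>Members outside \<open>P\<close> are classified by the set of parameters below
      them, which takes finitely many values.\<close>
    moreover have "finite ((\<lambda>n. {x \<in> P. x < q n}) ` (- {n. q n \<in> P}))"
      by (rule finite_subset[of _ "Set.Pow P"]) (use P in auto)
    ultimately obtain n0 where n0: "q n0 \<notin> P"
      "infinite {n \<in> - {n. q n \<in> P}. {x \<in> P. x < q n} = {x \<in> P. x < q n0}}"
      using pigeonhole_infinite[of "- {n. q n \<in> P}" "\<lambda>n. {x \<in> P. x < q n}"] by blast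
    define L where "L = {x \<in> P. x < q n0}"
    define I where "I = {n \<in> - {n. q n \<in> P}. {x \<in> P. x < q n} = L}"
    have I: "infinite I" using n0 by (simp add: I_def L_def)
    define c where "c = Max L"
    define c' where "c' = Min (P - L)"
    have fin: "finite L" "finite (P - L)" using P by (auto simp: L_def)
    have "l \<noteq> q n0" using n0(1) P(3) by auto
    then have "l < q n0" using D(4)[OF q[of n0]] by (simp add: order.order_iff_strict)
    then have lL: "l \<in> L" using P(3) by (simp add: L_def)
    have gL: "g \<in> P - L" using D(5)[OF q[of n0]] P(4) by (auto simp: L_def)
    have c: "c \<in> L" "c' \<in> P - L" unfolding c_def c'_def
      using Max_in[OF fin(1)] Min_in[OF fin(2)] lL gL by blast+
    have outP: "x \<le> c \<or> c' \<le> x" if "x \<in> P" for x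
      using that fin unfolding c_def c'_def by (cases "x \<in> L") (auto intro: Max_ge Min_le)
    have between: "c < q n" "q n < c'" if "n \<in> I" for n
    proof -
      have n: "q n \<notin> P" "{x \<in> P. x < q n} = L" using that by (auto simp: I_def)
      show "c < q n" using n c by blast
      have "\<not> c' < q n" "c' \<noteq> q n" using n c by blast+
      then show "q n < c'" by auto
    qed
    have cD: "c \<in> D" "c' \<in> D" using c P by (auto simp: L_def)
    \<comment> \<open>Indices of members whose truncated gaps to \<open>c\<close> and to
      \<open>c'\<close> both reach the cap; \<open>V\<close> below collects the finitely many points
      that could violate this.\<close>
    define J where "J k = {n \<in> I. gap k c (q n) = 2 ^ k \<and> gap k (q n) c' = 2 ^ k}" for k
    have J: "infinite (J k)" for k
    proof -
      define V where "V = (\<lambda>m. (fst c, snd c + m)) ` {0..<2 ^ k} \<union> (\<lambda>m. (fst c', snd c' - m)) ` {0..<(2::int) ^ k}"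
      have "I - J k \<subseteq> {n. q n \<in> V}"
      proof
        fix n assume n: "n \<in> I - J k"
        then have lt: "c < q n" "q n < c'" using between by auto
        have "gap k c (q n) \<noteq> 2 ^ k \<or> gap k (q n) c' \<noteq> 2 ^ k" using n by (auto simp: J_def)
        then show "n \<in> {n. q n \<in> V}"
        proof
          assume "gap k c (q n) \<noteq> 2 ^ k"
          then have "fst (q n) = fst c" "snd (q n) - snd c \<in> {0..<2 ^ k}"
            using lt by (auto simp: gap_def less_prod_def min_def split: if_splits)
          then have "q n \<in> (\<lambda>m. (fst c, snd c + m)) ` {0..<2 ^ k}"
            by (intro image_eqI[of _ _ "snd (q n) - snd c"]) (auto simp: prod_eq_iff)
          then show ?thesis by (simp add: V_def)
        next
          assume "gap k (q n) c' \<noteq> 2 ^ k"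
          then have "fst (q n) = fst c'" "snd c' - snd (q n) \<in> {0..<2 ^ k}"
            using lt by (auto simp: gap_def less_prod_def min_def split: if_splits)
          then have "q n \<in> (\<lambda>m. (fst c', snd c' - m)) ` {0..<2 ^ k}"
            by (intro image_eqI[of _ _ "snd c' - snd (q n)"]) (auto simp: prod_eq_iff)
          then show ?thesis by (simp add: V_def)
        qed
      qed
      moreover have "finite V" by (simp add: V_def)
      ultimately have "finite (I - J k)" using fibs finite_subset by blast
      then show ?thesis using I by (metis Diff_infinite_finite)
    qed
    have "fst c \<noteq> fst c'"
    proof
      assume eq: "fst c = fst c'"
      \<comment> \<open>For this \<open>k\<close>, a member indexed by \<open>J k\<close> would be
        at least \<open>2 ^ k\<close> away from \<open>c\<close>, which exceeds the distance from
        \<open>c\<close> to \<open>c'\<close>.\<close>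
      define k where "k = nat (snd c' - snd c)"
      obtain n where n: "n \<in> J k" using J[of k] by (metis finite.emptyI ex_in_conv)
      then have lt: "c < q n" "q n < c'" using between by (auto simp: J_def)
      then have f: "fst (q n) = fst c" using eq by (auto simp: less_prod_def)
      then have "2 ^ k \<le> snd (q n) - snd c" using n by (auto simp: J_def gap_def min_def split: if_splits)
      moreover have "snd (q n) < snd c'" using lt f eq by (auto simp: less_prod_def)
      moreover have "int k < 2 ^ k" by (metis of_nat_less_two_power)
      moreover have "snd c' - snd c \<le> int k" by (simp add: k_def)
      ultimately show False by linarith
    qed
    moreover obtain n where "n \<in> I" using I by (metis finite.emptyI ex_in_conv)
    ultimately have "fst c < fst c'" using between[of n] by (auto simp: less_prod_def)
    then obtain z where z: "z \<in> D" "fst c < fst z" "fst z < fst c'" using dense cD by blast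
    obtain f where f: "strict_mono f" "f k \<in> J k" for k using strict_mono_choice[of J] J by blast
    have "EF k ?M ?M (insert (q (f k), z) (Id_on P0))" for k
    proof (rule EF_subset[OF EF_lex_order[OF D(1) D(1)]])
      have fk: "f k \<in> I" "gap k c (q (f k)) = 2 ^ k" "gap k (q (f k)) c' = 2 ^ k"
        using f(2)[of k] by (auto simp: J_def)
      have "gap_similar k D D (Id_on P)"
        unfolding gap_similar_def
      proof (intro conjI)
        show "\<exists>x x'. (x, x') \<in> Id_on P \<and> (\<forall>y\<in>D. x \<le> y) \<and> (\<forall>y\<in>D. x' \<le> y)" using P D(4) by blast
        show "\<exists>x x'. (x, x') \<in> Id_on P \<and> (\<forall>y\<in>D. y \<le> x) \<and> (\<forall>y\<in>D. y \<le> x')" using P D(5) by blast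
      qed (use P in \<open>auto simp: Id_on_def\<close>)
      then show "gap_similar k D D (insert (q (f k), z) (Id_on P))"
      proof (rule gap_similar_insert)
        show "(c, c) \<in> Id_on P" "(c', c') \<in> Id_on P" using c by (auto simp: L_def)
        show "c < q (f k)" "q (f k) < c'" using between fk(1) by auto
        show "c < z" "z < c'" using z by (auto simp: less_prod_def)
        show "gap k c (q (f k)) = gap k c z" "gap k (q (f k)) c' = gap k z c'"
          using fk z by (auto simp: gap_def)
      qed (use q z outP in auto)
      show "insert (q (f k), z) (Id_on P0) \<subseteq> insert (q (f k), z) (Id_on P)" using P(5) by blast
    qed
    then show ?thesis using z(1) f(1) by auto
  qed
qed

section \<open>Rho as a set of columns\<close>

text \<open>An order embedding of Q into the open interval from -1 to 1; the columns -1 and 1 stay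
  free for the initial omega and the final reversed omega.\<close>

definition squash :: "rat \<Rightarrow> rat" where
  "squash r = r / (1 + \<bar>r\<bar>)"

lemma squash_bounds: "-1 < squash r" "squash r < 1"
  by (simp_all add: squash_def field_simps abs_if)

lemma frac_less: "0 < a \<Longrightarrow> 0 < b \<Longrightarrow> r * b < s * a \<Longrightarrow> r / a < s / (b :: rat)"
  by (simp add: field_simps)

lemma squash_less: "r < s \<Longrightarrow> squash r < squash s"
proof -
  assume rs: "r < s"
  have "r * \<bar>s\<bar> \<le> s * \<bar>r\<bar>"
  proof (cases "0 \<le> r")
    case True
    then show ?thesis using rs by simp
  next
    case False
    then show ?thesis
    proof (cases "0 \<le> s")
      case True
      then have "r * s \<le> 0" using False by (auto intro: mult_nonpos_nonneg mult_nonneg_nonpos simp: mult.commute[of r])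
      then show ?thesis using True False by (simp add: mult.commute)
    qed simp
  qed
  then have "r * (1 + \<bar>s\<bar>) < s * (1 + \<bar>r\<bar>)" using rs by (simp add: algebra_simps)
  then show ?thesis unfolding squash_def by (intro frac_less) (auto simp: add_pos_nonneg)
qed

lemma squash_iff: "squash r < squash s \<longleftrightarrow> r < s" "squash r = squash s \<longleftrightarrow> r = s"
  using squash_less by (metis linorder_less_linear order_less_asym)+

lemma squash_le: "squash r \<le> squash s \<longleftrightarrow> r \<le> s"
  by (simp add: not_less[symmetric] squash_iff)

text \<open>Components are exchanged on the middle part because \<open>order_copies\<close> treats
  the copy index, its second component, as the significant one.\<close>

definition rho_map :: "nat + (int \<times> rat) + int \<Rightarrow> rat \<times> int" where
  "rho_map x = (case x of Inl n \<Rightarrow> (-1, int n)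
     | Inr (Inl (z, r)) \<Rightarrow> (squash r, z) | Inr (Inr z) \<Rightarrow> (1, z))"

lemma rho_map_simps [simp]: "rho_map (Inl n) = (-1, int n)"
  "rho_map (Inr (Inl (z, r))) = (squash r, z)" "rho_map (Inr (Inr z')) = (1, z')"
  by (simp_all add: rho_map_def)

lemma Linear_order_zeta: "Linear_order order_zeta"
  by (auto simp: order_zeta_def order_on_defs refl_on_def trans_def antisym_def total_on_def Field_def)

lemma Linear_order_eta: "Linear_order order_eta"
  by (auto simp: order_eta_def order_on_defs refl_on_def trans_def antisym_def total_on_def Field_def)

lemma rho_parts_iff: "(i, j) \<in> order_omega \<longleftrightarrow> i \<le> j" "(x, y) \<in> order_zeta \<longleftrightarrow> x \<le> y"
  "(r, s) \<in> order_eta \<longleftrightarrow> r \<le> s" "(x, y) \<in> order_omega_star \<longleftrightarrow> x \<le> y \<and> y < 0"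
  by (simp_all add: order_omega_def order_zeta_def order_eta_def order_omega_star_def)

lemma Field_rho_parts: "Field order_omega = UNIV" "Field order_zeta = UNIV" "Field order_eta = UNIV"
  "Field order_omega_star = {z. z < 0}"
  by (auto simp: order_omega_def order_zeta_def order_eta_def order_omega_star_def Field_def)

lemma Field_rho: "Field order_rho = range Inl \<union> Inr ` (range Inl \<union> Inr ` {z. z < 0})"
  by (simp add: order_rho_def Field_order_sum Field_rho_parts
      Field_order_copies[OF Linear_order_zeta Linear_order_eta])

definition rho_set :: "(rat \<times> int) set" where
  "rho_set = {(b, i). b = -1 \<and> 0 \<le> i \<or> b = 1 \<and> i < 0 \<or> b \<in> range squash}"

lemma rho_map_image: "rho_map ` Field order_rho = rho_set"
proof
  show "rho_map ` Field order_rho \<subseteq> rho_set"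
    by (auto simp: Field_rho rho_set_def)
  have "(-1, int n) \<in> rho_map ` Field order_rho" for n
    by (rule image_eqI[of _ _ "Inl n"]) (auto simp: Field_rho)
  moreover have "(1, z) \<in> rho_map ` Field order_rho" if "z < 0" for z
    by (rule image_eqI[of _ _ "Inr (Inr z)"]) (use that in \<open>auto simp: Field_rho\<close>)
  moreover have "(squash r, z) \<in> rho_map ` Field order_rho" for z r
    by (rule image_eqI[of _ _ "Inr (Inl (z, r))"]) (auto simp: Field_rho)
  ultimately show "rho_set \<subseteq> rho_map ` Field order_rho"
    unfolding rho_set_def by (auto elim: nonneg_int_cases)
qed

lemma lword_iso_rho: "lword_iso rho_map (unlab order_rho) (unlab (lex_order rho_set))"
proof -
  note ne = squash_bounds[THEN less_imp_neq] squash_bounds[THEN less_imp_neq, symmetric]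
  have nle: "\<not> squash r \<le> -1" "\<not> 1 \<le> squash r" "\<not> squash r < -1" "\<not> 1 < squash r" for r
    using squash_bounds[of r] by auto
  have "inj_on rho_map (Field order_rho)"
  proof (rule inj_onI)
    fix x y assume "x \<in> Field order_rho" "y \<in> Field order_rho" "rho_map x = rho_map y"
    then show "x = y"
      using ne by (auto simp: Field_rho squash_iff)
  qed
  moreover have "(x, y) \<in> order_rho \<longleftrightarrow> (rho_map x, rho_map y) \<in> lex_order rho_set"
    if x: "x \<in> Field order_rho" and y: "y \<in> Field order_rho" for x y
  proof -
    have "(rho_map x, rho_map y) \<in> lex_order rho_set \<longleftrightarrow> rho_map x \<le> rho_map y"
      using x y rho_map_image by (auto simp: lex_order_def)
    moreover have "(x, y) \<in> order_rho \<longleftrightarrow> rho_map x \<le> rho_map y"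
      using x y ne unfolding Field_rho
      by (elim UnE imageE)
        (auto simp: order_rho_def less_eq_prod_def rho_parts_iff order_copies_iff Field_rho_parts
          squash_iff squash_bounds squash_le Field_order_sum
          Field_order_copies[OF Linear_order_zeta Linear_order_eta]
          squash_bounds[THEN less_imp_le] nle)
    ultimately show ?thesis by simp
  qed
  ultimately show ?thesis by (simp add: lword_iso_def rho_map_image)
qed

lemma rho_set_fst: "x \<in> rho_set \<Longrightarrow> -1 \<le> fst x \<and> fst x \<le> 1"
  using squash_bounds by (auto simp: rho_set_def less_imp_le)

lemma columnar_rho: "columnar rho_set"
proof -
  have b: "-1 \<le> b \<and> b \<le> 1" if "(b, i) \<in> rho_set" for b i
    using rho_set_fst[OF that] by simp
  have r1: "(b, m) \<in> rho_set" if "(b, i) \<in> rho_set" "(b', j) \<in> rho_set" "b < b'" "i \<le> m" for b b' i j m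
    using b[OF that(2)] that(1,3,4) by (auto simp: rho_set_def)
  have r2: "(b', m) \<in> rho_set" if "(b, i) \<in> rho_set" "(b', j) \<in> rho_set" "b < b'" "m \<le> j" for b b' i j m
    using b[OF that(1)] that(2,3,4) by (auto simp: rho_set_def)
  have r3: "(b, m) \<in> rho_set" if "(b, i) \<in> rho_set" "(b, j) \<in> rho_set" "i \<le> m" "m \<le> j" for b i j m
    using that by (auto simp: rho_set_def)
  show ?thesis unfolding columnar_def
    by (intro conjI allI impI) (erule (3) r3, erule (3) r1, erule (3) r2)
qed

lemma rho_bounds: "(-1, 0) \<in> rho_set" "(1, -1) \<in> rho_set"
  "x \<in> rho_set \<Longrightarrow> (-1, 0) \<le> x" "x \<in> rho_set \<Longrightarrow> x \<le> (1, -1)"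
  using squash_bounds by (auto simp: rho_set_def less_eq_prod_def)

lemma rho_dense:
  assumes "x \<in> rho_set" "y \<in> rho_set" "fst x < fst y"
  shows "\<exists>z\<in>rho_set. fst x < fst z \<and> fst z < fst y"
proof -
  have "\<exists>r. fst x < squash r \<and> squash r < fst y"
  proof -
    consider "fst x = -1" "fst y = 1" | r where "fst x = -1" "fst y = squash r"
      | r where "fst x = squash r" "fst y = 1" | r s where "fst x = squash r" "fst y = squash s"
      | "fst x = 1" | "fst y = -1"
      using assms unfolding rho_set_def by auto
    then show ?thesis
    proof cases
      case 1
      then show ?thesis using squash_bounds[of 0] by auto
    next
      case (2 r)
      then show ?thesis using squash_bounds squash_less[of "r - 1" r] by auto
    next
      case (3 r)
      then show ?thesis using squash_bounds squash_less[of r "r + 1"] by auto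
    next
      case (4 r s)
      then have "r < s" using assms(3) by (simp add: squash_iff)
      then obtain t where "r < t" "t < s" using dense by blast
      then show ?thesis using 4 squash_less by metis
    next
      case 5
      then show ?thesis using rho_set_fst[OF assms(2)] assms(3) by simp
    next
      case 6
      then show ?thesis using rho_set_fst[OF assms(1)] assms(3) by simp
    qed
  qed
  then obtain r where "fst x < squash r" "squash r < fst y" by blast
  moreover have "(squash r, 0) \<in> rho_set" by (simp add: rho_set_def)
  ultimately show ?thesis by force
qed

lemma ef_compact_rho: "ef_compact (unlab order_rho)"
proof -
  have iso: "lword_iso (inv_into (pts (unlab order_rho)) rho_map) (unlab (lex_order rho_set)) (unlab order_rho)"
  proof -
    define N where "N = unlab (lex_order rho_set)"
    define h where "h = inv_into (Field order_rho) rho_map"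
    have a: "inj_on rho_map (Field order_rho)" "rho_map ` Field order_rho = rho_set"
      and o: "\<And>x y. x \<in> Field order_rho \<Longrightarrow> y \<in> Field order_rho \<Longrightarrow>
        (x, y) \<in> order_rho \<longleftrightarrow> (rho_map x, rho_map y) \<in> lex_order rho_set"
      using lword_iso_rho by (auto simp: lword_iso_def)
    have h: "h y \<in> Field order_rho" "rho_map (h y) = y" if "y \<in> rho_set" for y
      using that a(2) unfolding h_def by (metis inv_into_into, metis f_inv_into_f)
    have "h ` rho_set = Field order_rho"
      using a inv_into_image_cancel[OF a(1), of "Field order_rho"] by (simp add: h_def)
    moreover have "inj_on h rho_set" using h(2) by (metis inj_onI)
    ultimately show ?thesis using o h unfolding lword_iso_def h_def[symmetric] by simp (simp add: h_def)
  qed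
  show ?thesis
    by (rule ef_compact_iso[OF iso ef_compact_lex_order[OF columnar_rho rho_bounds rho_dense]])
qed

section \<open>Finite orders and their equivalence with rho\<close>

definition order_nat :: "nat \<Rightarrow> nat rel" where
  "order_nat n = {(i, j). i \<le> j \<and> j < n}"

lemma Field_order_nat [simp]: "Field (order_nat n) = {..<n}"
  by (auto simp: order_nat_def Field_def)

lemma Linear_order_nat: "Linear_order (order_nat n)"
  unfolding order_on_defs refl_on_def Field_order_nat total_on_def
  by (auto simp: order_nat_def trans_def antisym_def)

text \<open>Play opens with the endpoints matched. In rho they lie in different columns, so their
  gap is the full cap \<open>2 ^ k\<close>; in the finite order their distance is
  \<open>n - 1\<close>, which reaches the cap because \<open>2 ^ k < n\<close>.\<close>

lemma ef_equiv_rho_nat: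
  assumes n: "2 ^ k < n"
  shows "ef_equiv k (unlab order_rho) (unlab (order_nat n))"
proof -
  \<comment> \<open>A finite order is a single column.\<close>
  define E where "E = (\<lambda>i. (0 :: rat, int i)) ` {..<n}"
  have iso: "lword_iso (\<lambda>i. (0, int i)) (unlab (order_nat n)) (unlab (lex_order E))"
    unfolding lword_iso_def
    by (simp add: inj_on_def) (auto simp: E_def lex_order_iff order_nat_def less_eq_prod_def)
  have E: "columnar E"
  proof -
    have "(0, m) \<in> E" if "0 \<le> i" "i \<le> m" "m \<le> j" "j < int n" for i j m
      unfolding E_def by (rule image_eqI[of _ _ "nat m"]) (use that in auto)
    moreover have "b = 0 \<and> 0 \<le> i \<and> i < int n" if "(b, i) \<in> E" for b i
      using that by (auto simp: E_def)
    ultimately show ?thesis unfolding columnar_def by (metis less_irrefl)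
  qed
  have "gap_similar k rho_set E {((-1, 0), (0, 0)), ((1, -1), (0, int (n - 1)))}"
  proof -
    have "(1 :: nat) \<le> 2 ^ k" by simp
    then have "1 < n" "2 ^ k \<le> n - 1" using n by linarith+
    then have "0 < n" "0 < int (n - 1)" "int (2 ^ k) \<le> int (n - 1)" by (auto simp only: of_nat_le_iff)
    show ?thesis
    proof (rule gap_similar_pair)
      show "(0, int (n - 1)) \<in> E"
        unfolding E_def by (rule image_eqI[of _ _ "n - 1"]) (use \<open>0 < n\<close> in auto)
      show "(0, 0) \<in> E"
        unfolding E_def by (rule image_eqI[of _ _ 0]) (use \<open>0 < n\<close> in auto)
      show "(0, 0) \<le> y" "y \<le> (0, int (n - 1))" if "y \<in> E" for y
        using that \<open>0 < n\<close> by (auto simp: E_def less_eq_prod_def)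
      show "gap k (-1, 0) (1, -1) = gap k (0, 0) (0, int (n - 1))"
        using \<open>int (2 ^ k) \<le> int (n - 1)\<close> by (simp add: gap_def)
      show "(-1 :: rat, 0 :: int) < (1, -1)" "(0 :: rat, 0) < (0 :: rat, int (n - 1))"
        using \<open>0 < int (n - 1)\<close> by (auto simp: less_prod_def)
    qed (fact rho_bounds)+
  qed
  then have "EF k (unlab (lex_order rho_set)) (unlab (lex_order E)) {}"
    using EF_subset[OF EF_lex_order[OF columnar_rho E]] by blast
  then have "ef_equiv k (unlab (lex_order rho_set)) (unlab (lex_order E))" by (simp add: ef_equiv_def)
  then show ?thesis
    by (rule ef_equiv_trans[OF ef_equiv_iso[OF lword_iso_rho] ef_equiv_trans[OF _ ef_equiv_sym[OF ef_equiv_iso[OF iso]]]])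
qed

lemma ef_equiv_nat_nat:
  "2 ^ k < n \<Longrightarrow> 2 ^ k < m \<Longrightarrow> ef_equiv k (unlab (order_nat n)) (unlab (order_nat m))"
  by (rule ef_equiv_trans[OF ef_equiv_sym[OF ef_equiv_rho_nat] ef_equiv_rho_nat])


section \<open>Evaluation of terms and syntactic semigroups\<close>

abbreviation fw :: "'a list \<Rightarrow> (nat, 'a) lword" where
  "fw w \<equiv> gw (finite_word w)"

lemma word_ord_finite_word: "(i, j) \<in> word_ord (finite_word w) \<longleftrightarrow> 1 \<le> i \<and> i \<le> j \<and> j \<le> length w"
  by (simp add: finite_word_def)

lemma letter_at_finite_word: "letter_at (finite_word w) i = w ! (i - 1)"
  by (simp add: finite_word_def)

lemma ef_equiv_append: "ef_equiv k (lsum (fw u) (fw v)) (fw (u @ v))"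
proof (rule ef_equiv_iso)
  \<comment> \<open>Positions of finite words count from 1, so the shift is exactly
    \<open>length u\<close>.\<close>
  have "case_sum id ((+) (length u)) ` pts (lsum (fw u) (fw v)) = pts (fw (u @ v))"
    by (simp add: Field_order_sum positions_finite_word image_Un image_image image_add_atLeastAtMost) auto
  then show "lword_iso (case_sum id ((+) (length u))) (lsum (fw u) (fw v)) (fw (u @ v))"
    unfolding lword_iso_def
    by (simp add: Field_order_sum positions_finite_word)
      (auto simp: word_ord_finite_word letter_at_finite_word positions_finite_word inj_on_def nth_append)
qed

lemma ef_equiv_copies_Suc:
  assumes M: "Linear_order (fst M)"
  shows "ef_equiv k (lsum (lcopies M (order_nat n)) M) (lcopies M (order_nat (Suc n)))"
proof (rule ef_equiv_iso)
  note F = Field_order_copies[OF M Linear_order_nat]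
  have "(p, i) \<in> case_sum id (\<lambda>p. (p, n)) ` (Inl ` (pts M \<times> {..<n}) \<union> Inr ` pts M)"
    if "p \<in> pts M" "i < Suc n" for p i
    using that by (cases "i = n") (force simp: image_iff)+
  then show "lword_iso (case_sum id (\<lambda>p. (p, n))) (lsum (lcopies M (order_nat n)) M) (lcopies M (order_nat (Suc n)))"
    unfolding lword_iso_def
    by (auto simp: Field_order_sum F inj_on_def order_copies_iff) (auto simp: order_nat_def)
qed

lemma Linear_order_fw: "Linear_order (fst (fw w))"
  using wf_finite_word by (simp add: wf_word_def)

lemma ef_equiv_replicate: "ef_equiv k (lcopies (fw u) (order_nat n)) (fw (concat (replicate n u)))"
proof (induction n)
  case 0
  \<comment> \<open>Both sides have no positions, so any function is an isomorphism.\<close>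
  show ?case
    by (rule ef_equiv_iso[of undefined])
      (simp add: lword_iso_def Field_order_copies[OF Linear_order_fw[simplified] Linear_order_nat] positions_finite_word)
next
  case (Suc n)
  have "ef_equiv k (lcopies (fw u) (order_nat (Suc n))) (lsum (lcopies (fw u) (order_nat n)) (fw u))"
    by (rule ef_equiv_sym[OF ef_equiv_copies_Suc[OF Linear_order_fw]])
  also have "ef_equiv k (lsum (lcopies (fw u) (order_nat n)) (fw u)) (lsum (fw (concat (replicate n u))) (fw u))"
    by (rule ef_equiv_lsum[OF Suc.IH ef_equiv_refl])
  also have "ef_equiv k (lsum (fw (concat (replicate n u))) (fw u)) (fw (concat (replicate n u) @ u))"
    by (rule ef_equiv_append)
  also have "concat (replicate n u) @ u = concat (replicate (Suc n) u)"
    by (metis concat.simps(2) concat_append concat.simps(1) append_Nil2 replicate_append_same replicate_Suc)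
  finally show ?case .
qed

text \<open>\<open>w a\<close> stands for a representative of the class to which a morphism into a
  syntactic semigroup sends the letter \<open>a\<close>; \<open>n\<close> replaces the idempotent
  exponent.\<close>

primrec fin_eval :: "nat \<Rightarrow> ('a \<Rightarrow> 'b list) \<Rightarrow> 'a pterm \<Rightarrow> 'b list" where
  "fin_eval n w (Letter a) = w a"
| "fin_eval n w (Pow s) = concat (replicate n (fin_eval n w s))"
| "fin_eval n w (LetterCat a t) = w a @ fin_eval n w t"
| "fin_eval n w (PowCat s t) = concat (replicate n (fin_eval n w s)) @ fin_eval n w t"

lemma fin_eval_pcat: "fin_eval n w (pcat s t) = fin_eval n w s @ fin_eval n w t"
  by (induction s) auto

lemma concat_map_replicate:
  "concat (map w (concat (replicate n u))) = concat (replicate n (concat (map w u)))"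
  by (induction n) auto

lemma fin_eval_subst: "fin_eval n w t = concat (map w (fin_eval n (\<lambda>a. [a]) t))"
  by (induction t) (auto simp: concat_map_replicate)

lemma ef_equiv_concat: "ef_equiv k (lsum (gw u) (gw v)) (gw (word_concat u v))"
  by (rule ef_equiv_iso[OF lword_iso_concat])

lemma ef_equiv_power_rho:
  assumes "2 ^ k < n" "wf_word u" "ef_equiv k (gw u) (fw v)"
  shows "ef_equiv k (gw (word_power u order_rho)) (fw (concat (replicate n v)))"
proof -
  have "ef_equiv k (gw (word_power u order_rho)) (lcopies (gw u) order_rho)"
    by (rule ef_equiv_sym[OF ef_equiv_iso[OF lword_iso_power]])
  also have "ef_equiv k (lcopies (gw u) order_rho) (lcopies (fw v) (order_nat n))"
    using assms Linear_order_fw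
    by (intro ef_equiv_lcopies ef_equiv_rho_nat Linear_order_rho Linear_order_nat) (simp_all add: wf_word_def)
  also have "ef_equiv k (lcopies (fw v) (order_nat n)) (fw (concat (replicate n v)))"
    by (rule ef_equiv_replicate)
  finally show ?thesis .
qed

lemma wf_eval_rho: "wf_word (eval_pterm order_rho t)"
  by (rule wf_eval_pterm[OF Linear_order_rho])

lemma ef_equiv_word_concat:
  assumes "ef_equiv k (gw u) (fw x)" "ef_equiv k (gw v) (fw y)"
  shows "ef_equiv k (gw (word_concat u v)) (fw (x @ y))"
proof -
  have "ef_equiv k (gw (word_concat u v)) (lsum (gw u) (gw v))"
    by (rule ef_equiv_sym[OF ef_equiv_concat])
  also have "ef_equiv k (lsum (gw u) (gw v)) (lsum (fw x) (fw y))"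
    using assms by (rule ef_equiv_lsum)
  also have "ef_equiv k (lsum (fw x) (fw y)) (fw (x @ y))"
    by (rule ef_equiv_append)
  finally show ?thesis .
qed

lemma ef_equiv_eval_rho:
  assumes n: "2 ^ k < n"
  shows "ef_equiv k (gw (eval_pterm order_rho t)) (fw (fin_eval n (\<lambda>a. [a]) t))"
proof (induction t)
  case (Letter a)
  show ?case by (simp add: ef_equiv_refl)
next
  case (Pow t)
  then show ?case using ef_equiv_power_rho[OF n wf_eval_rho] by simp
next
  case (LetterCat a t)
  then show ?case
    using ef_equiv_word_concat[of k "finite_word [a]" "[a]", OF ef_equiv_refl] by simp
next
  case (PowCat s t)
  then show ?case using ef_equiv_word_concat[OF ef_equiv_power_rho[OF n wf_eval_rho]] by simp
qed

lemma ef_compact_eval_rho: "ef_compact (gw (eval_pterm order_rho t))"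
proof (induction t)
  case (Letter a)
  show ?case by (simp add: ef_compact_finite_word)
next
  case (Pow t)
  then have "ef_compact (lcopies (gw (eval_pterm order_rho t)) order_rho)"
    using wf_eval_rho[of t] by (intro ef_compact_lcopies ef_compact_rho Linear_order_rho) (simp_all add: wf_word_def)
  then show ?case using ef_compact_iso[OF lword_iso_power] by simp
next
  case (LetterCat a t)
  then have "ef_compact (lsum (fw [a]) (gw (eval_pterm order_rho t)))"
    by (intro ef_compact_lsum ef_compact_finite_word)
  then show ?case using ef_compact_iso[OF lword_iso_concat] by simp
next
  case (PowCat s t)
  then have "ef_compact (lcopies (gw (eval_pterm order_rho s)) order_rho)"
    using wf_eval_rho[of s] by (intro ef_compact_lcopies ef_compact_rho Linear_order_rho) (simp_all add: wf_word_def)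
  then have "ef_compact (gw (word_power (eval_pterm order_rho s) order_rho))"
    using ef_compact_iso[OF lword_iso_power] by blast
  then have "ef_compact (lsum (gw (word_power (eval_pterm order_rho s) order_rho)) (gw (eval_pterm order_rho t)))"
    using PowCat by (intro ef_compact_lsum)
  then show ?case using ef_compact_iso[OF lword_iso_concat] by simp
qed

lemma ef_equiv_lsub_lsum:
  fixes M :: "('p, 'a) lword" and N :: "('q, 'a) lword"
  shows "ef_equiv k (lsub w (lsum M N)) (lsum (lsub w M) (lsub w N))"
proof (rule ef_equiv_iso)
  define f :: "('p + 'q) \<times> nat \<Rightarrow> 'p \<times> nat + 'q \<times> nat"
    where "f = (\<lambda>(p, i). case p of Inl a \<Rightarrow> Inl (a, i) | Inr b \<Rightarrow> Inr (b, i))"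
  have f: "f (Inl a, i) = Inl (a, i)" "f (Inr b, i) = Inr (b, i)" for a b i
    by (simp_all add: f_def)
  have pts: "pts (lsub w (lsum M N)) =
      (\<lambda>(a, i). (Inl a, i)) ` pts (lsub w M) \<union> (\<lambda>(b, i). (Inr b, i)) ` pts (lsub w N)"
    by (auto simp: pts_lsub Field_order_sum)
  show "lword_iso f (lsub w (lsum M N)) (lsum (lsub w M) (lsub w N))"
    unfolding lword_iso_def pts
    by (auto simp: inj_on_def f Field_order_sum image_Un image_image split_def lsub_simps pts_lsub)
qed

lemma ef_equiv_lsub_letter: "ef_equiv k (lsub w (fw [a])) (fw (w a))"
proof (rule ef_equiv_iso)
  have pts: "pts (lsub w (fw [a])) = (\<lambda>i. (1, i)) ` {..<length (w a)}"
    by (auto simp: pts_lsub positions_finite_word letter_at_finite_word)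
  have "(\<lambda>x. Suc (snd x)) ` (\<lambda>i. (1 :: nat, i)) ` {..<length (w a)} = {1..length (w a)}"
    by (simp add: image_image image_Suc_lessThan)
  then show "lword_iso (\<lambda>x. Suc (snd x)) (lsub w (fw [a])) (fw (w a))"
    unfolding lword_iso_def pts
    by (auto simp: inj_on_def positions_finite_word word_ord_finite_word letter_at_finite_word lsub_simps)
qed

lemma ef_equiv_lsub_fw: "ef_equiv k (lsub w (fw l)) (fw (concat (map w l)))"
proof (induction l)
  case Nil
  show ?case
    by (rule ef_equiv_iso[of undefined]) (simp add: lword_iso_def pts_lsub positions_finite_word)
next
  case (Cons a l)
  have "ef_equiv k (lsub w (fw (a # l))) (lsub w (lsum (fw [a]) (fw l)))"
    using ef_equiv_lsub[OF ef_equiv_sym[OF ef_equiv_append[of k "[a]" l]]] by simp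
  also have "ef_equiv k (lsub w (lsum (fw [a]) (fw l))) (lsum (lsub w (fw [a])) (lsub w (fw l)))"
    by (rule ef_equiv_lsub_lsum)
  also have "ef_equiv k (lsum (lsub w (fw [a])) (lsub w (fw l))) (lsum (fw (w a)) (fw (concat (map w l))))"
    by (rule ef_equiv_lsum[OF ef_equiv_lsub_letter Cons.IH])
  also have "ef_equiv k (lsum (fw (w a)) (fw (concat (map w l)))) (fw (w a @ concat (map w l)))"
    by (rule ef_equiv_append)
  finally show ?case by simp
qed

text \<open>The counterpart, over any labelled order, of the words \<open>x @ u @ y\<close> that
  \<open>synt_cong\<close> tests.\<close>

definition lcontext :: "'b list \<Rightarrow> ('a \<Rightarrow> 'b list) \<Rightarrow> ('p, 'a) lword \<Rightarrow> 'b list \<Rightarrow> (nat + ('p \<times> nat) + nat, 'b) lword" where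
  "lcontext x w M y = lsum (fw x) (lsum (lsub w M) (fw y))"

lemma ef_equiv_lcontext:
  assumes n: "2 ^ k < n"
  shows "ef_equiv k (lcontext x w (gw (eval_pterm order_rho t)) y) (fw (x @ fin_eval n w t @ y))"
proof -
  let ?M = "gw (eval_pterm order_rho t)"
  have "ef_equiv k (lsub w ?M) (lsub w (fw (fin_eval n (\<lambda>a. [a]) t)))"
    by (rule ef_equiv_lsub[OF ef_equiv_eval_rho[OF n]])
  also have "ef_equiv k (lsub w (fw (fin_eval n (\<lambda>a. [a]) t))) (fw (fin_eval n w t))"
    by (subst (2) fin_eval_subst) (rule ef_equiv_lsub_fw)
  finally have "ef_equiv k (lsum (lsub w ?M) (fw y)) (lsum (fw (fin_eval n w t)) (fw y))"
    by (rule ef_equiv_lsum[OF _ ef_equiv_refl])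
  also have "ef_equiv k (lsum (fw (fin_eval n w t)) (fw y)) (fw (fin_eval n w t @ y))"
    by (rule ef_equiv_append)
  finally have "ef_equiv k (lcontext x w ?M y) (lsum (fw x) (fw (fin_eval n w t @ y)))"
    unfolding lcontext_def by (rule ef_equiv_lsum[OF ef_equiv_refl])
  also have "ef_equiv k (lsum (fw x) (fw (fin_eval n w t @ y))) (fw (x @ fin_eval n w t @ y))"
    by (rule ef_equiv_append)
  finally show ?thesis .
qed

section \<open>The syntactic congruence of a definable language\<close>

lemma sat_sentence: "sentence \<phi> \<Longrightarrow> sat u Map.empty \<phi> \<longleftrightarrow> gsat (gw u) \<alpha> \<phi>"
  unfolding sat_gsat sentence_def by (rule gsat_cong) simp

lemma language_ef_equiv:
  assumes "sentence \<phi>" "u \<in> nonempty_words A" "v \<in> nonempty_words A" "ef_equiv (qrank \<phi>) (fw u) (fw v)"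
  shows "u \<in> language A \<phi> \<longleftrightarrow> v \<in> language A \<phi>"
  using assms ef_equiv_gsat[OF assms(4)]
  by (simp add: language_def sat_sentence[of _ _ undefined] sentence_def)

lemma synt_cong_ef_equiv:
  assumes \<phi>: "sentence \<phi>" and uv: "u \<in> nonempty_words A" "v \<in> nonempty_words A"
    and ef: "ef_equiv (qrank \<phi>) (fw u) (fw v)"
  shows "(u, v) \<in> synt_cong A (language A \<phi>)"
proof -
  have "x @ u @ y \<in> language A \<phi> \<longleftrightarrow> x @ v @ y \<in> language A \<phi>" if "x \<in> lists A" "y \<in> lists A" for x y
  proof (rule language_ef_equiv[OF \<phi>])
    show "x @ u @ y \<in> nonempty_words A" "x @ v @ y \<in> nonempty_words A"
      using uv that by (auto simp: nonempty_words_def)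
    have ctx: "ef_equiv (qrank \<phi>) (fw (x @ z @ y)) (lsum (fw x) (lsum (fw z) (fw y)))" for z
      by (rule ef_equiv_sym[OF ef_equiv_trans[OF ef_equiv_lsum[OF ef_equiv_refl ef_equiv_append] ef_equiv_append]])
    have "ef_equiv (qrank \<phi>) (lsum (fw x) (lsum (fw u) (fw y))) (lsum (fw x) (lsum (fw v) (fw y)))"
      by (intro ef_equiv_lsum ef_equiv_refl ef)
    then show "ef_equiv (qrank \<phi>) (fw (x @ u @ y)) (fw (x @ v @ y))"
      by (rule ef_equiv_trans[OF ef_equiv_trans[OF ctx] ef_equiv_sym[OF ctx]])
  qed
  then show ?thesis using uv by (simp add: synt_cong_def)
qed

lemma concat_replicate_nonempty:
  "u \<in> nonempty_words A \<Longrightarrow> 0 < n \<Longrightarrow> concat (replicate n u) \<in> nonempty_words A"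
  by (auto simp: nonempty_words_def)

text \<open>Aperiodicity of first-order definable languages, with an explicit threshold: copies of
  \<open>u\<close> along any two long finite orders are indistinguishable at this rank.\<close>

lemma synt_cong_replicate:
  assumes \<phi>: "sentence \<phi>" and u: "u \<in> nonempty_words A" and nm: "2 ^ qrank \<phi> < n" "2 ^ qrank \<phi> < m"
  shows "(concat (replicate n u), concat (replicate m u)) \<in> synt_cong A (language A \<phi>)"
proof (rule synt_cong_ef_equiv[OF \<phi>])
  show "concat (replicate n u) \<in> nonempty_words A" "concat (replicate m u) \<in> nonempty_words A"
    using u nm by (metis concat_replicate_nonempty gr0I not_less_zero)+
  let ?k = "qrank \<phi>"
  have "ef_equiv ?k (fw (concat (replicate n u))) (lcopies (fw u) (order_nat n))"
    by (rule ef_equiv_sym[OF ef_equiv_replicate])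
  also have "ef_equiv ?k (lcopies (fw u) (order_nat n)) (lcopies (fw u) (order_nat m))"
    by (intro ef_equiv_lcopies Linear_order_fw Linear_order_nat ef_equiv_refl ef_equiv_nat_nat nm)
  also have "ef_equiv ?k (lcopies (fw u) (order_nat m)) (fw (concat (replicate m u)))"
    by (rule ef_equiv_replicate)
  finally show "ef_equiv ?k (fw (concat (replicate n u))) (fw (concat (replicate m u)))" .
qed

text \<open>Beyond the threshold all powers of the class coincide, so the \<open>n\<close>-th one is
  idempotent. Any idempotent power \<open>e\<close> equals its own \<open>n\<close>-th power, whose
  exponent is again beyond the threshold; this yields uniqueness.\<close>

lemma idem_power_synt:
  assumes \<phi>: "sentence \<phi>" and u: "u \<in> nonempty_words A" and n: "2 ^ qrank \<phi> < n"
  defines "C v \<equiv> synt_cong A (language A \<phi>) `` {v}"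
  shows "idem_power (synt_mult A (language A \<phi>)) (C u) = C (concat (replicate n u))"
proof -
  let ?m = "synt_mult A (language A \<phi>)"
  have n0: "0 < n" using n by (metis gr0I not_less_zero)
  have mult: "?m (C v) (C w) = C (v @ w)" if "v \<in> nonempty_words A" "w \<in> nonempty_words A" for v w
    unfolding C_def using that by (rule synt_mult_class)
  have pow: "(?m (C v) ^^ j) (C v) = C (concat (replicate (Suc j) v))" if "v \<in> nonempty_words A" for v j
  proof (induction j)
    case (Suc j)
    then show ?case using mult[OF that concat_replicate_nonempty[OF that, of "Suc j"]] by simp
  qed simp
  have eq: "C (concat (replicate i u)) = C (concat (replicate j u))"
    if "2 ^ qrank \<phi> < i" "2 ^ qrank \<phi> < j" for i j
    unfolding C_def using equiv_class_eq[OF equiv_synt_cong synt_cong_replicate[OF \<phi> u that]] .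
  have rep: "concat (replicate i (concat (replicate j u))) = concat (replicate (i * j) u)" for i j
    by (induction i) (auto simp: replicate_add)
  show ?thesis
    unfolding idem_power_def
  proof (rule the_equality)
    have "?m (C (concat (replicate n u))) (C (concat (replicate n u))) = C (concat (replicate (n + n) u))"
      using mult[OF concat_replicate_nonempty[OF u n0] concat_replicate_nonempty[OF u n0]]
      by (simp add: replicate_add)
    also have "\<dots> = C (concat (replicate n u))" using n by (intro eq) auto
    finally show "?m (C (concat (replicate n u))) (C (concat (replicate n u))) = C (concat (replicate n u))
        \<and> (\<exists>j. C (concat (replicate n u)) = (?m (C u) ^^ j) (C u))"
      using pow[OF u, of "n - 1"] n0 by (metis Suc_diff_1)
  next
    fix e assume e: "?m e e = e \<and> (\<exists>j. e = (?m (C u) ^^ j) (C u))"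
    then obtain j where j: "e = C (concat (replicate (Suc j) u))" using pow[OF u] by blast
    have "(?m e ^^ i) e = e" for i using e by (induction i) auto
    then have "e = (?m e ^^ (n - 1)) e" by simp
    also have "\<dots> = C (concat (replicate (n * Suc j) u))"
      unfolding j using pow[OF concat_replicate_nonempty[OF u zero_less_Suc], of "n - 1" j] n0 by (simp add: rep del: replicate_Suc)
    also have "\<dots> = C (concat (replicate n u))" using n by (intro eq) auto
    finally show "e = C (concat (replicate n u))" .
  qed
qed

lemma fin_eval_nonempty:
  assumes "\<And>a. w a \<in> nonempty_words A" "0 < n"
  shows "fin_eval n w t \<in> nonempty_words A"
  using assms by (induction t) (auto simp: nonempty_words_def)

text \<open>A morphism into the quotient is determined by the classes of the letters. Choosing a
  representative \<open>w a\<close> in each class turns it into \<open>fin_eval n w\<close>, where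
  \<open>idem_power_synt\<close> explains why \<open>Pow\<close> becomes the \<open>n\<close>-fold
  power.\<close>

lemma identity_holds_iff:
  assumes \<phi>: "sentence \<phi>" and n: "2 ^ qrank \<phi> < n"
  shows "identity_holds (synt_semigroup A (language A \<phi>)) (synt_mult A (language A \<phi>)) s t \<longleftrightarrow>
    (\<forall>w. (\<forall>a. w a \<in> nonempty_words A) \<longrightarrow> (fin_eval n w s, fin_eval n w t) \<in> synt_cong A (language A \<phi>))"
proof -
  let ?L = "language A \<phi>" and ?S = "synt_semigroup A (language A \<phi>)" and ?m = "synt_mult A (language A \<phi>)"
  define C where "C v = synt_cong A ?L `` {v}" for v
  have n0: "0 < n" using n by (metis gr0I not_less_zero)
  have mult: "?m (C v) (C w) = C (v @ w)" if "v \<in> nonempty_words A" "w \<in> nonempty_words A" for v w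
    unfolding C_def using that by (rule synt_mult_class)
  have idem: "idem_power ?m (C u) = C (concat (replicate n u))" if "u \<in> nonempty_words A" for u
    unfolding C_def using idem_power_synt[OF \<phi> that n] .
  have ne: "fin_eval n w t \<in> nonempty_words A" if "\<forall>a. w a \<in> nonempty_words A" for w :: "'c \<Rightarrow> _" and t
    using that n0 by (intro fin_eval_nonempty) auto
  have ker: "C (fin_eval n w s) = C (fin_eval n w t) \<longleftrightarrow> (fin_eval n w s, fin_eval n w t) \<in> synt_cong A ?L"
    if "\<forall>a. w a \<in> nonempty_words A" for w
    unfolding C_def using eq_equiv_class_iff[OF equiv_synt_cong ne[OF that] ne[OF that]] .
  have hom: "pi_hom ?S ?m (idem_power ?m) (\<lambda>t. C (fin_eval n w t))" if "\<forall>a. w a \<in> nonempty_words A" for w :: "'c \<Rightarrow> _"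
    unfolding pi_hom_def
    using ne[OF that] mult idem by (auto simp: fin_eval_pcat synt_semigroup_def C_def intro: quotientI)
  have uniq: "\<exists>w. (\<forall>a. w a \<in> nonempty_words A) \<and> (\<forall>t. h t = C (fin_eval n w t))"
    if h: "pi_hom ?S ?m (idem_power ?m) h" for h :: "'c pterm \<Rightarrow> _"
  proof -
    have "\<exists>u. u \<in> nonempty_words A \<and> h (Letter a) = C u" for a
      using h unfolding pi_hom_def synt_semigroup_def C_def by (metis quotientE)
    then obtain w where w: "\<And>a. w a \<in> nonempty_words A" "\<And>a. h (Letter a) = C (w a)" by metis
    then have w': "\<forall>a. w a \<in> nonempty_words A" by blast
    have hc: "h (pcat s t) = ?m (h s) (h t)" "h (Pow t) = idem_power ?m (h t)" for s t
      using h unfolding pi_hom_def by blast+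
    have cat: "h (LetterCat a s) = ?m (h (Letter a)) (h s)" "h (PowCat r s) = ?m (h (Pow r)) (h s)" for a r s
      using hc(1)[of "Letter a" s] hc(1)[of "Pow r" s] by simp_all
    have "h t = C (fin_eval n w t)" for t
      by (induction t) (simp_all add: w cat hc(2) mult idem ne[OF w'] concat_replicate_nonempty n0)
    with w' show ?thesis by blast
  qed
  show ?thesis
    unfolding identity_holds_def using hom uniq ker by metis
qed


section \<open>From identities to strategies\<close>

text \<open>Duplicator wins by never being caught, so this is a safety game: it is won exactly from
  configurations contained in some set closed under suitable replies. Such sets spare the later
  proofs all reference to histories.\<close>

definition dup_inv :: "('v, 'a) config set \<Rightarrow> bool" where
  "dup_inv I \<longleftrightarrow> (\<forall>c\<in>I. \<not> spoiler_stop c \<and>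
     (\<forall>m. spoiler_legal c m \<longrightarrow> (\<exists>r. duplicator_legal c m r \<and> next_config c m r \<in> I)))"

lemma duplicator_wins_iff:
  "duplicator_wins F u v \<longleftrightarrow> (\<exists>I. dup_inv I \<and> (F, (u, Map.empty), (v, Map.empty)) \<in> I)"
proof
  let ?c = "(F, (u, Map.empty), (v, Map.empty))"
  assume "duplicator_wins F u v"
  then obtain \<sigma> where \<sigma>: "winning_strategy ?c \<sigma>" by (auto simp: duplicator_wins_def)
  have "dup_inv {c. \<exists>h. play ?c \<sigma> h c}"
    unfolding dup_inv_def
  proof (intro ballI conjI allI impI)
    fix c assume "c \<in> {c. \<exists>h. play ?c \<sigma> h c}"
    then obtain h where h: "play ?c \<sigma> h c" by blast
    show ns: "\<not> spoiler_stop c" using \<sigma> h unfolding winning_strategy_def by blast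
    fix m assume m: "spoiler_legal c m"
    then have "duplicator_legal c m (\<sigma> h m)" using \<sigma> h unfolding winning_strategy_def by blast
    with play.round[OF h ns m] show "\<exists>r. duplicator_legal c m r \<and> next_config c m r \<in> {c. \<exists>h. play ?c \<sigma> h c}"
      by blast
  qed
  then show "\<exists>I. dup_inv I \<and> ?c \<in> I" using play.start by blast
next
  let ?c = "(F, (u, Map.empty), (v, Map.empty))"
  assume "\<exists>I. dup_inv I \<and> ?c \<in> I"
  then obtain I where I: "dup_inv I" "?c \<in> I" by blast
  \<comment> \<open>The configuration is recomputed from the history, so that a reply staying in
    \<open>I\<close> can be chosen as a function of the history and Spoiler's move.\<close>
  define cfg where "cfg h = foldl (\<lambda>c (m, r). next_config c m r) ?c h" for h
  define \<sigma> where "\<sigma> h m = (SOME r. duplicator_legal (cfg h) m r \<and> next_config (cfg h) m r \<in> I)" for h m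
  have \<sigma>: "duplicator_legal (cfg h) m (\<sigma> h m) \<and> next_config (cfg h) m (\<sigma> h m) \<in> I"
    if "cfg h \<in> I" "spoiler_legal (cfg h) m" for h m
    unfolding \<sigma>_def by (rule someI_ex) (use I(1) that in \<open>unfold dup_inv_def, blast\<close>)
  have "c = cfg h \<and> c \<in> I" if "play ?c \<sigma> h c" for h c
    using that
  proof induction
    case start
    then show ?case using I(2) by (simp add: cfg_def)
  next
    case (round h c m)
    then have "cfg (h @ [(m, \<sigma> h m)]) = next_config c m (\<sigma> h m)" by (simp add: cfg_def)
    moreover have "cfg h \<in> I" "spoiler_legal (cfg h) m" "c = cfg h" using round by auto
    ultimately show ?case using \<sigma>[of h m] by simp
  qed
  then have "winning_strategy ?c \<sigma>"
    using I(1) \<sigma> unfolding winning_strategy_def dup_inv_def by blast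
  then show "duplicator_wins F u v" by (auto simp: duplicator_wins_def)
qed

section \<open>Closure properties of fragments and reducts\<close>

text \<open>A context inside a reduct is a context of the fragment with the quantifier in front;
  this passes each closure condition to reducts at once.\<close>

primrec quant_ctx :: "quantifier \<Rightarrow> 'v \<Rightarrow> ('v, 'a) fctx \<Rightarrow> ('v, 'a) fctx" where
  "quant_ctx QEx x \<mu> = CExi x \<mu>"
| "quant_ctx QAll x \<mu> = CAll x \<mu>"
| "quant_ctx QNegEx x \<mu> = CNeg (CExi x \<mu>)"
| "quant_ctx QNegAll x \<mu> = CNeg (CAll x \<mu>)"

lemma plug_in_reduct: "plug \<mu> \<phi> \<in> reduct F Q x \<longleftrightarrow> plug (quant_ctx Q x \<mu>) \<phi> \<in> F"
  by (cases Q) (simp_all add: reduct_def)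

lemma fragment_reduct: "fragment F \<Longrightarrow> reduct F Q x \<noteq> {} \<Longrightarrow> fragment (reduct F Q x)"
  unfolding fragment_def plug_in_reduct by blast

lemma suc_stable_reduct: "suc_stable F \<Longrightarrow> suc_stable (reduct F Q x)"
  unfolding suc_stable_def plug_in_reduct by blast

lemma order_stable_reduct: "order_stable F \<Longrightarrow> order_stable (reduct F Q x)"
  unfolding order_stable_def plug_in_reduct by blast

lemma fragmentD:
  assumes "fragment F"
  shows "\<phi> \<in> F \<Longrightarrow> Atom ATrue \<in> F" "\<phi> \<in> F \<Longrightarrow> Atom AFalse \<in> F" "\<phi> \<in> F \<Longrightarrow> Atom (ALetter x a) \<in> F"
    "Or \<phi> \<psi> \<in> F \<longleftrightarrow> \<phi> \<in> F \<and> \<psi> \<in> F" "And \<phi> \<psi> \<in> F \<longleftrightarrow> \<phi> \<in> F \<and> \<psi> \<in> F"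
    "Neg (Or \<phi> \<psi>) \<in> F \<longleftrightarrow> Neg \<phi> \<in> F \<and> Neg \<psi> \<in> F"
    "Neg (And \<phi> \<psi>) \<in> F \<longleftrightarrow> Neg \<phi> \<in> F \<and> Neg \<psi> \<in> F"
    "Neg (Neg \<phi>) \<in> F \<Longrightarrow> \<phi> \<in> F"
proof -
  note H = assms[unfolded fragment_def, THEN conjunct2, rule_format]
  from H[of Hole] show "\<phi> \<in> F \<Longrightarrow> Atom ATrue \<in> F" "\<phi> \<in> F \<Longrightarrow> Atom AFalse \<in> F"
    "\<phi> \<in> F \<Longrightarrow> Atom (ALetter x a) \<in> F"
    "Or \<phi> \<psi> \<in> F \<longleftrightarrow> \<phi> \<in> F \<and> \<psi> \<in> F" "And \<phi> \<psi> \<in> F \<longleftrightarrow> \<phi> \<in> F \<and> \<psi> \<in> F" "Neg (Neg \<phi>) \<in> F \<Longrightarrow> \<phi> \<in> F"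
    unfolding plug.simps by blast+
  from H[of "CNeg Hole"] show "Neg (Or \<phi> \<psi>) \<in> F \<longleftrightarrow> Neg \<phi> \<in> F \<and> Neg \<psi> \<in> F"
    "Neg (And \<phi> \<psi>) \<in> F \<longleftrightarrow> Neg \<phi> \<in> F \<and> Neg \<psi> \<in> F"
    unfolding plug.simps by blast+
qed

lemma fragment_big_And:
  assumes "fragment F" "finite S" "S \<subseteq> F"
  shows "\<exists>\<chi>\<in>F. FV \<chi> \<subseteq> (\<Union>\<psi>\<in>S. FV \<psi>) \<and> (\<forall>M :: ('p, 'a) lword. \<forall>\<alpha>. gsat M \<alpha> \<chi> \<longleftrightarrow> (\<forall>\<psi>\<in>S. gsat M \<alpha> \<psi>))"
  using assms(2,3)
proof (induction S)
  case empty
  have "Atom ATrue \<in> F" using assms(1) fragmentD(1) unfolding fragment_def by blast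
  then show ?case by (intro bexI[of _ "Atom ATrue"]) auto
next
  case (insert \<psi> S)
  then obtain \<chi> where "\<chi> \<in> F" "FV \<chi> \<subseteq> (\<Union>\<psi>\<in>S. FV \<psi>)"
    "\<forall>M :: ('p, 'a) lword. \<forall>\<alpha>. gsat M \<alpha> \<chi> \<longleftrightarrow> (\<forall>\<psi>\<in>S. gsat M \<alpha> \<psi>)" by blast
  with insert.prems show ?case
    by (intro bexI[of _ "And \<psi> \<chi>"]) (auto simp: fragmentD(5)[OF assms(1)])
qed

lemma fragment_big_Or:
  assumes "fragment F" "finite S" "S \<subseteq> F"
  shows "\<exists>\<chi>\<in>F. FV \<chi> \<subseteq> (\<Union>\<psi>\<in>S. FV \<psi>) \<and> (\<forall>M :: ('p, 'a) lword. \<forall>\<alpha>. gsat M \<alpha> \<chi> \<longleftrightarrow> (\<exists>\<psi>\<in>S. gsat M \<alpha> \<psi>))"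
  using assms(2,3)
proof (induction S)
  case empty
  have "Atom AFalse \<in> F" using assms(1) fragmentD(2) unfolding fragment_def by blast
  then show ?case by (intro bexI[of _ "Atom AFalse"]) auto
next
  case (insert \<psi> S)
  then obtain \<chi> where "\<chi> \<in> F" "FV \<chi> \<subseteq> (\<Union>\<psi>\<in>S. FV \<psi>)"
    "\<forall>M :: ('p, 'a) lword. \<forall>\<alpha>. gsat M \<alpha> \<chi> \<longleftrightarrow> (\<exists>\<psi>\<in>S. gsat M \<alpha> \<psi>)" by blast
  with insert.prems show ?case
    by (intro bexI[of _ "Or \<psi> \<chi>"]) (auto simp: fragmentD(4)[OF assms(1)])
qed

section \<open>Saturation and Duplicator's answers\<close>

instance atom :: (countable, countable) countable
  by countable_datatype

instance fm :: (countable, countable) countable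
  by countable_datatype

text \<open>Formulae are countable, so let \<open>q n\<close> satisfy the finitely many members of
  \<open>\<Phi>\<close> with code at most \<open>n\<close>. The limit of a subsequence satisfies
  every member, because it agrees with later and later \<open>q n\<close> for more and more
  rounds.\<close>

lemma ef_compact_saturated:
  fixes \<Phi> :: "('v::countable, 'a::countable) fm set"
  assumes M: "ef_compact M" and X: "finite X" "\<beta> ` X \<subseteq> pts M"
    and FV: "\<And>\<phi>. \<phi> \<in> \<Phi> \<Longrightarrow> FV \<phi> \<subseteq> insert x X"
    and fin: "\<And>\<Psi>. finite \<Psi> \<Longrightarrow> \<Psi> \<subseteq> \<Phi> \<Longrightarrow> \<exists>p\<in>pts M. \<forall>\<psi>\<in>\<Psi>. gsat M (\<beta>(x := p)) \<psi>"
  shows "\<exists>p\<in>pts M. \<forall>\<phi>\<in>\<Phi>. gsat M (\<beta>(x := p)) \<phi>"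
proof -
  have fin_n: "finite {\<phi> \<in> \<Phi>. to_nat \<phi> \<le> n}" for n
    by (rule finite_subset[of _ "to_nat -` {..n}"]) (auto intro: finite_vimageI)
  have "\<forall>n. \<exists>p. p \<in> pts M \<and> (\<forall>\<psi>\<in>{\<phi> \<in> \<Phi>. to_nat \<phi> \<le> n}. gsat M (\<beta>(x := p)) \<psi>)"
    using fin[OF fin_n] by blast
  then obtain q where q: "\<And>n. q n \<in> pts M" "\<And>n \<phi>. \<phi> \<in> \<Phi> \<Longrightarrow> to_nat \<phi> \<le> n \<Longrightarrow> gsat M (\<beta>(x := q n)) \<phi>"
    by (metis (mono_tags, lifting) mem_Collect_eq)
  obtain c f where c: "c \<in> pts M" "strict_mono (f :: nat \<Rightarrow> nat)"
    and ef: "\<And>k. EF k M M (insert (q (f k), c) (Id_on (\<beta> ` X)))"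
    using ef_compactE[OF M finite_imageI[OF X(1)] X(2), of q] q(1) by blast
  have "gsat M (\<beta>(x := c)) \<phi>" if "\<phi> \<in> \<Phi>" for \<phi>
  proof -
    \<comment> \<open>At least the code, so that \<open>q (f k)\<close> satisfies
      \<open>\<phi>\<close>, and at least the rank, so that \<open>k\<close> rounds carry
      \<open>\<phi>\<close> over to \<open>c\<close>.\<close>
    define k where "k = max (to_nat \<phi>) (qrank \<phi>)"
    have "to_nat \<phi> \<le> f k" using strict_mono_imp_increasing[OF c(2), of k] by (simp add: k_def)
    then have "gsat M (\<beta>(x := q (f k))) \<phi>" using q(2) that by blast
    moreover have "gsat M (\<beta>(x := q (f k))) \<phi> \<longleftrightarrow> gsat M (\<beta>(x := c)) \<phi>"
      by (rule EF_gsat[OF ef[of k]]) (use FV[OF that] in \<open>auto simp: k_def\<close>)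
    ultimately show ?thesis by blast
  qed
  with c(1) show ?thesis by blast
qed

text \<open>Saturation is applied to the formulae true at \<open>q\<close>: any finitely many of
  them have a conjunction in \<open>H\<close>, and its existential statement passes from
  \<open>M\<close> to \<open>N\<close>.\<close>

lemma respond_ex:
  fixes H :: "('v::countable, 'a::countable) fm set" and M N :: "('p, 'a) lword"
  assumes H: "fragment H" and N: "ef_compact N" and X: "finite X" "\<beta> ` X \<subseteq> pts N"
    and pres: "\<And>\<chi>. \<chi> \<in> H \<Longrightarrow> FV \<chi> \<subseteq> insert x X \<Longrightarrow> \<exists>p\<in>pts M. gsat M (\<alpha>(x := p)) \<chi> \<Longrightarrow>
      \<exists>p\<in>pts N. gsat N (\<beta>(x := p)) \<chi>"
    and q: "q \<in> pts M"
  shows "\<exists>r\<in>pts N. \<forall>\<phi>\<in>H. FV \<phi> \<subseteq> insert x X \<longrightarrow> gsat M (\<alpha>(x := q)) \<phi> \<longrightarrow> gsat N (\<beta>(x := r)) \<phi>"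
proof -
  define \<Phi> where "\<Phi> = {\<phi> \<in> H. FV \<phi> \<subseteq> insert x X \<and> gsat M (\<alpha>(x := q)) \<phi>}"
  have "\<exists>p\<in>pts N. \<forall>\<phi>\<in>\<Phi>. gsat N (\<beta>(x := p)) \<phi>"
  proof (rule ef_compact_saturated[OF N X])
    fix \<Psi> assume \<Psi>: "finite \<Psi>" "\<Psi> \<subseteq> \<Phi>"
    then have "\<Psi> \<subseteq> H" by (auto simp: \<Phi>_def)
    obtain \<chi> where \<chi>: "\<chi> \<in> H" "FV \<chi> \<subseteq> (\<Union>\<psi>\<in>\<Psi>. FV \<psi>)"
      "\<And>(K :: ('p, 'a) lword) \<alpha>. gsat K \<alpha> \<chi> \<longleftrightarrow> (\<forall>\<psi>\<in>\<Psi>. gsat K \<alpha> \<psi>)"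
      using fragment_big_And[OF H \<Psi>(1) \<open>\<Psi> \<subseteq> H\<close>] by blast
    have "FV \<chi> \<subseteq> insert x X" using \<chi>(2) \<Psi> by (auto simp: \<Phi>_def)
    moreover have "gsat M (\<alpha>(x := q)) \<chi>" using \<chi>(3) \<Psi> by (auto simp: \<Phi>_def)
    ultimately show "\<exists>p\<in>pts N. \<forall>\<psi>\<in>\<Psi>. gsat N (\<beta>(x := p)) \<psi>"
      using pres[OF \<chi>(1)] q \<chi>(3) by blast
  qed (auto simp: \<Phi>_def)
  then show ?thesis by (auto simp: \<Phi>_def)
qed

text \<open>Saturation is applied to the negations of the formulae false at \<open>q\<close>. If
  finitely many of these formulae could not be falsified together in \<open>M\<close>, their
  disjunction would hold throughout \<open>M\<close>, hence throughout \<open>N\<close>, contrary to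
  the choice at \<open>q\<close>. The negations themselves may lie outside \<open>H\<close>.\<close>

lemma respond_all:
  fixes H :: "('v::countable, 'a::countable) fm set" and M N :: "('p, 'a) lword"
  assumes H: "fragment H" and M: "ef_compact M" and X: "finite X" "\<alpha> ` X \<subseteq> pts M"
    and pres: "\<And>\<chi>. \<chi> \<in> H \<Longrightarrow> FV \<chi> \<subseteq> insert x X \<Longrightarrow> \<forall>p\<in>pts M. gsat M (\<alpha>(x := p)) \<chi> \<Longrightarrow>
      \<forall>p\<in>pts N. gsat N (\<beta>(x := p)) \<chi>"
    and q: "q \<in> pts N"
  shows "\<exists>r\<in>pts M. \<forall>\<phi>\<in>H. FV \<phi> \<subseteq> insert x X \<longrightarrow> gsat M (\<alpha>(x := r)) \<phi> \<longrightarrow> gsat N (\<beta>(x := q)) \<phi>"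
proof -
  define \<Phi> where "\<Phi> = {\<phi> \<in> H. FV \<phi> \<subseteq> insert x X \<and> \<not> gsat N (\<beta>(x := q)) \<phi>}"
  have "\<exists>p\<in>pts M. \<forall>\<phi>\<in>Neg ` \<Phi>. gsat M (\<alpha>(x := p)) \<phi>"
  proof (rule ef_compact_saturated[OF M X])
    fix \<Psi>' assume "finite \<Psi>'" "\<Psi>' \<subseteq> Neg ` \<Phi>"
    then obtain \<Psi> where \<Psi>: "finite \<Psi>" "\<Psi> \<subseteq> \<Phi>" and \<Psi>': "\<Psi>' = Neg ` \<Psi>"
      by (metis finite_subset_image)
    then have "\<Psi> \<subseteq> H" by (auto simp: \<Phi>_def)
    obtain \<chi> where \<chi>: "\<chi> \<in> H" "FV \<chi> \<subseteq> (\<Union>\<psi>\<in>\<Psi>. FV \<psi>)"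
      "\<And>(K :: ('p, 'a) lword) \<alpha>. gsat K \<alpha> \<chi> \<longleftrightarrow> (\<exists>\<psi>\<in>\<Psi>. gsat K \<alpha> \<psi>)"
      using fragment_big_Or[OF H \<Psi>(1) \<open>\<Psi> \<subseteq> H\<close>] by blast
    have "FV \<chi> \<subseteq> insert x X" using \<chi>(2) \<Psi> by (auto simp: \<Phi>_def)
    moreover have "\<not> gsat N (\<beta>(x := q)) \<chi>" using \<chi>(3) \<Psi> by (auto simp: \<Phi>_def)
    ultimately obtain p where "p \<in> pts M" "\<not> gsat M (\<alpha>(x := p)) \<chi>"
      using pres[OF \<chi>(1)] q by blast
    then show "\<exists>p\<in>pts M. \<forall>\<psi>\<in>\<Psi>'. gsat M (\<alpha>(x := p)) \<psi>"
      using \<chi>(3) unfolding \<Psi>' by (intro bexI[of _ p]) auto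
  qed (auto simp: \<Phi>_def)
  then show ?thesis by (auto simp: \<Phi>_def)
qed

definition sat_inv :: "('v, 'a) config set" where
  "sat_inv = {(G, (u, \<alpha>), (v, \<beta>)) |G u \<alpha> v \<beta>. fragment G \<and>
     ef_compact (gw u) \<and> ef_compact (gw v) \<and> dom \<alpha> = dom \<beta> \<and> finite (dom \<alpha>) \<and>
     (\<forall>z\<in>dom \<alpha>. the (\<alpha> z) \<in> positions u \<and> the (\<beta> z) \<in> positions v) \<and>
     (\<forall>\<phi>\<in>G. FV \<phi> \<subseteq> dom \<alpha> \<longrightarrow> sat u \<alpha> \<phi> \<longrightarrow> sat v \<beta> \<phi>)}"

lemma dup_inv_sat_inv: "dup_inv (sat_inv :: ('v::countable, 'a::countable) config set)"
  unfolding dup_inv_def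
proof (intro ballI conjI allI impI)
  fix c :: "('v, 'a) config" assume "c \<in> sat_inv"
  then obtain G u \<alpha> v \<beta> where c: "c = (G, (u, \<alpha>), (v, \<beta>))" and G: "fragment G"
    and comp: "ef_compact (gw u)" "ef_compact (gw v)" and dom: "dom \<alpha> = dom \<beta>" "finite (dom \<alpha>)"
    and ran: "\<And>z. z \<in> dom \<alpha> \<Longrightarrow> the (\<alpha> z) \<in> positions u \<and> the (\<beta> z) \<in> positions v"
    and pres: "\<And>\<phi>. \<phi> \<in> G \<Longrightarrow> FV \<phi> \<subseteq> dom \<alpha> \<Longrightarrow> sat u \<alpha> \<phi> \<Longrightarrow> sat v \<beta> \<phi>"
    unfolding sat_inv_def by blast
  show "\<not> spoiler_stop c" using pres unfolding c by auto
  fix m assume m: "spoiler_legal c m"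
  obtain Q x q where mq: "m = (Q, x, q)" by (cases m)
  define H where "H = reduct G Q x"
  have H: "fragment H" and q: "q \<in> (if Q \<in> {QEx, QNegAll} then positions u else positions v)"
    using m fragment_reduct[OF G] unfolding c mq H_def by auto
  have fin: "finite (dom \<alpha>)" "finite (dom \<beta>)" using dom by simp_all
  have img: "(the \<circ> \<alpha>) ` dom \<alpha> \<subseteq> pts (gw u)" "(the \<circ> \<beta>) ` dom \<alpha> \<subseteq> pts (gw v)"
    using ran by auto
  have upd: "gsat M (the \<circ> (\<gamma>(x \<mapsto> p))) \<phi> = gsat M ((the \<circ> \<gamma>)(x := p)) \<phi>" for M :: "(nat, 'a) lword" and \<gamma> :: "'v \<rightharpoonup> nat" and p \<phi>
    by (simp add: fun_upd_comp)
  have FVq: "FV (quantify Q x \<chi>) \<subseteq> dom \<alpha>" if "FV \<chi> \<subseteq> insert x (dom \<alpha>)" for \<chi> :: "('v, 'a) fm"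
    using that by (cases Q) auto
  \<comment> \<open>Stated for both orientations because the negated quantifiers exchange the two
    words.\<close>
  have inv: "(H, (u', \<alpha>'(x \<mapsto> a)), (v', \<beta>'(x \<mapsto> b))) \<in> sat_inv"
    if "u' = u \<and> v' = v \<and> \<alpha>' = \<alpha> \<and> \<beta>' = \<beta> \<or> u' = v \<and> v' = u \<and> \<alpha>' = \<beta> \<and> \<beta>' = \<alpha>"
      "a \<in> positions u'" "b \<in> positions v'"
      "\<forall>\<phi>\<in>H. FV \<phi> \<subseteq> insert x (dom \<alpha>) \<longrightarrow> gsat (gw u') ((the \<circ> \<alpha>')(x := a)) \<phi> \<longrightarrow> gsat (gw v') ((the \<circ> \<beta>')(x := b)) \<phi>"
    for u' v' \<alpha>' \<beta>' a b
    using that(1)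
  proof
    assume e: "u' = u \<and> v' = v \<and> \<alpha>' = \<alpha> \<and> \<beta>' = \<beta>"
    show ?thesis
      using that(2-4) e H comp dom ran by (simp add: sat_inv_def sat_gsat upd)
  next
    assume e: "u' = v \<and> v' = u \<and> \<alpha>' = \<beta> \<and> \<beta>' = \<alpha>"
    show ?thesis
      using that(2-4) e H comp dom ran by (simp add: sat_inv_def sat_gsat upd)
  qed
  show "\<exists>r. duplicator_legal c m r \<and> next_config c m r \<in> sat_inv"
  proof (cases Q)
    case QEx
    have "\<exists>r\<in>pts (gw v). \<forall>\<phi>\<in>H. FV \<phi> \<subseteq> insert x (dom \<alpha>) \<longrightarrow>
        gsat (gw u) ((the \<circ> \<alpha>)(x := q)) \<phi> \<longrightarrow> gsat (gw v) ((the \<circ> \<beta>)(x := r)) \<phi>"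
    proof (rule respond_ex[OF H comp(2) fin(1) img(2)])
      fix \<chi> assume \<chi>: "\<chi> \<in> H" "FV \<chi> \<subseteq> insert x (dom \<alpha>)" "\<exists>p\<in>pts (gw u). gsat (gw u) ((the \<circ> \<alpha>)(x := p)) \<chi>"
      then show "\<exists>p\<in>pts (gw v). gsat (gw v) ((the \<circ> \<beta>)(x := p)) \<chi>"
        using pres[of "quantify Q x \<chi>"] FVq[OF \<chi>(2)] QEx by (simp add: H_def reduct_def sat_gsat upd)
    qed (use q QEx in simp)
    then obtain r where r: "r \<in> positions v" "\<forall>\<phi>\<in>H. FV \<phi> \<subseteq> insert x (dom \<alpha>) \<longrightarrow>
        gsat (gw u) ((the \<circ> \<alpha>)(x := q)) \<phi> \<longrightarrow> gsat (gw v) ((the \<circ> \<beta>)(x := r)) \<phi>" by auto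
    have "(H, (u, \<alpha>(x \<mapsto> q)), (v, \<beta>(x \<mapsto> r))) \<in> sat_inv"
      by (rule inv) (use q r QEx in auto)
    then show ?thesis using r(1) QEx by (intro exI[of _ r]) (simp add: c mq H_def)
  next
    case QAll
    have "\<exists>r\<in>pts (gw u). \<forall>\<phi>\<in>H. FV \<phi> \<subseteq> insert x (dom \<alpha>) \<longrightarrow>
        gsat (gw u) ((the \<circ> \<alpha>)(x := r)) \<phi> \<longrightarrow> gsat (gw v) ((the \<circ> \<beta>)(x := q)) \<phi>"
    proof (rule respond_all[OF H comp(1) fin(1) img(1)])
      fix \<chi> assume \<chi>: "\<chi> \<in> H" "FV \<chi> \<subseteq> insert x (dom \<alpha>)" "\<forall>p\<in>pts (gw u). gsat (gw u) ((the \<circ> \<alpha>)(x := p)) \<chi>"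
      then show "\<forall>p\<in>pts (gw v). gsat (gw v) ((the \<circ> \<beta>)(x := p)) \<chi>"
        using pres[of "quantify Q x \<chi>"] FVq[OF \<chi>(2)] QAll by (simp add: H_def reduct_def sat_gsat upd)
    qed (use q QAll in simp)
    then obtain r where r: "r \<in> positions u" "\<forall>\<phi>\<in>H. FV \<phi> \<subseteq> insert x (dom \<alpha>) \<longrightarrow>
        gsat (gw u) ((the \<circ> \<alpha>)(x := r)) \<phi> \<longrightarrow> gsat (gw v) ((the \<circ> \<beta>)(x := q)) \<phi>" by auto
    have "(H, (u, \<alpha>(x \<mapsto> r)), (v, \<beta>(x \<mapsto> q))) \<in> sat_inv"
      by (rule inv) (use q r QAll in auto)
    then show ?thesis using r(1) QAll by (intro exI[of _ r]) (simp add: c mq H_def)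
  next
    case QNegEx
    have "\<exists>r\<in>pts (gw u). \<forall>\<phi>\<in>H. FV \<phi> \<subseteq> insert x (dom \<alpha>) \<longrightarrow>
        gsat (gw v) ((the \<circ> \<beta>)(x := q)) \<phi> \<longrightarrow> gsat (gw u) ((the \<circ> \<alpha>)(x := r)) \<phi>"
    proof (rule respond_ex[OF H comp(1) fin(1) img(1)])
      fix \<chi> assume \<chi>: "\<chi> \<in> H" "FV \<chi> \<subseteq> insert x (dom \<alpha>)" "\<exists>p\<in>pts (gw v). gsat (gw v) ((the \<circ> \<beta>)(x := p)) \<chi>"
      then show "\<exists>p\<in>pts (gw u). gsat (gw u) ((the \<circ> \<alpha>)(x := p)) \<chi>"
        using pres[of "quantify Q x \<chi>"] FVq[OF \<chi>(2)] QNegEx by (auto simp: H_def reduct_def sat_gsat upd)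
    qed (use q QNegEx in simp)
    then obtain r where r: "r \<in> positions u" "\<forall>\<phi>\<in>H. FV \<phi> \<subseteq> insert x (dom \<alpha>) \<longrightarrow>
        gsat (gw v) ((the \<circ> \<beta>)(x := q)) \<phi> \<longrightarrow> gsat (gw u) ((the \<circ> \<alpha>)(x := r)) \<phi>" by auto
    have "(H, (v, \<beta>(x \<mapsto> q)), (u, \<alpha>(x \<mapsto> r))) \<in> sat_inv"
      by (rule inv) (use q r QNegEx in auto)
    then show ?thesis using r(1) QNegEx by (intro exI[of _ r]) (simp add: c mq H_def)
  next
    case QNegAll
    have "\<exists>r\<in>pts (gw v). \<forall>\<phi>\<in>H. FV \<phi> \<subseteq> insert x (dom \<alpha>) \<longrightarrow>
        gsat (gw v) ((the \<circ> \<beta>)(x := r)) \<phi> \<longrightarrow> gsat (gw u) ((the \<circ> \<alpha>)(x := q)) \<phi>"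
    proof (rule respond_all[OF H comp(2) fin(1) img(2)])
      fix \<chi> assume \<chi>: "\<chi> \<in> H" "FV \<chi> \<subseteq> insert x (dom \<alpha>)" "\<forall>p\<in>pts (gw v). gsat (gw v) ((the \<circ> \<beta>)(x := p)) \<chi>"
      then show "\<forall>p\<in>pts (gw u). gsat (gw u) ((the \<circ> \<alpha>)(x := p)) \<chi>"
        using pres[of "quantify Q x \<chi>"] FVq[OF \<chi>(2)] QNegAll by (auto simp: H_def reduct_def sat_gsat upd)
    qed (use q QNegAll in simp)
    then obtain r where r: "r \<in> positions v" "\<forall>\<phi>\<in>H. FV \<phi> \<subseteq> insert x (dom \<alpha>) \<longrightarrow>
        gsat (gw v) ((the \<circ> \<beta>)(x := r)) \<phi> \<longrightarrow> gsat (gw u) ((the \<circ> \<alpha>)(x := q)) \<phi>" by auto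
    have "(H, (v, \<beta>(x \<mapsto> r)), (u, \<alpha>(x \<mapsto> q))) \<in> sat_inv"
      by (rule inv) (use q r QNegAll in auto)
    then show ?thesis using r(1) QNegAll by (intro exI[of _ r]) (simp add: c mq H_def)
  qed
qed

lemma duplicator_wins_if_preserved:
  fixes F :: "('v::countable, 'a::countable) fm set"
  assumes "fragment F" "ef_compact (gw u)" "ef_compact (gw v)"
    and "\<And>\<phi>. \<phi> \<in> F \<Longrightarrow> sentence \<phi> \<Longrightarrow> sat u Map.empty \<phi> \<Longrightarrow> sat v Map.empty \<phi>"
  shows "duplicator_wins F u v"
proof -
  have "(F, (u, Map.empty), (v, Map.empty)) \<in> sat_inv"
    using assms by (simp add: sat_inv_def sentence_def)
  then show ?thesis using dup_inv_sat_inv duplicator_wins_iff by blast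
qed

section \<open>From an identity to preservation of sentences\<close>

primrec letters :: "'a pterm \<Rightarrow> 'a set" where
  "letters (Letter a) = {a}"
| "letters (Pow s) = letters s"
| "letters (LetterCat a t) = insert a (letters t)"
| "letters (PowCat s t) = letters s \<union> letters t"

lemma finite_letters: "finite (letters t)"
  by (induction t) auto

lemma letters_nonempty: "letters t \<noteq> {}"
  by (induction t) auto

lemma fin_eval_cong: "(\<And>a. a \<in> letters t \<Longrightarrow> w a = w' a) \<Longrightarrow> fin_eval n w t = fin_eval n w' t"
  by (induction t) auto

lemma sat_eval_rho:
  assumes "sentence \<phi>" "2 ^ qrank \<phi> < n"
  shows "sat (eval_pterm order_rho t) Map.empty \<phi> \<longleftrightarrow> sat (finite_word (fin_eval n (\<lambda>a. [a]) t)) Map.empty \<phi>"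
  using ef_equiv_gsat[OF ef_equiv_eval_rho[OF assms(2)]] assms(1)
  by (simp add: sat_sentence[OF assms(1), of _ undefined] sentence_def)

lemma identity_imp_sat_eval:
  fixes \<phi> :: "('v, 'a) fm"
  assumes \<phi>: "sentence \<phi>" and A: "A = letters s \<union> letters t"
    and id: "identity_holds (synt_semigroup A (language A \<phi>)) (synt_mult A (language A \<phi>)) s t"
  shows "sat (eval_pterm order_rho s) Map.empty \<phi> \<longleftrightarrow> sat (eval_pterm order_rho t) Map.empty \<phi>"
proof -
  define n :: nat where "n = Suc (2 ^ qrank \<phi>)"
  have n: "2 ^ qrank \<phi> < n" by (simp add: n_def)
  obtain a0 where "a0 \<in> A" using letters_nonempty[of s] A by blast
  \<comment> \<open>A morphism needs a value at every letter, also outside the alphabet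
    \<open>A\<close>; a fixed letter of \<open>A\<close> fills in there, and \<open>s\<close> and
    \<open>t\<close> never mention those letters.\<close>
  define w where "w a = [if a \<in> A then a else a0]" for a
  have w: "\<forall>a. w a \<in> nonempty_words A" using \<open>a0 \<in> A\<close> by (auto simp: w_def nonempty_words_def)
  then have "(fin_eval n w s, fin_eval n w t) \<in> synt_cong A (language A \<phi>)"
    using id identity_holds_iff[OF \<phi> n] by blast
  then have "fin_eval n w s \<in> nonempty_words A" "fin_eval n w t \<in> nonempty_words A"
    and "[] @ fin_eval n w s @ [] \<in> language A \<phi> \<longleftrightarrow> [] @ fin_eval n w t @ [] \<in> language A \<phi>"
    unfolding synt_cong_def by blast+
  then have "sat (finite_word (fin_eval n w s)) Map.empty \<phi> \<longleftrightarrow> sat (finite_word (fin_eval n w t)) Map.empty \<phi>"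
    by (simp add: language_def)
  moreover have "fin_eval n w s = fin_eval n (\<lambda>a. [a]) s" "fin_eval n w t = fin_eval n (\<lambda>a. [a]) t"
    by (auto intro!: fin_eval_cong simp: w_def A)
  ultimately show ?thesis using sat_eval_rho[OF \<phi> n] by simp
qed

lemma identities_imp_duplicator_wins:
  fixes F :: "('v::countable, 'a::countable) fm set"
  assumes F: "fragment F"
    and id: "\<And>A \<phi>. finite A \<Longrightarrow> \<phi> \<in> F \<Longrightarrow> sentence \<phi> \<Longrightarrow>
      identity_holds (synt_semigroup A (language A \<phi>)) (synt_mult A (language A \<phi>)) s t"
  shows "duplicator_wins F (eval_pterm order_rho s) (eval_pterm order_rho t)"
    and "duplicator_wins F (eval_pterm order_rho t) (eval_pterm order_rho s)"
proof -
  have "sat (eval_pterm order_rho s) Map.empty \<phi> \<longleftrightarrow> sat (eval_pterm order_rho t) Map.empty \<phi>"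
    if "\<phi> \<in> F" "sentence \<phi>" for \<phi>
    by (rule identity_imp_sat_eval[OF that(2) refl id]) (use that in \<open>auto simp: finite_letters\<close>)
  then show "duplicator_wins F (eval_pterm order_rho s) (eval_pterm order_rho t)"
    "duplicator_wins F (eval_pterm order_rho t) (eval_pterm order_rho s)"
    using F by (auto intro!: duplicator_wins_if_preserved ef_compact_eval_rho)
qed


section \<open>From strategies to identities\<close>

text \<open>A successor pair across the border of a sum consists of a position with nothing above it
  and one with nothing below it. On linear orders these notions agree with the atoms max and
  min.\<close>

definition lfirst :: "('p, 'a) lword \<Rightarrow> 'p \<Rightarrow> bool" where
  "lfirst M p \<longleftrightarrow> (\<forall>z\<in>pts M. \<not> lless M z p)"

definition llast :: "('p, 'a) lword \<Rightarrow> 'p \<Rightarrow> bool" where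
  "llast M p \<longleftrightarrow> (\<forall>z\<in>pts M. \<not> lless M p z)"

lemma lfirst_lmin:
  assumes "Linear_order (fst M)" "p \<in> pts M"
  shows "lfirst M p \<longleftrightarrow> lmin M p" "llast M p \<longleftrightarrow> lmax M p"
proof -
  have "(p, z) \<in> fst M \<longleftrightarrow> \<not> lless M z p" "(z, p) \<in> fst M \<longleftrightarrow> \<not> lless M p z" if "z \<in> pts M" for z
  proof -
    have "(p, p) \<in> fst M" "p \<noteq> z \<Longrightarrow> (p, z) \<in> fst M \<or> (z, p) \<in> fst M"
      using assms that by (auto simp: order_on_defs refl_on_def total_on_def)
    moreover have "(p, z) \<in> fst M \<Longrightarrow> (z, p) \<in> fst M \<Longrightarrow> p = z"
      using assms by (auto simp: order_on_defs dest: antisymD)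
    ultimately show "(p, z) \<in> fst M \<longleftrightarrow> \<not> lless M z p" "(z, p) \<in> fst M \<longleftrightarrow> \<not> lless M p z"
      unfolding lless_def by auto
  qed
  then show "lfirst M p \<longleftrightarrow> lmin M p" "llast M p \<longleftrightarrow> lmax M p"
    by (simp_all add: lfirst_def lmin_def llast_def lmax_def)
qed

lemma lless_lsum [simp]:
  "lless (lsum M N) (Inl p) (Inl p') \<longleftrightarrow> lless M p p'"
  "lless (lsum M N) (Inr q) (Inr q') \<longleftrightarrow> lless N q q'"
  "lless (lsum M N) (Inl p) (Inr q) \<longleftrightarrow> p \<in> pts M \<and> q \<in> pts N"
  "\<not> lless (lsum M N) (Inr q) (Inl p)"
  by (simp_all add: lless_def)

lemma ball_pts_lsum: "(\<forall>z\<in>pts (lsum M N). P z) \<longleftrightarrow> (\<forall>p\<in>pts M. P (Inl p)) \<and> (\<forall>q\<in>pts N. P (Inr q))"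
  unfolding pts_lsum by blast

lemma bex_pts_lsum: "(\<exists>z\<in>pts (lsum M N). P z) \<longleftrightarrow> (\<exists>p\<in>pts M. P (Inl p)) \<or> (\<exists>q\<in>pts N. P (Inr q))"
  unfolding pts_lsum by blast

lemma lsuc_lsum [simp]:
  "lsuc (lsum M N) (Inl p) (Inl p') \<longleftrightarrow> lsuc M p p'"
  "lsuc (lsum M N) (Inr q) (Inr q') \<longleftrightarrow> lsuc N q q'"
  "lsuc (lsum M N) (Inl p) (Inr q) \<longleftrightarrow> p \<in> pts M \<and> q \<in> pts N \<and> llast M p \<and> lfirst N q"
  "\<not> lsuc (lsum M N) (Inr q) (Inl p)"
  unfolding lsuc_def bex_pts_lsum llast_def lfirst_def by auto

lemma lmin_lsum [simp]:
  "lmin (lsum M N) (Inl p) \<longleftrightarrow> lmin M p \<and> (p \<in> pts M \<or> pts N = {})"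
  "lmin (lsum M N) (Inr q) \<longleftrightarrow> pts M = {} \<and> lmin N q"
  "lmax (lsum M N) (Inr q) \<longleftrightarrow> lmax N q \<and> (q \<in> pts N \<or> pts M = {})"
  "lmax (lsum M N) (Inl p) \<longleftrightarrow> pts N = {} \<and> lmax M p"
  unfolding lmin_def lmax_def ball_pts_lsum by auto

lemma lfirst_lsum [simp]:
  "lfirst (lsum M N) (Inl p) \<longleftrightarrow> lfirst M p"
  "q \<in> pts N \<Longrightarrow> lfirst (lsum M N) (Inr q) \<longleftrightarrow> pts M = {} \<and> lfirst N q"
  unfolding lfirst_def ball_pts_lsum by auto

section \<open>Expanding letters into words\<close>

locale expansion =
  fixes w :: "'a \<Rightarrow> 'b list" and M :: "('p, 'a) lword"
  assumes w: "w a \<noteq> []" and M: "Linear_order (fst M)"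
begin

lemma ball_pts_lsub: "(\<forall>z\<in>pts (lsub w M). P z) \<longleftrightarrow> (\<forall>p\<in>pts M. \<forall>i<length (w (snd M p)). P (p, i))"
  unfolding pts_lsub by blast

lemma bex_pts_lsub: "(\<exists>z\<in>pts (lsub w M). P z) \<longleftrightarrow> (\<exists>p\<in>pts M. \<exists>i<length (w (snd M p)). P (p, i))"
  unfolding pts_lsub by blast

lemma len_pos: "0 < length (w a)"
  using w by simp

lemma pts_lsub_empty: "pts (lsub w M) = {} \<longleftrightarrow> pts M = {}"
  using len_pos unfolding pts_lsub by blast

lemma refl_M: "p \<in> pts M \<Longrightarrow> (p, p) \<in> fst M"
  using M by (simp add: order_on_defs refl_on_def)

context
  fixes p q i j
  assumes p: "p \<in> pts M" "i < length (w (snd M p))" and q: "q \<in> pts M" "j < length (w (snd M q))"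
begin

lemma lless_lsub: "lless (lsub w M) (p, i) (q, j) \<longleftrightarrow> lless M p q \<or> p = q \<and> i < j"
  using p q by (auto simp: lless_def lsub_simps)

text \<open>The source of order stability: depending on the indices, a weak comparison of expanded
  positions is a weak or a strict one of the original positions.\<close>

lemma leq_lsub:
  "((p, i), (q, j)) \<in> fst (lsub w M) \<longleftrightarrow> (if i \<le> j then (p, q) \<in> fst M else lless M p q)"
  using p q refl_M by (auto simp: lless_def lsub_simps)

end

text \<open>Blocks are non-empty, so an extreme position of the expansion has to sit in an extreme
  block.\<close>

lemma lfirst_lsub:
  assumes p: "p \<in> pts M" "i < length (w (snd M p))"
  shows "lfirst (lsub w M) (p, i) \<longleftrightarrow> lfirst M p \<and> i = 0"
    "llast (lsub w M) (p, i) \<longleftrightarrow> llast M p \<and> Suc i = length (w (snd M p))"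
proof -
  have "(\<forall>z\<in>pts M. \<forall>j<length (w (snd M z)). \<not> (lless M z p \<or> z = p \<and> j < i)) \<longleftrightarrow> lfirst M p \<and> i = 0"
  proof (intro iffI conjI)
    assume a: "\<forall>z\<in>pts M. \<forall>j<length (w (snd M z)). \<not> (lless M z p \<or> z = p \<and> j < i)"
    show "i = 0" using a[rule_format, OF p(1) len_pos] by simp
    show "lfirst M p" unfolding lfirst_def using a[rule_format, OF _ len_pos] by blast
  qed (auto simp: lfirst_def)
  then show "lfirst (lsub w M) (p, i) \<longleftrightarrow> lfirst M p \<and> i = 0"
    unfolding lfirst_def[of "lsub w M"] ball_pts_lsub using p by (simp add: lless_lsub)
  have "(\<forall>z\<in>pts M. \<forall>j<length (w (snd M z)). \<not> (lless M p z \<or> p = z \<and> i < j)) \<longleftrightarrow>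
      llast M p \<and> Suc i = length (w (snd M p))"
  proof (intro iffI conjI)
    assume a: "\<forall>z\<in>pts M. \<forall>j<length (w (snd M z)). \<not> (lless M p z \<or> p = z \<and> i < j)"
    show "Suc i = length (w (snd M p))" using a[rule_format, OF p(1), of "Suc i"] p(2) by fastforce
    show "llast M p" unfolding llast_def using a[rule_format, OF _ len_pos] by blast
  qed (auto simp: llast_def)
  then show "llast (lsub w M) (p, i) \<longleftrightarrow> llast M p \<and> Suc i = length (w (snd M p))"
    unfolding llast_def[of "lsub w M"] ball_pts_lsub using p by (simp add: lless_lsub)
qed

lemma lmin_lsub:
  assumes p: "p \<in> pts M" "i < length (w (snd M p))"
  shows "lmin (lsub w M) (p, i) \<longleftrightarrow> lmin M p \<and> i = 0"
    "lmax (lsub w M) (p, i) \<longleftrightarrow> lmax M p \<and> Suc i = length (w (snd M p))"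
proof -
  have "lmin (lsub w M) (p, i) \<longleftrightarrow>
      (\<forall>z\<in>pts M. \<forall>j<length (w (snd M z)). (p, z) \<in> fst M \<and> p \<noteq> z \<or> p = z \<and> i \<le> j)"
    unfolding lmin_def ball_pts_lsub using p by (auto simp: lsub_simps)
  also have "\<dots> \<longleftrightarrow> lmin M p \<and> i = 0"
  proof (intro iffI conjI)
    assume a: "\<forall>z\<in>pts M. \<forall>j<length (w (snd M z)). (p, z) \<in> fst M \<and> p \<noteq> z \<or> p = z \<and> i \<le> j"
    show "i = 0" using a[rule_format, OF p(1) len_pos] by simp
    show "lmin M p" unfolding lmin_def
    proof
      fix z assume "z \<in> pts M"
      from a[rule_format, OF this len_pos] refl_M[OF p(1)] show "(p, z) \<in> fst M" by auto
    qed
  qed (auto simp: lmin_def)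
  finally show "lmin (lsub w M) (p, i) \<longleftrightarrow> lmin M p \<and> i = 0" .
  have "lmax (lsub w M) (p, i) \<longleftrightarrow>
      (\<forall>z\<in>pts M. \<forall>j<length (w (snd M z)). (z, p) \<in> fst M \<and> p \<noteq> z \<or> p = z \<and> j \<le> i)"
    unfolding lmax_def ball_pts_lsub using p by (auto simp: lsub_simps)
  also have "\<dots> \<longleftrightarrow> lmax M p \<and> Suc i = length (w (snd M p))"
  proof (intro iffI conjI)
    assume a: "\<forall>z\<in>pts M. \<forall>j<length (w (snd M z)). (z, p) \<in> fst M \<and> p \<noteq> z \<or> p = z \<and> j \<le> i"
    show "Suc i = length (w (snd M p))" using a[rule_format, OF p(1), of "Suc i"] p(2) by fastforce
    show "lmax M p" unfolding lmax_def
    proof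
      fix z assume "z \<in> pts M"
      from a[rule_format, OF this len_pos] refl_M[OF p(1)] show "(z, p) \<in> fst M" by auto
    qed
  qed (auto simp: lmax_def)
  finally show "lmax (lsub w M) (p, i) \<longleftrightarrow> lmax M p \<and> Suc i = length (w (snd M p))" .
qed

text \<open>Since every block has a position, no block is skipped between consecutive positions. The
  first alternative is the source of the atom \<open>x = y\<close> in suc-stability.\<close>

lemma lsuc_lsub:
  assumes p: "p \<in> pts M" "i < length (w (snd M p))" and q: "q \<in> pts M" "j < length (w (snd M q))"
  shows "lsuc (lsub w M) (p, i) (q, j) \<longleftrightarrow>
    p = q \<and> j = Suc i \<or> lsuc M p q \<and> Suc i = length (w (snd M p)) \<and> j = 0"
proof -
  have irrefl: "\<not> lless M z z" for z by (simp add: lless_def)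
  have asym: "\<not> (lless M z z' \<and> lless M z' z)" for z z'
    using M unfolding lless_def order_on_defs antisym_def by blast
  have "lsuc (lsub w M) (p, i) (q, j) \<longleftrightarrow> (lless M p q \<or> p = q \<and> i < j) \<and>
      \<not> (\<exists>z\<in>pts M. \<exists>k<length (w (snd M z)). (lless M p z \<or> p = z \<and> i < k) \<and> (lless M z q \<or> z = q \<and> k < j))"
    unfolding lsuc_def bex_pts_lsub using p q by (simp add: lless_lsub cong: conj_cong bex_cong)
  also have "\<dots> \<longleftrightarrow> p = q \<and> j = Suc i \<or> lsuc M p q \<and> Suc i = length (w (snd M p)) \<and> j = 0"
  proof (cases "p = q")
    case True
    have "(\<exists>z\<in>pts M. \<exists>k<length (w (snd M z)). (lless M p z \<or> p = z \<and> i < k) \<and> (lless M z q \<or> z = q \<and> k < j)) \<longleftrightarrow>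
        (\<exists>k. i < k \<and> k < j)"
    proof
      assume "\<exists>z\<in>pts M. \<exists>k<length (w (snd M z)). (lless M p z \<or> p = z \<and> i < k) \<and> (lless M z q \<or> z = q \<and> k < j)"
      then show "\<exists>k. i < k \<and> k < j" using True irrefl asym by blast
    next
      assume "\<exists>k. i < k \<and> k < j"
      then show "\<exists>z\<in>pts M. \<exists>k<length (w (snd M z)). (lless M p z \<or> p = z \<and> i < k) \<and> (lless M z q \<or> z = q \<and> k < j)"
        using True p q by (metis less_trans)
    qed
    moreover have "(i < j \<and> \<not> (\<exists>k. i < k \<and> k < j)) \<longleftrightarrow> j = Suc i"
      by (metis Suc_lessI lessI not_less_eq)
    ultimately show ?thesis using True irrefl unfolding lsuc_def by blast
  next
    case False
    \<comment> \<open>With \<open>p\<close> before \<open>q\<close>, a position in between lies in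
      an intermediate block, later in the block of \<open>p\<close>, or earlier in the block of
      \<open>q\<close>.\<close>
    have ex: "(\<exists>z\<in>pts M. \<exists>k<length (w (snd M z)). (lless M p z \<or> p = z \<and> i < k) \<and> (lless M z q \<or> z = q \<and> k < j)) \<longleftrightarrow>
        (\<exists>z\<in>pts M. lless M p z \<and> lless M z q) \<or> Suc i < length (w (snd M p)) \<or> 0 < j" if "lless M p q"
    proof
      assume "\<exists>z\<in>pts M. \<exists>k<length (w (snd M z)). (lless M p z \<or> p = z \<and> i < k) \<and> (lless M z q \<or> z = q \<and> k < j)"
      then obtain z k where "z \<in> pts M" "k < length (w (snd M z))" "lless M p z \<or> p = z \<and> i < k"
        "lless M z q \<or> z = q \<and> k < j" by blast
      then show "(\<exists>z\<in>pts M. lless M p z \<and> lless M z q) \<or> Suc i < length (w (snd M p)) \<or> 0 < j"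
        using False by (cases "p = z"; cases "z = q") auto
    next
      assume "(\<exists>z\<in>pts M. lless M p z \<and> lless M z q) \<or> Suc i < length (w (snd M p)) \<or> 0 < j"
      then show "\<exists>z\<in>pts M. \<exists>k<length (w (snd M z)). (lless M p z \<or> p = z \<and> i < k) \<and> (lless M z q \<or> z = q \<and> k < j)"
        using p q that len_pos by blast
    qed
    show ?thesis
    proof (cases "lless M p q")
      case True
      show ?thesis unfolding ex[OF True] lsuc_def using True False p(2) by auto
    qed (use False in \<open>simp add: lsuc_def\<close>)
  qed
  finally show ?thesis .
qed

end

section \<open>Transfer of atoms to expanded words in a context\<close>

text \<open>When \<open>P\<close> and \<open>Q\<close> lie in the context, \<open>p\<close> and
  \<open>q\<close> are arbitrary; this permits dummy moves in the game on the original
  words.\<close>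

definition same_pos :: "('a \<Rightarrow> 'b list) \<Rightarrow> ('p, 'a) lword \<Rightarrow> 'p \<Rightarrow> 'p \<Rightarrow>
    nat + ('p \<times> nat) + nat \<Rightarrow> nat + ('p \<times> nat) + nat \<Rightarrow> bool" where
  "same_pos w M p q P Q \<longleftrightarrow> (\<exists>i. P = Inl i \<and> Q = Inl i) \<or>
     (\<exists>i<length (w (snd M p)). P = Inr (Inl (p, i)) \<and> Q = Inr (Inl (q, i))) \<or>
     (\<exists>j. P = Inr (Inr j) \<and> Q = Inr (Inr j))"

lemma same_pos_swap: "same_pos w M p q P Q \<Longrightarrow> snd M p = snd N q \<Longrightarrow> same_pos w N q p Q P"
  by (auto simp: same_pos_def)

text \<open>Each implication from \<open>M\<close> to \<open>N\<close> names original atoms into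
  which an expanded atom can decompose. The borders explain the entries for \<open>ASuc\<close>: a
  successor from the left context into the expansion needs an original minimum, and one from the
  expansion into the right context an original maximum. As the original words have positions, the
  two contexts are never adjacent.\<close>

lemma atom_transfer:
  fixes M N :: "('p, 'a) lword" and A :: "('v, 'b) atom" and x y :: "'b list" and w :: "'a \<Rightarrow> 'b list"
  defines "X \<equiv> \<lambda>K. lcontext x w K y"
  assumes w: "\<And>a. w a \<noteq> []" and M: "Linear_order (fst M)" "pts M \<noteq> {}" and N: "Linear_order (fst N)" "pts N \<noteq> {}"
    and pts: "\<And>z. z \<in> V \<Longrightarrow> \<alpha> z \<in> pts M \<and> \<beta> z \<in> pts N \<and> snd M (\<alpha> z) = snd N (\<beta> z)"
    and same: "\<And>z. z \<in> atom_vars A \<Longrightarrow> z \<in> V \<and> same_pos w M (\<alpha> z) (\<beta> z) (\<alpha>' z) (\<beta>' z)"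
    and in_pts: "\<And>z. z \<in> atom_vars A \<Longrightarrow> \<alpha>' z \<in> pts (X M) \<and> \<beta>' z \<in> pts (X N)"
    and eq: "\<And>z z'. A = AEq z z' \<or> A = ASuc z z' \<Longrightarrow> z \<in> V \<Longrightarrow> z' \<in> V \<Longrightarrow> \<alpha> z = \<alpha> z' \<Longrightarrow> \<beta> z = \<beta> z'"
    and less: "\<And>z z'. A = ALess z z' \<or> A = ALeq z z' \<Longrightarrow> z \<in> V \<Longrightarrow> z' \<in> V \<Longrightarrow> lless M (\<alpha> z) (\<alpha> z') \<Longrightarrow> lless N (\<beta> z) (\<beta> z')"
    and leq: "\<And>z z'. A = ALess z z' \<or> A = ALeq z z' \<Longrightarrow> z \<in> V \<Longrightarrow> z' \<in> V \<Longrightarrow> (\<alpha> z, \<alpha> z') \<in> fst M \<Longrightarrow> (\<beta> z, \<beta> z') \<in> fst N"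
    and suc: "\<And>z z'. A = ASuc z z' \<Longrightarrow> z \<in> V \<Longrightarrow> z' \<in> V \<Longrightarrow> lsuc M (\<alpha> z) (\<alpha> z') \<Longrightarrow> lsuc N (\<beta> z) (\<beta> z')"
    and min: "\<And>z z'. A = AMin z \<or> A = ASuc z' z \<Longrightarrow> z \<in> V \<Longrightarrow> lmin M (\<alpha> z) \<Longrightarrow> lmin N (\<beta> z)"
    and max: "\<And>z z'. A = AMax z \<or> A = ASuc z z' \<Longrightarrow> z \<in> V \<Longrightarrow> lmax M (\<alpha> z) \<Longrightarrow> lmax N (\<beta> z)"
    and sat: "gsat_atom (X M) \<alpha>' A"
  shows "gsat_atom (X N) \<beta>' A"
proof -
  interpret M: expansion w M by unfold_locales (fact w M)+
  interpret N: expansion w N by unfold_locales (fact w N)+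
  note X = assms(1)[unfolded lcontext_def]
  \<comment> \<open>\<open>vp\<close> is \<open>same_pos\<close> together with the membership and
    label facts that decide each case.\<close>
  define vp where "vp p q P Q \<longleftrightarrow> (\<exists>i. P = Inl i \<and> Q = Inl i \<and> i \<in> pts (fw x)) \<or>
     (\<exists>i. P = Inr (Inl (p, i)) \<and> Q = Inr (Inl (q, i)) \<and> i < length (w (snd M p)) \<and> i < length (w (snd N q)) \<and>
        p \<in> pts M \<and> q \<in> pts N \<and> snd M p = snd N q) \<or>
     (\<exists>j. P = Inr (Inr j) \<and> Q = Inr (Inr j) \<and> j \<in> pts (fw y))" for p q P Q
  have var: "vp (\<alpha> z) (\<beta> z) (\<alpha>' z) (\<beta>' z)" if "z \<in> atom_vars A" for z
    using same[OF that] in_pts[OF that] pts[of z]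
    unfolding vp_def by (auto simp: same_pos_def X Field_order_sum)
  have V: "z \<in> V" if "z \<in> atom_vars A" for z using same[OF that] by blast
  note lin = lfirst_lmin[OF M(1)] lfirst_lmin[OF N(1)]
  have le: "\<beta> z = \<beta> z' \<or> lless N (\<beta> z) (\<beta> z')"
    if "A = ALess z z' \<or> A = ALeq z z'" "z \<in> V" "z' \<in> V" "\<alpha> z = \<alpha> z' \<or> lless M (\<alpha> z) (\<alpha> z')" for z z'
    using leq[OF that(1-3)] that(4) pts[OF that(2)] M.refl_M unfolding lless_def by auto
  have mem: "(p, i) \<in> pts (lsub w K) \<longleftrightarrow> p \<in> pts K \<and> i < length (w (snd K p))" for K :: "('p, 'a) lword" and p i
    by (simp add: pts_lsub)
  have less_X: "lless (X N) Q Q'"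
    if vp: "vp p q P Q" "vp p' q' P' Q'" and l: "lless (X M) P P'"
      and h: "lless M p p' \<Longrightarrow> lless N q q'" "p = p' \<Longrightarrow> q = q' \<or> lless N q q'" for p q P Q p' q' P' Q'
  proof -
    from vp(1)[unfolded vp_def] show ?thesis
    proof (elim disjE exE conjE)
      fix i assume e: "P = Inl i" "Q = Inl i" "i \<in> pts (fw x)"
      from vp(2)[unfolded vp_def] show ?thesis
        by (elim disjE exE conjE) (use l h e in \<open>simp_all add: X Field_order_sum mem M.pts_lsub_empty N.pts_lsub_empty M(2) N(2) M.lless_lsub N.lless_lsub\<close>)
    next
      fix i assume e: "P = Inr (Inl (p, i))" "Q = Inr (Inl (q, i))" "i < length (w (snd M p))"
        "i < length (w (snd N q))" "p \<in> pts M" "q \<in> pts N" "snd M p = snd N q"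
      from vp(2)[unfolded vp_def] show ?thesis
        by (elim disjE exE conjE) (use l h e in \<open>auto simp: X Field_order_sum mem M.pts_lsub_empty N.pts_lsub_empty M(2) N(2) M.lless_lsub N.lless_lsub\<close>)
    next
      fix i assume e: "P = Inr (Inr i)" "Q = Inr (Inr i)" "i \<in> pts (fw y)"
      from vp(2)[unfolded vp_def] show ?thesis
        by (elim disjE exE conjE) (use l h e in \<open>simp_all add: X Field_order_sum mem M.pts_lsub_empty N.pts_lsub_empty M(2) N(2) M.lless_lsub N.lless_lsub\<close>)
    qed
  qed
  have leq_X: "(Q, Q') \<in> fst (X N)"
    if vp: "vp p q P Q" "vp p' q' P' Q'" and l: "(P, P') \<in> fst (X M)"
      and h: "lless M p p' \<Longrightarrow> lless N q q'" "(p, p') \<in> fst M \<Longrightarrow> (q, q') \<in> fst N" for p q P Q p' q' P' Q'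
  proof -
    from vp(1)[unfolded vp_def] show ?thesis
    proof (elim disjE exE conjE)
      fix i assume e: "P = Inl i" "Q = Inl i" "i \<in> pts (fw x)"
      from vp(2)[unfolded vp_def] show ?thesis
        by (elim disjE exE conjE) (use l h e in \<open>simp_all add: X Field_order_sum mem M.pts_lsub_empty N.pts_lsub_empty M(2) N(2) M.leq_lsub N.leq_lsub split: if_splits\<close>)
    next
      fix i assume e: "P = Inr (Inl (p, i))" "Q = Inr (Inl (q, i))" "i < length (w (snd M p))"
        "i < length (w (snd N q))" "p \<in> pts M" "q \<in> pts N" "snd M p = snd N q"
      from vp(2)[unfolded vp_def] show ?thesis
        by (elim disjE exE conjE) (use l h e in \<open>auto simp: X Field_order_sum mem M.pts_lsub_empty N.pts_lsub_empty M(2) N(2) M.leq_lsub N.leq_lsub split: if_splits\<close>)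
    next
      fix i assume e: "P = Inr (Inr i)" "Q = Inr (Inr i)" "i \<in> pts (fw y)"
      from vp(2)[unfolded vp_def] show ?thesis
        by (elim disjE exE conjE) (use l h e in \<open>simp_all add: X Field_order_sum mem M.pts_lsub_empty N.pts_lsub_empty M(2) N(2) M.leq_lsub N.leq_lsub split: if_splits\<close>)
    qed
  qed
  have suc_X: "lsuc (X N) Q Q'"
    if vp: "vp p q P Q" "vp p' q' P' Q'" and l: "lsuc (X M) P P'"
      and h: "lsuc M p p' \<Longrightarrow> lsuc N q q'"
      "p = p' \<Longrightarrow> q = q'" "lmax M p \<Longrightarrow> lmax N q" "lmin M p' \<Longrightarrow> lmin N q'" for p q P Q p' q' P' Q'
  proof -
    from vp(1)[unfolded vp_def] show ?thesis
    proof (elim disjE exE conjE)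
      fix i assume e: "P = Inl i" "Q = Inl i" "i \<in> pts (fw x)"
      from vp(2)[unfolded vp_def] show ?thesis
        by (elim disjE exE conjE) (use l h e in \<open>simp_all add: X Field_order_sum mem M.pts_lsub_empty N.pts_lsub_empty M(2) N(2) M.lsuc_lsub N.lsuc_lsub M.lfirst_lsub N.lfirst_lsub lin\<close>)
    next
      fix i assume e: "P = Inr (Inl (p, i))" "Q = Inr (Inl (q, i))" "i < length (w (snd M p))"
        "i < length (w (snd N q))" "p \<in> pts M" "q \<in> pts N" "snd M p = snd N q"
      from vp(2)[unfolded vp_def] show ?thesis
        by (elim disjE exE conjE) (use l h e in \<open>auto simp: X Field_order_sum mem M.pts_lsub_empty N.pts_lsub_empty M(2) N(2) M.lsuc_lsub N.lsuc_lsub M.lfirst_lsub N.lfirst_lsub lin\<close>)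
    next
      fix i assume e: "P = Inr (Inr i)" "Q = Inr (Inr i)" "i \<in> pts (fw y)"
      from vp(2)[unfolded vp_def] show ?thesis
        by (elim disjE exE conjE) (use l h e in \<open>simp_all add: X Field_order_sum mem M.pts_lsub_empty N.pts_lsub_empty M(2) N(2) M.lsuc_lsub N.lsuc_lsub M.lfirst_lsub N.lfirst_lsub lin\<close>)
    qed
  qed
  have min_X: "lmin (X N) Q"
    if "vp p q P Q" "lmin (X M) P" "lmin M p \<Longrightarrow> lmin N q" for p q P Q
    using that(1)[unfolded vp_def]
    by (elim disjE exE conjE) (use that(2,3) M(2) N(2) in \<open>auto simp: X M.lmin_lsub N.lmin_lsub M.pts_lsub_empty N.pts_lsub_empty Field_order_sum mem\<close>)
  have max_X: "lmax (X N) Q"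
    if "vp p q P Q" "lmax (X M) P" "lmax M p \<Longrightarrow> lmax N q" for p q P Q
    using that(1)[unfolded vp_def]
    by (elim disjE exE conjE) (use that(2,3) M(2) N(2) in \<open>auto simp: X M.lmin_lsub N.lmin_lsub M.pts_lsub_empty N.pts_lsub_empty Field_order_sum mem\<close>)
  show ?thesis
  proof (cases A)
    case AEmpty
    then show ?thesis using sat M(2) N(2) M.pts_lsub_empty by (simp add: X Field_order_sum)
  next
    case (AEq z z')
    then show ?thesis using sat var[of z] var[of z'] eq[of z z'] V unfolding vp_def by auto
  next
    case (ALetter z a)
    then show ?thesis using sat var[of z] unfolding vp_def by (auto simp: X lsub_simps)
  next
    case (ALess z z')
    then have v: "vp (\<alpha> z) (\<beta> z) (\<alpha>' z) (\<beta>' z)" "vp (\<alpha> z') (\<beta> z') (\<alpha>' z') (\<beta>' z')" "z \<in> V" "z' \<in> V"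
      using var V by simp_all
    show ?thesis unfolding ALess gsat_atom.simps
      by (rule less_X[OF v(1,2) sat[unfolded ALess gsat_atom.simps]])
        (use less[OF _ v(3,4)] le[OF _ v(3,4)] ALess in blast)+
  next
    case (ALeq z z')
    then have v: "vp (\<alpha> z) (\<beta> z) (\<alpha>' z) (\<beta>' z)" "vp (\<alpha> z') (\<beta> z') (\<alpha>' z') (\<beta>' z')" "z \<in> V" "z' \<in> V"
      using var V by simp_all
    show ?thesis unfolding ALeq gsat_atom.simps
      by (rule leq_X[OF v(1,2) sat[unfolded ALeq gsat_atom.simps]])
        (use less[OF _ v(3,4)] leq[OF _ v(3,4)] ALeq in blast)+
  next
    case (ASuc z z')
    then have v: "vp (\<alpha> z) (\<beta> z) (\<alpha>' z) (\<beta>' z)" "vp (\<alpha> z') (\<beta> z') (\<alpha>' z') (\<beta>' z')" "z \<in> V" "z' \<in> V"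
      using var V by simp_all
    show ?thesis unfolding ASuc gsat_atom.simps
      by (rule suc_X[OF v(1,2) sat[unfolded ASuc gsat_atom.simps]])
        (use eq[OF _ v(3,4)] suc[OF _ v(3,4)] max[OF _ v(3)] min[OF _ v(4)] ASuc in blast)+
  next
    case (AMin z)
    then have v: "vp (\<alpha> z) (\<beta> z) (\<alpha>' z) (\<beta>' z)" "z \<in> V" using var V by simp_all
    show ?thesis unfolding AMin gsat_atom.simps
      by (rule min_X[OF v(1) sat[unfolded AMin gsat_atom.simps]]) (use min[OF _ v(2)] AMin in blast)
  next
    case (AMax z)
    then have v: "vp (\<alpha> z) (\<beta> z) (\<alpha>' z) (\<beta>' z)" "z \<in> V" using var V by simp_all
    show ?thesis unfolding AMax gsat_atom.simps
      by (rule max_X[OF v(1) sat[unfolded AMax gsat_atom.simps]]) (use max[OF _ v(2)] AMax in blast)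
  qed (use sat in simp_all)
qed

text \<open>Stated for a set \<open>H\<close> of atoms because it is applied to the atoms of a
  fragment and, with the words exchanged, to the atoms whose negations belong to it.\<close>

lemma atom_set_transfer:
  fixes M N :: "('p, 'a) lword" and A :: "('v, 'a) atom" and x y :: "'a list"
  assumes w: "\<And>a. w a \<noteq> []" and M: "Linear_order (fst M)" "pts M \<noteq> {}" and N: "Linear_order (fst N)" "pts N \<noteq> {}"
    and pts: "\<And>z. z \<in> V \<Longrightarrow> \<alpha> z \<in> pts M \<and> \<beta> z \<in> pts N \<and> snd M (\<alpha> z) = snd N (\<beta> z)"
    and same: "\<And>z. z \<in> atom_vars A \<Longrightarrow> z \<in> V \<and> same_pos w M (\<alpha> z) (\<beta> z) (\<alpha>' z) (\<beta>' z)"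
    and in_pts: "\<And>z. z \<in> atom_vars A \<Longrightarrow>
      \<alpha>' z \<in> pts (lcontext x w M y) \<and> \<beta>' z \<in> pts (lcontext x w N y)"
    and A: "A \<in> H"
    and order: "\<And>z z'. ALess z z' \<in> H \<longleftrightarrow> ALeq z z' \<in> H"
    and suc: "\<And>z z'. ASuc z z' \<in> H \<Longrightarrow> AEq z z' \<in> H \<and> AMax z \<in> H \<and> AMin z' \<in> H"
    and pres: "\<And>B. B \<in> H \<Longrightarrow> atom_vars B \<subseteq> V \<Longrightarrow> gsat_atom M \<alpha> B \<Longrightarrow> gsat_atom N \<beta> B"
    and sat: "gsat_atom (lcontext x w M y) \<alpha>' A"
  shows "gsat_atom (lcontext x w N y) \<beta>' A"
proof (rule atom_transfer[where M = M and N = N and \<alpha> = \<alpha> and \<beta> = \<beta> and V = V, OF w M N pts same in_pts])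
  fix z z'
  show "\<beta> z = \<beta> z'" if "A = AEq z z' \<or> A = ASuc z z'" "z \<in> V" "z' \<in> V" "\<alpha> z = \<alpha> z'"
    using pres[of "AEq z z'"] suc[of z z'] that A by auto
  show "lless N (\<beta> z) (\<beta> z')" if "A = ALess z z' \<or> A = ALeq z z'" "z \<in> V" "z' \<in> V" "lless M (\<alpha> z) (\<alpha> z')"
    using pres[of "ALess z z'"] order[of z z'] that A by auto
  show "(\<beta> z, \<beta> z') \<in> fst N" if "A = ALess z z' \<or> A = ALeq z z'" "z \<in> V" "z' \<in> V" "(\<alpha> z, \<alpha> z') \<in> fst M"
    using pres[of "ALeq z z'"] order[of z z'] that A by auto
  show "lsuc N (\<beta> z) (\<beta> z')" if "A = ASuc z z'" "z \<in> V" "z' \<in> V" "lsuc M (\<alpha> z) (\<alpha> z')"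
    using pres[of "ASuc z z'"] that A by auto
  show "lmin N (\<beta> z)" if "A = AMin z \<or> A = ASuc z' z" "z \<in> V" "lmin M (\<alpha> z)"
    using pres[of "AMin z"] suc[of z' z] that A by auto
  show "lmax N (\<beta> z)" if "A = AMax z \<or> A = ASuc z z'" "z \<in> V" "lmax M (\<alpha> z)"
    using pres[of "AMax z"] suc[of z z'] that A by auto
qed (use sat in auto)

section \<open>Simulating the strategy on expanded words\<close>

definition game_ok :: "('v, 'a) config set \<Rightarrow> ('v, 'a) fm set \<Rightarrow> 'a gword \<Rightarrow> ('v \<rightharpoonup> nat) \<Rightarrow>
    'a gword \<Rightarrow> ('v \<rightharpoonup> nat) \<Rightarrow> bool" where
  "game_ok I G u \<alpha> v \<beta> \<longleftrightarrow> (G, (u, \<alpha>), (v, \<beta>)) \<in> I \<and> fragment G \<and> suc_stable G \<and> order_stable G \<and>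
     dom \<alpha> = dom \<beta> \<and> (\<forall>z\<in>dom \<alpha>. the (\<alpha> z) \<in> positions u \<and> the (\<beta> z) \<in> positions v) \<and>
     wf_word u \<and> wf_word v \<and> positions u \<noteq> {} \<and> positions v \<noteq> {}"

lemma game_literal:
  assumes "dup_inv I" "game_ok I G u \<alpha> v \<beta>" "\<phi> \<in> G" "literal \<phi>" "FV \<phi> \<subseteq> dom \<alpha>"
    and "gsat (gw u) (the \<circ> \<alpha>) \<phi>"
  shows "gsat (gw v) (the \<circ> \<beta>) \<phi>"
proof -
  have "\<not> spoiler_stop (G, (u, \<alpha>), (v, \<beta>))"
    using assms(1,2) unfolding dup_inv_def game_ok_def by blast
  then have "sat u \<alpha> \<phi> \<longrightarrow> sat v \<beta> \<phi>"
    using assms(3-5) unfolding spoiler_stop.simps by blast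
  then show ?thesis using assms(6) by (simp add: sat_gsat)
qed

text \<open>Every fragment contains all letter atoms, so Duplicator cannot survive with a mismatch.
  Equal letters are what lets blocks be matched index by index.\<close>

lemma game_label:
  assumes I: "dup_inv I" and ok: "game_ok I G u \<alpha> v \<beta>" and z: "z \<in> dom \<alpha>"
  shows "letter_at u (the (\<alpha> z)) = letter_at v (the (\<beta> z))"
proof -
  let ?A = "Atom (ALetter z (letter_at u (the (\<alpha> z))))"
  have "fragment G" using ok by (simp add: game_ok_def)
  moreover from this obtain \<phi> where "\<phi> \<in> G" unfolding fragment_def by blast
  ultimately have "?A \<in> G" by (rule fragmentD(3))
  then have "gsat (gw v) (the \<circ> \<beta>) ?A"
    by (rule game_literal[OF I ok]) (use z in \<open>auto simp: literal_def\<close>)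
  then show ?thesis by simp
qed

lemma game_move:
  assumes I: "dup_inv I" and ok: "game_ok I G u \<alpha> v \<beta>"
  shows "Exi z \<chi> \<in> G \<Longrightarrow> p \<in> positions u \<Longrightarrow>
      \<exists>r\<in>positions v. game_ok I (reduct G QEx z) u (\<alpha>(z \<mapsto> p)) v (\<beta>(z \<mapsto> r))" (is "?e \<Longrightarrow> ?pu \<Longrightarrow> ?E")
    and "All z \<chi> \<in> G \<Longrightarrow> p \<in> positions v \<Longrightarrow>
      \<exists>r\<in>positions u. game_ok I (reduct G QAll z) u (\<alpha>(z \<mapsto> r)) v (\<beta>(z \<mapsto> p))" (is "?a \<Longrightarrow> ?pv \<Longrightarrow> ?A")
    and "Neg (Exi z \<chi>) \<in> G \<Longrightarrow> p \<in> positions v \<Longrightarrow>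
      \<exists>r\<in>positions u. game_ok I (reduct G QNegEx z) v (\<beta>(z \<mapsto> p)) u (\<alpha>(z \<mapsto> r))" (is "?ne \<Longrightarrow> ?pv \<Longrightarrow> ?NE")
    and "Neg (All z \<chi>) \<in> G \<Longrightarrow> p \<in> positions u \<Longrightarrow>
      \<exists>r\<in>positions v. game_ok I (reduct G QNegAll z) v (\<beta>(z \<mapsto> r)) u (\<alpha>(z \<mapsto> p))" (is "?na \<Longrightarrow> ?pu \<Longrightarrow> ?NA")
proof -
  let ?c = "(G, (u, \<alpha>), (v, \<beta>))"
  have c: "?c \<in> I" and G: "fragment G" "suc_stable G" "order_stable G" and d: "dom \<alpha> = dom \<beta>"
    "\<And>z. z \<in> dom \<beta> \<Longrightarrow> the (\<alpha> z) \<in> positions u \<and> the (\<beta> z) \<in> positions v"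
    "wf_word u" "wf_word v" "positions u \<noteq> {}" "positions v \<noteq> {}"
    using ok unfolding game_ok_def by auto
  have resp: "\<exists>r. duplicator_legal ?c m r \<and> next_config ?c m r \<in> I" if "spoiler_legal ?c m" for m
    using I c that unfolding dup_inv_def by blast
  have st: "fragment (reduct G Q z)" "suc_stable (reduct G Q z)" "order_stable (reduct G Q z)"
    if "\<chi> \<in> reduct G Q z" for Q
    using fragment_reduct[OF G(1), of Q z] suc_stable_reduct[OF G(2)] order_stable_reduct[OF G(3)] that by blast+
  show ?E if e: ?e ?pu
  proof -
    have m: "\<chi> \<in> reduct G QEx z" using e by (simp add: reduct_def)
    then obtain r where "r \<in> positions v" "(reduct G QEx z, (u, \<alpha>(z \<mapsto> p)), (v, \<beta>(z \<mapsto> r))) \<in> I"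
      using resp[of "(QEx, z, p)"] e(2) by auto
    then show ?thesis using st[OF m] d e(2) by (intro bexI[of _ r]) (auto simp: game_ok_def)
  qed
  show ?A if e: ?a ?pv
  proof -
    have m: "\<chi> \<in> reduct G QAll z" using e by (simp add: reduct_def)
    then obtain r where "r \<in> positions u" "(reduct G QAll z, (u, \<alpha>(z \<mapsto> r)), (v, \<beta>(z \<mapsto> p))) \<in> I"
      using resp[of "(QAll, z, p)"] e(2) by auto
    then show ?thesis using st[OF m] d e(2) by (intro bexI[of _ r]) (auto simp: game_ok_def)
  qed
  show ?NE if e: ?ne ?pv
  proof -
    have m: "\<chi> \<in> reduct G QNegEx z" using e by (simp add: reduct_def)
    then obtain r where "r \<in> positions u" "(reduct G QNegEx z, (v, \<beta>(z \<mapsto> p)), (u, \<alpha>(z \<mapsto> r))) \<in> I"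
      using resp[of "(QNegEx, z, p)"] e(2) by auto
    then show ?thesis using st[OF m] d e(2) by (intro bexI[of _ r]) (auto simp: game_ok_def)
  qed
  show ?NA if e: ?na ?pu
  proof -
    have m: "\<chi> \<in> reduct G QNegAll z" using e by (simp add: reduct_def)
    then obtain r where "r \<in> positions v" "(reduct G QNegAll z, (v, \<beta>(z \<mapsto> r)), (u, \<alpha>(z \<mapsto> p))) \<in> I"
      using resp[of "(QNegAll, z, p)"] e(2) by auto
    then show ?thesis using st[OF m] d e(2) by (intro bexI[of _ r]) (auto simp: game_ok_def)
  qed
qed

text \<open>\<open>\<alpha>\<close> and \<open>\<beta>\<close> are the valuations of the game,
  \<open>\<alpha>'\<close> and \<open>\<beta>'\<close> those of the expanded words. \<open>V\<close>
  will be the set of free variables of the formula at hand, so values left over at other variables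
  are ignored.\<close>

definition vmatch where
  "vmatch x w y u \<alpha> v \<beta> V \<alpha>' \<beta>' \<longleftrightarrow> (\<forall>z\<in>V. z \<in> dom \<alpha> \<and>
     same_pos w (gw u) (the (\<alpha> z)) (the (\<beta> z)) (\<alpha>' z) (\<beta>' z) \<and>
     \<alpha>' z \<in> pts (lcontext x w (gw u) y) \<and> \<beta>' z \<in> pts (lcontext x w (gw v) y))"

text \<open>
  Positions of the context are answered by themselves; the game on the inner words then
  continues with an arbitrary dummy position.
\<close>
lemma base_position:
  assumes P: "P \<in> pts (lcontext x w (gw u) y)" and u: "positions u \<noteq> {}"
  obtains p where "p \<in> positions u"
    "\<And>v r. r \<in> positions v \<Longrightarrow> letter_at u p = letter_at v r \<Longrightarrow>
      \<exists>Q\<in>pts (lcontext x w (gw v) y). same_pos w (gw u) p r P Q"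
proof -
  consider i where "P = Inl i" "i \<in> pts (fw x)"
    | p i where "P = Inr (Inl (p, i))" "p \<in> positions u" "i < length (w (letter_at u p))"
    | j where "P = Inr (Inr j)" "j \<in> pts (fw y)"
    using P by (auto simp: lcontext_def Field_order_sum pts_lsub)
  then show thesis
  proof cases
    case (1 i)
    obtain p where "p \<in> positions u" using u by blast
    then show thesis
      by (rule that) (use 1 in \<open>auto intro!: bexI[of _ "Inl i"] simp: same_pos_def lcontext_def Field_order_sum\<close>)
  next
    case (2 p i)
    show thesis
    proof (rule that[OF 2(2)])
      fix v r assume "r \<in> positions v" "letter_at u p = letter_at v r"
      then show "\<exists>Q\<in>pts (lcontext x w (gw v) y). same_pos w (gw u) p r P Q"
        using 2 by (intro bexI[of _ "Inr (Inl (r, i))"]) (auto simp: same_pos_def lcontext_def Field_order_sum pts_lsub)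
    qed
  next
    case (3 j)
    obtain p where "p \<in> positions u" using u by blast
    then show thesis
      by (rule that) (use 3 in \<open>auto intro!: bexI[of _ "Inr (Inr j)"] simp: same_pos_def lcontext_def Field_order_sum\<close>)
  qed
qed

lemma vmatch_subset:
  "vmatch x w y u \<alpha> v \<beta> V \<alpha>' \<beta>' \<Longrightarrow> V' \<subseteq> V \<Longrightarrow> vmatch x w y u \<alpha> v \<beta> V' \<alpha>' \<beta>'"
  unfolding vmatch_def by blast

lemma vmatch_swap:
  assumes I: "dup_inv I" and ok: "game_ok I G u \<alpha> v \<beta>" and V: "vmatch x w y u \<alpha> v \<beta> V \<alpha>' \<beta>'"
  shows "vmatch x w y v \<beta> u \<alpha> V \<beta>' \<alpha>'"
proof -
  have "dom \<alpha> = dom \<beta>" using ok by (simp add: game_ok_def)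
  then show ?thesis
    using V game_label[OF I ok] same_pos_swap[of w "gw u" _ _ _ _ "gw v"]
    unfolding vmatch_def by auto
qed

lemma vmatch_upd:
  assumes "vmatch x w y u \<alpha> v \<beta> (V - {z}) \<alpha>' \<beta>'" "same_pos w (gw u) p r P Q"
    "P \<in> pts (lcontext x w (gw u) y)" "Q \<in> pts (lcontext x w (gw v) y)"
  shows "vmatch x w y u (\<alpha>(z \<mapsto> p)) v (\<beta>(z \<mapsto> r)) V (\<alpha>'(z := P)) (\<beta>'(z := Q))"
  using assms unfolding vmatch_def by auto

text \<open>Induction on size, because a fragment handles negation by pushing it inwards: the cases
  \<open>Neg (Or _ _)\<close> and \<open>Neg (And _ _)\<close> call the hypothesis for negations
  that are not subformulae. Under a negated quantifier the game exchanges the words, and the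
  hypothesis is used from \<open>v\<close> to \<open>u\<close>.\<close>

lemma game_transfer:
  assumes I: "dup_inv I" and w: "\<And>a. w a \<noteq> []"
  shows "game_ok I G u \<alpha> v \<beta> \<Longrightarrow> \<phi> \<in> G \<Longrightarrow> vmatch x w y u \<alpha> v \<beta> (FV \<phi>) \<alpha>' \<beta>' \<Longrightarrow>
    gsat (lcontext x w (gw u) y) \<alpha>' \<phi> \<Longrightarrow> gsat (lcontext x w (gw v) y) \<beta>' \<phi>"
proof (induction "size \<phi>" arbitrary: \<phi> G u \<alpha> v \<beta> \<alpha>' \<beta>' rule: less_induct)
  case (less \<phi>)
  let ?X = "\<lambda>u. lcontext x w (gw u) y"
  note ok = less.prems(1) and \<phi>G = less.prems(2) and match = less.prems(3) and sat = less.prems(4)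
  have G: "fragment G" "suc_stable G" "order_stable G" and d: "dom \<alpha> = dom \<beta>"
    "\<And>z. z \<in> dom \<alpha> \<Longrightarrow> the (\<alpha> z) \<in> positions u \<and> the (\<beta> z) \<in> positions v"
    and wf: "Linear_order (fst (gw u))" "Linear_order (fst (gw v))" "pts (gw u) \<noteq> {}" "pts (gw v) \<noteq> {}"
    using ok unfolding game_ok_def wf_word_def by auto
  note frag = fragmentD[OF G(1)]
  show ?case
  proof (cases \<phi>)
    case (Atom A)
    have "gsat_atom (?X v) \<beta>' A"
    proof (rule atom_set_transfer[where M = "gw u" and N = "gw v" and \<alpha> = "the \<circ> \<alpha>" and \<beta> = "the \<circ> \<beta>"
          and V = "dom \<alpha>" and H = "{A. Atom A \<in> G}", OF w wf(1,3,2,4)])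
      fix z assume "z \<in> dom \<alpha>"
      then show "(the \<circ> \<alpha>) z \<in> pts (gw u) \<and> (the \<circ> \<beta>) z \<in> pts (gw v) \<and>
          snd (gw u) ((the \<circ> \<alpha>) z) = snd (gw v) ((the \<circ> \<beta>) z)"
        using d(2) game_label[OF I ok] by simp
    next
      fix z z'
      show "ALess z z' \<in> {A. Atom A \<in> G} \<longleftrightarrow> ALeq z z' \<in> {A. Atom A \<in> G}"
        using G(3)[unfolded order_stable_def, rule_format, of Hole] by simp
      show "AEq z z' \<in> {A. Atom A \<in> G} \<and> AMax z \<in> {A. Atom A \<in> G} \<and> AMin z' \<in> {A. Atom A \<in> G}"
        if "ASuc z z' \<in> {A. Atom A \<in> G}"
        using G(2)[unfolded suc_stable_def, THEN conjunct1, rule_format, of Hole] that by simp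
    next
      fix B assume "B \<in> {A. Atom A \<in> G}" "atom_vars B \<subseteq> dom \<alpha>" "gsat_atom (gw u) (the \<circ> \<alpha>) B"
      then show "gsat_atom (gw v) (the \<circ> \<beta>) B"
        using game_literal[OF I ok, of "Atom B"] by (simp add: literal_def)
    qed (use match \<phi>G sat Atom in \<open>auto simp: vmatch_def\<close>)
    then show ?thesis by (simp add: Atom)
  next
    case (Or \<phi>1 \<phi>2)
    then have "vmatch x w y u \<alpha> v \<beta> (FV \<phi>1) \<alpha>' \<beta>'" "vmatch x w y u \<alpha> v \<beta> (FV \<phi>2) \<alpha>' \<beta>'"
      using vmatch_subset[OF match] by simp_all
    then show ?thesis
      using less.hyps[OF _ ok, of \<phi>1 \<alpha>' \<beta>'] less.hyps[OF _ ok, of \<phi>2 \<alpha>' \<beta>'] \<phi>G sat frag(4) Or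
      by auto
  next
    case (And \<phi>1 \<phi>2)
    then have "vmatch x w y u \<alpha> v \<beta> (FV \<phi>1) \<alpha>' \<beta>'" "vmatch x w y u \<alpha> v \<beta> (FV \<phi>2) \<alpha>' \<beta>'"
      using vmatch_subset[OF match] by simp_all
    then show ?thesis
      using less.hyps[OF _ ok, of \<phi>1 \<alpha>' \<beta>'] less.hyps[OF _ ok, of \<phi>2 \<alpha>' \<beta>'] \<phi>G sat frag(5) And
      by auto
  next
    case (Exi z \<chi>)
    then obtain P where P: "P \<in> pts (?X u)" "gsat (?X u) (\<alpha>'(z := P)) \<chi>" using sat by auto
    \<comment> \<open>\<open>P\<close> is projected to \<open>p\<close>, the strategy answers with
      \<open>r\<close>, and \<open>Q\<close> takes the place of \<open>P\<close> inside the block of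
      \<open>r\<close> or in the context.\<close>
    obtain p where p: "p \<in> positions u" "\<And>v r. r \<in> positions v \<Longrightarrow> letter_at u p = letter_at v r \<Longrightarrow>
      \<exists>Q\<in>pts (?X v). same_pos w (gw u) p r P Q"
      using base_position[OF P(1)] wf(3) by (metis gw_simps(1))
    obtain r where r: "r \<in> positions v" "game_ok I (reduct G QEx z) u (\<alpha>(z \<mapsto> p)) v (\<beta>(z \<mapsto> r))"
      using game_move(1)[OF I ok _ p(1)] \<phi>G Exi by blast
    have "letter_at u p = letter_at v r" using game_label[OF I r(2), of z] by simp
    then obtain Q where Q: "Q \<in> pts (?X v)" "same_pos w (gw u) p r P Q" using p(2) r(1) by blast
    have "gsat (?X v) (\<beta>'(z := Q)) \<chi>"
    proof (rule less.hyps[OF _ r(2)])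
      show "\<chi> \<in> reduct G QEx z" using \<phi>G Exi by (simp add: reduct_def)
      show "vmatch x w y u (\<alpha>(z \<mapsto> p)) v (\<beta>(z \<mapsto> r)) (FV \<chi>) (\<alpha>'(z := P)) (\<beta>'(z := Q))"
        by (rule vmatch_upd[OF _ Q(2) P(1) Q(1)]) (use match Exi in simp)
    qed (use P Exi in simp_all)
    then show ?thesis using Q(1) Exi by auto
  next
    case (All z \<chi>)
    \<comment> \<open>Here the challenge \<open>Q\<close> comes from the second word; it is
      projected there and the answer is lifted to the first.\<close>
    have "gsat (?X v) (\<beta>'(z := Q)) \<chi>" if Q: "Q \<in> pts (?X v)" for Q
    proof -
      obtain p where p: "p \<in> positions v" "\<And>u r. r \<in> positions u \<Longrightarrow> letter_at v p = letter_at u r \<Longrightarrow>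
        \<exists>P\<in>pts (?X u). same_pos w (gw v) p r Q P"
        using base_position[OF Q] wf(4) by (metis gw_simps(1))
      obtain r where r: "r \<in> positions u" "game_ok I (reduct G QAll z) u (\<alpha>(z \<mapsto> r)) v (\<beta>(z \<mapsto> p))"
        using game_move(2)[OF I ok _ p(1)] \<phi>G All by blast
      have lab: "letter_at u r = letter_at v p" using game_label[OF I r(2), of z] by simp
      then obtain P where P: "P \<in> pts (?X u)" "same_pos w (gw v) p r Q P" using p(2)[OF r(1)] by auto
      have same: "same_pos w (gw u) r p P Q" using same_pos_swap[OF P(2)] lab by simp
      show ?thesis
      proof (rule less.hyps[OF _ r(2)])
        show "\<chi> \<in> reduct G QAll z" using \<phi>G All by (simp add: reduct_def)
        show "vmatch x w y u (\<alpha>(z \<mapsto> r)) v (\<beta>(z \<mapsto> p)) (FV \<chi>) (\<alpha>'(z := P)) (\<beta>'(z := Q))"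
          by (rule vmatch_upd[OF _ same P(1) Q]) (use match All in simp)
      qed (use P sat All in simp_all)
    qed
    then show ?thesis using All by simp
  next
    case (Neg \<psi>)
    note match' = vmatch_swap[OF I ok match]
    show ?thesis
    proof (cases \<psi>)
      case (Atom A)
      have "gsat_atom (?X u) \<alpha>' A" if asm: "gsat_atom (?X v) \<beta>' A"
      proof (rule atom_set_transfer[where M = "gw v" and N = "gw u" and \<alpha> = "the \<circ> \<beta>" and \<beta> = "the \<circ> \<alpha>"
            and V = "dom \<alpha>" and H = "{A. Neg (Atom A) \<in> G}", OF w wf(2,4,1,3)])
        fix z assume "z \<in> dom \<alpha>"
        then show "(the \<circ> \<beta>) z \<in> pts (gw v) \<and> (the \<circ> \<alpha>) z \<in> pts (gw u) \<and>
            snd (gw v) ((the \<circ> \<beta>) z) = snd (gw u) ((the \<circ> \<alpha>) z)"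
          using d(2) game_label[OF I ok] by simp
      next
        fix z z'
        show "ALess z z' \<in> {A. Neg (Atom A) \<in> G} \<longleftrightarrow> ALeq z z' \<in> {A. Neg (Atom A) \<in> G}"
          using G(3)[unfolded order_stable_def, rule_format, of "CNeg Hole"] by simp
        show "AEq z z' \<in> {A. Neg (Atom A) \<in> G} \<and> AMax z \<in> {A. Neg (Atom A) \<in> G} \<and> AMin z' \<in> {A. Neg (Atom A) \<in> G}"
          if "ASuc z z' \<in> {A. Neg (Atom A) \<in> G}"
          using G(2)[unfolded suc_stable_def, THEN conjunct1, rule_format, of "CNeg Hole"] that by simp
      next
        fix B assume "B \<in> {A. Neg (Atom A) \<in> G}" "atom_vars B \<subseteq> dom \<alpha>" "gsat_atom (gw v) (the \<circ> \<beta>) B"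
        then show "gsat_atom (gw u) (the \<circ> \<alpha>) B"
          using game_literal[OF I ok, of "Neg (Atom B)"] by (auto simp: literal_def)
      qed (use match' d(1) \<phi>G asm Neg Atom in \<open>auto simp: vmatch_def\<close>)
      then show ?thesis using sat by (auto simp: Neg Atom)
    next
      case (Neg \<chi>)
      then show ?thesis
        using less.hyps[OF _ ok, of \<chi>] \<phi>G sat match frag(8) \<open>\<phi> = Neg \<psi>\<close> by simp
    next
      case (Or \<phi>1 \<phi>2)
      then have "vmatch x w y u \<alpha> v \<beta> (FV \<phi>1) \<alpha>' \<beta>'" "vmatch x w y u \<alpha> v \<beta> (FV \<phi>2) \<alpha>' \<beta>'"
        using vmatch_subset[OF match] Neg by simp_all
      then show ?thesis
        using less.hyps[OF _ ok, of "Neg \<phi>1" \<alpha>' \<beta>'] less.hyps[OF _ ok, of "Neg \<phi>2" \<alpha>' \<beta>'] \<phi>G sat frag(6) Or Neg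
        by auto
    next
      case (And \<phi>1 \<phi>2)
      then have "vmatch x w y u \<alpha> v \<beta> (FV \<phi>1) \<alpha>' \<beta>'" "vmatch x w y u \<alpha> v \<beta> (FV \<phi>2) \<alpha>' \<beta>'"
        using vmatch_subset[OF match] Neg by simp_all
      then show ?thesis
        using less.hyps[OF _ ok, of "Neg \<phi>1" \<alpha>' \<beta>'] less.hyps[OF _ ok, of "Neg \<phi>2" \<alpha>' \<beta>'] \<phi>G sat frag(7) And Neg
        by auto
    next
      case (Exi z \<chi>)
      have False if Q: "Q \<in> pts (?X v)" "gsat (?X v) (\<beta>'(z := Q)) \<chi>" for Q
      proof -
        obtain p where p: "p \<in> positions v" "\<And>u r. r \<in> positions u \<Longrightarrow> letter_at v p = letter_at u r \<Longrightarrow>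
          \<exists>P\<in>pts (?X u). same_pos w (gw v) p r Q P"
          using base_position[OF Q(1)] wf(4) by (metis gw_simps(1))
        obtain r where r: "r \<in> positions u" "game_ok I (reduct G QNegEx z) v (\<beta>(z \<mapsto> p)) u (\<alpha>(z \<mapsto> r))"
          using game_move(3)[OF I ok _ p(1)] \<phi>G Neg Exi by blast
        have "letter_at v p = letter_at u r" using game_label[OF I r(2), of z] by simp
        then obtain P where P: "P \<in> pts (?X u)" "same_pos w (gw v) p r Q P" using p(2)[OF r(1)] by auto
        have "gsat (?X u) (\<alpha>'(z := P)) \<chi>"
        proof (rule less.hyps[OF _ r(2)])
          show "\<chi> \<in> reduct G QNegEx z" using \<phi>G Neg Exi by (simp add: reduct_def)
          show "vmatch x w y v (\<beta>(z \<mapsto> p)) u (\<alpha>(z \<mapsto> r)) (FV \<chi>) (\<beta>'(z := Q)) (\<alpha>'(z := P))"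
            by (rule vmatch_upd[OF _ P(2) Q(1) P(1)]) (use match' Neg Exi in simp)
        qed (use Q Neg Exi in simp_all)
        then show False using sat P(1) Neg Exi by auto
      qed
      then show ?thesis using Neg Exi by auto
    next
      case (All z \<chi>)
      then obtain P where P: "P \<in> pts (?X u)" "\<not> gsat (?X u) (\<alpha>'(z := P)) \<chi>" using sat Neg by auto
      obtain p where p: "p \<in> positions u" "\<And>v r. r \<in> positions v \<Longrightarrow> letter_at u p = letter_at v r \<Longrightarrow>
        \<exists>Q\<in>pts (?X v). same_pos w (gw u) p r P Q"
        using base_position[OF P(1)] wf(3) by (metis gw_simps(1))
      obtain r where r: "r \<in> positions v" "game_ok I (reduct G QNegAll z) v (\<beta>(z \<mapsto> r)) u (\<alpha>(z \<mapsto> p))"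
        using game_move(4)[OF I ok _ p(1)] \<phi>G Neg All by blast
      have lab: "letter_at v r = letter_at u p" using game_label[OF I r(2), of z] by simp
      then obtain Q where Q: "Q \<in> pts (?X v)" "same_pos w (gw u) p r P Q" using p(2)[OF r(1)] by auto
      have same: "same_pos w (gw v) r p Q P" using same_pos_swap[OF Q(2)] lab by simp
      have "gsat (?X u) (\<alpha>'(z := P)) \<chi>" if "gsat (?X v) (\<beta>'(z := Q)) \<chi>"
      proof (rule less.hyps[OF _ r(2)])
        show "\<chi> \<in> reduct G QNegAll z" using \<phi>G Neg All by (simp add: reduct_def)
        show "vmatch x w y v (\<beta>(z \<mapsto> r)) u (\<alpha>(z \<mapsto> p)) (FV \<chi>) (\<beta>'(z := Q)) (\<alpha>'(z := P))"
          by (rule vmatch_upd[OF _ same Q(1) P(1)]) (use match' Neg All in simp)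
      qed (use that Neg All in simp_all)
      then show ?thesis using P(2) Q(1) Neg All by auto
    qed
  qed
qed

text \<open>One round against a non-empty finite word already produces a position; 3 is the least
  exponent above \<open>2 ^ 1\<close>.\<close>

lemma positions_eval_rho: "positions (eval_pterm order_rho t) \<noteq> {}"
proof -
  have "EF (Suc 0) (gw (eval_pterm order_rho t)) (fw (fin_eval 3 (\<lambda>a. [a]) t)) {}"
    using ef_equiv_eval_rho[of "Suc 0" 3 t] by (simp add: ef_equiv_def)
  moreover have "fin_eval 3 (\<lambda>a. [a]) t \<noteq> []"
    using fin_eval_nonempty[of "\<lambda>a. [a]" UNIV 3 t] by (simp add: nonempty_words_def)
  then have "1 \<in> pts (fw (fin_eval 3 (\<lambda>a. [a]) t))" by (simp add: positions_finite_word Suc_le_eq)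
  ultimately obtain p where "p \<in> pts (gw (eval_pterm order_rho t))" by (rule EF_back)
  then show ?thesis by auto
qed

lemma duplicator_wins_imp_context:
  fixes w :: "'a \<Rightarrow> 'a list"
  assumes F: "fragment F" "suc_stable F" "order_stable F" and \<phi>: "\<phi> \<in> F" "sentence \<phi>"
    and n: "2 ^ qrank \<phi> < n" and w: "\<And>a. w a \<noteq> []"
    and wins: "duplicator_wins F (eval_pterm order_rho s) (eval_pterm order_rho t)"
    and sat: "sat (finite_word (x @ fin_eval n w s @ y)) Map.empty \<phi>"
  shows "sat (finite_word (x @ fin_eval n w t @ y)) Map.empty \<phi>"
proof -
  let ?u = "eval_pterm order_rho s" and ?v = "eval_pterm order_rho t"
  obtain I where I: "dup_inv I" "(F, (?u, Map.empty), (?v, Map.empty)) \<in> I"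
    using wins unfolding duplicator_wins_iff by blast
  have ok: "game_ok I F ?u Map.empty ?v Map.empty"
    using I F by (simp add: game_ok_def wf_eval_rho positions_eval_rho)
  have FV: "FV \<phi> = {}" using \<phi>(2) by (simp add: sentence_def)
  \<comment> \<open>At the rank of \<open>\<phi>\<close> the finite word is indistinguishable from
    the expanded rho-word in the same context.\<close>
  have "gsat (lcontext x w (gw ?u) y) undefined \<phi>"
    using ef_equiv_gsat[OF ef_equiv_lcontext[OF n] FV] sat sat_sentence[OF \<phi>(2)] by blast
  then have "gsat (lcontext x w (gw ?v) y) undefined \<phi>"
    by (rule game_transfer[OF I(1) w ok \<phi>(1), rotated]) (simp add: vmatch_def FV)
  then show ?thesis
    using ef_equiv_gsat[OF ef_equiv_lcontext[OF n] FV] sat_sentence[OF \<phi>(2)] by blast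
qed

theorem theorem4p2:
  fixes F :: "('v::{countable,infinite}, 'a::{countable,infinite}) fm set"
    and s t :: "'a pterm"
  assumes "fragment F" and "suc_stable F" and "order_stable F"
  shows "(\<forall>A \<phi>. finite A \<and> \<phi> \<in> F \<and> sentence \<phi> \<longrightarrow>
            identity_holds (synt_semigroup A (language A \<phi>)) (synt_mult A (language A \<phi>)) s t)
     \<longleftrightarrow> (duplicator_wins F (eval_pterm order_rho s) (eval_pterm order_rho t) \<and>
          duplicator_wins F (eval_pterm order_rho t) (eval_pterm order_rho s))"
proof
  assume "\<forall>A \<phi>. finite A \<and> \<phi> \<in> F \<and> sentence \<phi> \<longrightarrow>
    identity_holds (synt_semigroup A (language A \<phi>)) (synt_mult A (language A \<phi>)) s t"
  then show "duplicator_wins F (eval_pterm order_rho s) (eval_pterm order_rho t) \<and>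
      duplicator_wins F (eval_pterm order_rho t) (eval_pterm order_rho s)"
    using identities_imp_duplicator_wins[OF assms(1), of s t] by blast
next
  assume wins: "duplicator_wins F (eval_pterm order_rho s) (eval_pterm order_rho t) \<and>
      duplicator_wins F (eval_pterm order_rho t) (eval_pterm order_rho s)"
  show "\<forall>A \<phi>. finite A \<and> \<phi> \<in> F \<and> sentence \<phi> \<longrightarrow>
    identity_holds (synt_semigroup A (language A \<phi>)) (synt_mult A (language A \<phi>)) s t"
  proof (intro allI impI, elim conjE)
    fix A :: "'a set" and \<phi> :: "('v, 'a) fm"
    assume \<phi>: "\<phi> \<in> F" "sentence \<phi>"
    \<comment> \<open>The least exponent above the threshold; by \<open>identity_holds_iff\<close> a
      single such exponent decides the identity.\<close>
    define n :: nat where "n = Suc (2 ^ qrank \<phi>)"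
    have n: "2 ^ qrank \<phi> < n" "0 < n" by (simp_all add: n_def)
    have "(fin_eval n w s, fin_eval n w t) \<in> synt_cong A (language A \<phi>)"
      if w: "\<forall>a. w a \<in> nonempty_words A" for w
    proof -
      have w': "\<And>a. w a \<noteq> []" using w by (auto simp: nonempty_words_def)
      have ne: "fin_eval n w r \<in> nonempty_words A" for r
        using w n(2) by (intro fin_eval_nonempty) auto
      \<comment> \<open>Each of the two games yields one implication.\<close>
      have "sat (finite_word (x @ fin_eval n w s @ y)) Map.empty \<phi> \<longleftrightarrow>
          sat (finite_word (x @ fin_eval n w t @ y)) Map.empty \<phi>" for x y
        using duplicator_wins_imp_context[where w = w, OF assms \<phi> n(1) w'] wins by blast
      then show ?thesis
        using ne[of s] ne[of t] by (auto simp: synt_cong_def language_def nonempty_words_def)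
    qed
    then show "identity_holds (synt_semigroup A (language A \<phi>)) (synt_mult A (language A \<phi>)) s t"
      unfolding identity_holds_iff[OF \<phi>(2) n(1)] by blast
  qed
qed

end
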